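(* Let $\Gamma\subset PSL(3,\mathbb{C})$ be a discrete subgroup and let $\Omega\subset\mathbb{P}^2_{\mathbb{C}}$ be either $Eq(\Gamma)$, or $\Omega(\Gamma)$, or a maximal region where $\Gamma$ acts properly discontinuously. Then $LiG(\Omega)=1,2,3,4$ or $\infty$.
   Context: $PSL(3,\mathbb{C})$ acts on the complex projective plane $\mathbb{P}^2_{\mathbb{C}}$ by projective transformations; a complex line is the image in $\mathbb{P}^2_{\mathbb{C}}$ of a 2-dimensional complex linear subspace of $\mathbb{C}^3$ (minus $0$). Region of proper discontinuity: a non-empty open set $\Omega\subset\mathbb{P}^2_{\mathbb{C}}$ is a region where $\Gamma$ acts properly discontinuously if $\Gamma\Omega=\Omega$ and for each compact $K\subset\Omega$ the set $\{\gamma\in\Gamma:\gamma(K)\cap K\neq\emptyset\}$ is finite. It is maximal if it is not properly contained in another such region. Equicontinuity set: $Eq(\Gamma)$ is the set of points $z\in\mathbb{P}^2_{\mathbb{C}}$ having an open neighborhood $U$ such that $\{\gamma|_U:\gamma\in\Gamma\}$ is a normal family (every sequence has a subsequence converging uniformly on compact subsets of $U$). Kulkarni limit set: a cluster point of a family $\{\gamma A\}_{\gamma\in\Gamma}$ ($A\subset\mathbb{P}^2_{\mathbb{C}}$) is a point each of whose neighborhoods meets $\gamma A$ for infinitely many $\gamma\in\Gamma$. $L_0(\Gamma)$ is the closure of the set of points with infinite isotropy group in $\Gamma$; $L_1(\Gamma)$ is the closure of the set of cluster points of $\Gamma z$, $z$ running over $\mathbb{P}^2_{\mathbb{C}}\setminus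 L_0(\Gamma)$; $L_2(\Gamma)$ is the closure of the set of cluster points of $\Gamma K$, $K$ running over the compact subsets of $\mathbb{P}^2_{\mathbb{C}}\setminus(L_0(\Gamma)\cup L_1(\Gamma))$. $\Lambda(\Gamma)=L_0(\Gamma)\cup L_1(\Gamma)\cup L_2(\Gamma)$ and $\Omega(\Gamma)=\mathbb{P}^2_{\mathbb{C}}\setminus\Lambda(\Gamma)$. For a non-empty open $\Omega\subset\mathbb{P}^2_{\mathbb{C}}$, $LiG(\Omega)$ is the maximal cardinality of a set of complex lines in general position (no three distinct lines of the set share a point) all contained in $\mathbb{P}^2_{\mathbb{C}}\setminus\Omega$; it is $\infty$ if there are such sets of arbitrarily large cardinality.
   Formalization: The discrete subgroup Γ is additionally assumed infinite: for finite Γ, Eq(Γ) = Ω(Γ) = the whole projective plane, which is also the only maximal region, so LiG = 0 and the claim as written fails. *)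

theory Defs
  imports "HOL-Analysis.Analysis" "HOL-Algebra.Coset" "HOL-Library.Extended_Nat"
begin

definition proj_rel :: "complex^3 \<Rightarrow> complex^3 \<Rightarrow> bool" where
  "proj_rel v w \<longleftrightarrow> v \<noteq> 0 \<and> w \<noteq> 0 \<and> (\<exists>c. w = c *s v)"

lemma proj_rel_refl: "v \<noteq> 0 \<Longrightarrow> proj_rel v v"
  unfolding proj_rel_def by (metis vector_smult_lid)

lemma proj_rel_scale: "proj_rel v w \<longleftrightarrow> v \<noteq> 0 \<and> (\<exists>c. c \<noteq> 0 \<and> w = c *s v)"
  unfolding proj_rel_def by auto

lemma part_equivp_proj_rel: "part_equivp proj_rel"
proof (rule part_equivpI)
  have "axis 1 1 \<noteq> (0 :: complex^3)"
    by (simp add: axis_eq_0_iff)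
  then show "\<exists>x. proj_rel x x"
    using proj_rel_refl by blast
  show "symp proj_rel"
  proof (rule sympI)
    fix x y assume "proj_rel x y"
    then obtain c where "x \<noteq> 0" "c \<noteq> 0" "y = c *s x"
      unfolding proj_rel_scale by auto
    then have "x = inverse c *s y" "y \<noteq> 0"
      by (simp_all add: vector_smult_assoc)
    with \<open>x \<noteq> 0\<close> show "proj_rel y x" unfolding proj_rel_def by blast
  qed
  show "transp proj_rel"
    by (rule transpI) (auto simp: proj_rel_def vector_smult_assoc)
qed

quotient_type cp2 = "complex^3" / partial: proj_rel
  by (rule part_equivp_proj_rel)

text \<open>The point \<open>[v]\<close> of the projective plane; only meaningful for \<open>v \<noteq> 0\<close>.\<close>

definition cp2_of :: "complex^3 \<Rightarrow> cp2" where
  "cp2_of v = abs_cp2 v"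

lemma cp2_of_eq_iff: "v \<noteq> 0 \<Longrightarrow> w \<noteq> 0 \<Longrightarrow> cp2_of v = cp2_of w \<longleftrightarrow> (\<exists>c. w = c *s v)"
  using Quotient_rel_abs2[OF Quotient_cp2] Quotient_rel[OF Quotient_cp2, of v w] proj_rel_refl
  unfolding cp2_of_def by (auto simp: proj_rel_def)

lemma cp2_cases: obtains v where "v \<noteq> 0" "x = cp2_of v"
proof -
  have "proj_rel (rep_cp2 x) (rep_cp2 x)" "abs_cp2 (rep_cp2 x) = x"
    using Quotient_cp2 by (simp_all add: Quotient_rep_reflp Quotient_abs_rep)
  then show ?thesis using that[of "rep_cp2 x"] by (auto simp: cp2_of_def proj_rel_def)
qed

text \<open>The matrix of the orthogonal projection of \<open>\<complex>\<^sup>3\<close> onto the line spanned by \<open>v\<close>.\<close>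

definition proj_matrix :: "complex^3 \<Rightarrow> complex^3^3" where
  "proj_matrix v = (\<chi> i j. v $ i * cnj (v $ j) / of_real ((norm v)\<^sup>2))"

lemma norm_vec3_sq: "of_real ((norm (v :: complex^3))\<^sup>2) = (\<Sum>j\<in>UNIV. cnj (v $ j) * v $ j)"
proof -
  have "(norm v)\<^sup>2 = (\<Sum>j\<in>UNIV. (norm (v $ j))\<^sup>2)"
    by (simp add: norm_vec_def L2_set_def sum_nonneg)
  then have "complex_of_real ((norm v)\<^sup>2) = (\<Sum>j\<in>UNIV. of_real ((norm (v $ j))\<^sup>2))"
    by (simp only: of_real_sum)
  then show ?thesis
    unfolding complex_norm_square by (simp only: mult.commute)
qed

lemma proj_matrix_mult_vec:
  "proj_matrix w *v v = ((\<Sum>j\<in>UNIV. cnj (w $ j) * v $ j) / of_real ((norm w)\<^sup>2)) *s w"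
  by (simp add: vec_eq_iff proj_matrix_def matrix_vector_mult_def sum_distrib_left
      sum_distrib_right sum_divide_distrib mult_ac)

lemma proj_matrix_self: "v \<noteq> 0 \<Longrightarrow> proj_matrix v *v v = v"
  unfolding proj_matrix_mult_vec norm_vec3_sq[symmetric] by simp

lemma proj_matrix_scale:
  assumes "c \<noteq> 0" shows "proj_matrix (c *s v) = proj_matrix v"
proof -
  have "of_real ((norm (c *s v))\<^sup>2) = c * cnj c * of_real ((norm v)\<^sup>2)"
    unfolding norm_vec3_sq by (simp add: sum_distrib_left mult_ac)
  then show ?thesis using assms
    by (simp add: proj_matrix_def vec_eq_iff field_simps)
qed

lemma proj_matrix_eqD:
  assumes "v \<noteq> 0" "w \<noteq> 0" "proj_matrix v = proj_matrix w"
  shows "cp2_of v = cp2_of w"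
proof -
  have "v = proj_matrix w *v v" using proj_matrix_self[of v] assms by simp
  then obtain c where "v = c *s w" unfolding proj_matrix_mult_vec by blast
  then show ?thesis using cp2_of_eq_iff[of w v] assms by auto
qed

lift_definition cp2_matrix :: "cp2 \<Rightarrow> complex^3^3" is proj_matrix
  unfolding proj_rel_scale by (auto simp: proj_matrix_scale)

lemma cp2_matrix_of: "v \<noteq> 0 \<Longrightarrow> cp2_matrix (cp2_of v) = proj_matrix v"
  unfolding cp2_of_def by (rule cp2_matrix.abs_eq) (simp add: eq_onp_def proj_rel_refl)

lemma cp2_matrix_inject: "cp2_matrix x = cp2_matrix y \<longleftrightarrow> x = y"
  by (metis cp2_cases cp2_matrix_of proj_matrix_eqD)

lemma continuous_on_proj_matrix: "continuous_on (- {0}) proj_matrix"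
  unfolding proj_matrix_def by (intro continuous_intros) auto

lemma open_cp2_aux:
  "open {v. v \<noteq> 0 \<and> cp2_of v \<in> U} \<longleftrightarrow>
    (\<forall>x\<in>U. \<exists>e>0. \<forall>y. norm (cp2_matrix x - cp2_matrix y) < e \<longrightarrow> y \<in> U)" (is "open ?W \<longleftrightarrow> ?R")
proof
  assume W: "open ?W"
  show ?R
  proof
    fix x assume "x \<in> U"
    obtain v where v: "v \<noteq> 0" "x = cp2_of v" by (rule cp2_cases)
    let ?f = "\<lambda>M :: complex^3^3. M *v v"
    have "continuous_on UNIV ?f"
      unfolding matrix_vector_mult_def by (intro continuous_intros)
    with W have "open (?f -` ?W)" by (rule open_vimage)
    moreover have "cp2_matrix x \<in> ?f -` ?W"
      using v \<open>x \<in> U\<close> by (simp add: cp2_matrix_of proj_matrix_self)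
    ultimately obtain e where e: "e > 0" "\<And>M. dist M (cp2_matrix x) < e \<Longrightarrow> M \<in> ?f -` ?W"
      unfolding open_dist by blast
    have "y \<in> U" if "norm (cp2_matrix x - cp2_matrix y) < e" for y
    proof -
      obtain w where w: "w \<noteq> 0" "y = cp2_of w" by (rule cp2_cases)
      have "dist (cp2_matrix y) (cp2_matrix x) < e"
        using that by (simp add: dist_norm norm_minus_commute)
      from e(2)[OF this] have *: "proj_matrix w *v v \<noteq> 0" "cp2_of (proj_matrix w *v v) \<in> U"
        using w by (simp_all add: cp2_matrix_of)
      obtain c where c: "proj_matrix w *v v = c *s w"
        unfolding proj_matrix_mult_vec by blast
      with * w have "cp2_of w = cp2_of (proj_matrix w *v v)"
        using cp2_of_eq_iff[of w "proj_matrix w *v v"] by blast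
      with * w show ?thesis by simp
    qed
    with e(1) show "\<exists>e>0. \<forall>y. norm (cp2_matrix x - cp2_matrix y) < e \<longrightarrow> y \<in> U" by blast
  qed
next
  assume R: ?R
  show "open ?W"
    unfolding open_dist
  proof
    fix v assume "v \<in> ?W"
    then have v: "v \<noteq> 0" "cp2_of v \<in> U" by auto
    then obtain e where e: "e > 0"
      "\<And>y. norm (cp2_matrix (cp2_of v) - cp2_matrix y) < e \<Longrightarrow> y \<in> U"
      using R by blast
    from continuous_on_proj_matrix v(1) e(1) obtain d where d: "d > 0"
      "\<And>w. w \<in> - {0} \<Longrightarrow> dist w v < d \<Longrightarrow> dist (proj_matrix w) (proj_matrix v) < e"
      unfolding continuous_on_iff by (metis ComplI singletonD)
    have "w \<in> ?W" if "dist w v < min d (norm v)" for w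
    proof -
      have "w \<noteq> 0" using that by (auto simp: dist_norm)
      then show ?thesis using d(2)[of w] e(2)[of "cp2_of w"] that v
        by (simp add: cp2_matrix_of dist_norm norm_minus_commute)
    qed
    then show "\<exists>d>0. \<forall>w. dist w v < d \<longrightarrow> w \<in> ?W"
      using d(1) v(1) by (intro exI[of _ "min d (norm v)"]) auto
  qed
qed

text \<open>
  The topology is the quotient topology of \<open>\<complex>\<^sup>3 - {0}\<close>. It is metrised by the chordal distance
  (the Frobenius distance of the orthogonal projections onto the two lines); as the plane is
  compact, uniform convergence does not depend on the choice of a compatible metric.
\<close>

instantiation cp2 :: metric_space
begin

definition dist_cp2 :: "cp2 \<Rightarrow> cp2 \<Rightarrow> real" where
  "dist_cp2 x y = norm (cp2_matrix x - cp2_matrix y)"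

definition uniformity_cp2 :: "(cp2 \<times> cp2) filter" where
  "uniformity_cp2 = (INF e\<in>{0 <..}. principal {(x, y). dist x y < e})"

definition open_cp2 :: "cp2 set \<Rightarrow> bool" where
  "open_cp2 U \<longleftrightarrow> open {v. v \<noteq> 0 \<and> cp2_of v \<in> U}"

instance
proof
  show unif: "uniformity = (INF e\<in>{0 <..}. principal {(x :: cp2, y). dist x y < e})"
    by (rule uniformity_cp2_def)
  have ev: "eventually P uniformity \<longleftrightarrow> (\<exists>e>0. \<forall>x y :: cp2. dist x y < e \<longrightarrow> P (x, y))" for P
    unfolding unif
    by (subst eventually_INF_base)
      (auto simp: eventually_principal subset_eq intro: bexI[of _ "min _ _"])
  fix U :: "cp2 set"
  show "open U \<longleftrightarrow> (\<forall>x\<in>U. eventually (\<lambda>(x', y). x' = x \<longrightarrow> y \<in> U) uniformity)"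
    unfolding open_cp2_def open_cp2_aux ev dist_cp2_def by auto
next
  fix x y z :: cp2
  show "dist x y = 0 \<longleftrightarrow> x = y"
    by (simp add: dist_cp2_def cp2_matrix_inject)
  show "dist x y \<le> dist x z + dist y z"
    unfolding dist_cp2_def
    using norm_triangle_sub norm_diff_triangle_le[of "cp2_matrix x" "cp2_matrix z" _ "cp2_matrix y"]
    by (metis norm_minus_commute order_refl)
qed

end

definition complex_line :: "cp2 set \<Rightarrow> bool" where
  "complex_line L \<longleftrightarrow> (\<exists>W :: (complex^3) set. vec.subspace W \<and> vec.dim W = 2 \<and> L = cp2_of ` (W - {0}))"

definition SL3 :: "(complex^3^3) monoid" where
  "SL3 = \<lparr>carrier = {A. det A = 1}, mult = (**), one = mat 1\<rparr>"

definition SL3_center :: "(complex^3^3) set" where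
  "SL3_center = {mat c | c. c ^ 3 = 1}"

definition PSL3 :: "(complex^3^3) set monoid" where
  "PSL3 = SL3 Mod SL3_center"

lemma SL3_simps [simp]:
  "carrier SL3 = {A. det A = 1}" "mult SL3 = (**)" "one SL3 = mat 1"
  by (simp_all add: SL3_def)

lemma group_SL3: "group SL3"
proof (rule groupI)
  fix A assume "A \<in> carrier SL3"
  then have A: "det A = 1" by simp
  then have "invertible A" by (simp add: invertible_det_nz)
  then obtain B where B: "B ** A = mat 1" unfolding invertible_def by blast
  then have "det B * det A = 1" using det_mul[of B A] by simp
  with A B show "\<exists>B\<in>carrier SL3. B \<otimes>\<^bsub>SL3\<^esub> A = \<one>\<^bsub>SL3\<^esub>" by auto
qed (simp_all add: det_mul matrix_mul_assoc matrix_mul_lid)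

lemma mat_mult_left: "mat c ** (A :: complex^3^3) = (\<chi> i j. c * A $ i $ j)"
  by (simp add: vec_eq_iff matrix_matrix_mult_def mat_def if_distrib if_distribR sum.delta
      cong: if_cong)

lemma mat_mult_right: "(A :: complex^3^3) ** mat c = (\<chi> i j. c * A $ i $ j)"
  by (simp add: vec_eq_iff matrix_matrix_mult_def mat_def if_distrib if_distribR sum.delta'
      mult.commute cong: if_cong)

lemma mat_mult_vec: "mat c *v (v :: complex^3) = c *s v"
  by (simp add: vec_eq_iff matrix_vector_mult_def mat_def if_distrib if_distribR sum.delta
      cong: if_cong)

lemma det_mat3: "det (mat c :: complex^3^3) = c ^ 3"
  by (simp add: det_3 mat_def power3_eq_cube)

lemma SL3_center_eq: "SL3_center = {Z \<in> carrier SL3. \<forall>A\<in>carrier SL3. Z ** A = A ** Z}"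
proof (intro equalityI subsetI)
  fix Z assume "Z \<in> SL3_center"
  then show "Z \<in> {Z \<in> carrier SL3. \<forall>A\<in>carrier SL3. Z ** A = A ** Z}"
    by (auto simp: SL3_center_def det_mat3 mat_mult_left mat_mult_right)
next
  fix Z assume "Z \<in> {Z \<in> carrier SL3. \<forall>A\<in>carrier SL3. Z ** A = A ** Z}"
  then have Z: "det Z = 1" "\<And>A. det A = 1 \<Longrightarrow> Z ** A = A ** Z" by auto
  define E :: "3 \<Rightarrow> 3 \<Rightarrow> complex^3^3"
    where "E p q = (\<chi> i j. if i = j then 1 else if i = p \<and> j = q then 1 else 0)" for p q
  have "det (E p q) = 1" if "p \<noteq> q" for p q
    using that exhaust_3[of p] exhaust_3[of q] by (auto simp: det_3 E_def)
  then have comm: "(Z ** E p q) $ i $ j = (E p q ** Z) $ i $ j" if "p \<noteq> q" for p q i j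
    using Z(2) that by metis
  note simps = matrix_matrix_mult_def E_def sum_3
  have "Z $ 2 $ 1 = 0" "Z $ 2 $ 3 = 0" "Z $ 1 $ 2 = 0" "Z $ 1 $ 3 = 0" "Z $ 3 $ 1 = 0" "Z $ 3 $ 2 = 0"
    using comm[of 1 2 1 1] comm[of 1 2 1 3] comm[of 2 1 2 2] comm[of 2 1 2 3]
      comm[of 1 3 1 1] comm[of 1 3 1 2]
    by (simp_all add: simps)
  moreover have "Z $ 2 $ 2 = Z $ 1 $ 1" "Z $ 3 $ 3 = Z $ 1 $ 1"
    using comm[of 1 2 1 2] comm[of 1 3 1 3] by (simp_all add: simps)
  ultimately have "Z $ i $ j = (if i = j then Z $ 1 $ 1 else 0)" for i j
    using exhaust_3[of i] exhaust_3[of j] by (elim disjE) simp_all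
  then have "Z = mat (Z $ 1 $ 1)" unfolding vec_eq_iff mat_def vec_lambda_beta by blast
  then obtain c where c: "Z = mat c" by blast
  with Z(1) have "c ^ 3 = 1" by (simp add: det_mat3)
  with c show "Z \<in> SL3_center" unfolding SL3_center_def by blast
qed

lemma normal_SL3_center: "SL3_center \<lhd> SL3"
proof -
  interpret group SL3 by (rule group_SL3)
  have sub: "subgroup SL3_center SL3"
  proof (rule subgroupI)
    show "SL3_center \<subseteq> carrier SL3" by (auto simp: SL3_center_def det_mat3)
    show "SL3_center \<noteq> {}" by (auto simp: SL3_center_def intro!: exI[of _ 1])
  next
    fix A assume "A \<in> SL3_center"
    then obtain c where c: "A = mat c" "c ^ 3 = 1" by (auto simp: SL3_center_def)
    then have "c \<noteq> 0" by auto
    with c have "mat (inverse c) ** A = mat 1"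
      by (simp add: mat_mult_left) (simp add: mat_def vec_eq_iff)
    moreover have "det A = 1" "det (mat (inverse c) :: complex^3^3) = 1"
      using c by (simp_all add: det_mat3 power_inverse)
    ultimately have "inv\<^bsub>SL3\<^esub> A = mat (inverse c)"
      by (intro inv_equality) simp_all
    then show "inv\<^bsub>SL3\<^esub> A \<in> SL3_center"
      using c by (auto simp: SL3_center_def power_inverse)
  next
    fix A B assume "A \<in> SL3_center" "B \<in> SL3_center"
    then obtain c d where c: "A = mat c" "c ^ 3 = 1" "B = mat d" "d ^ 3 = 1"
      by (auto simp: SL3_center_def)
    have "A ** B = mat (c * d)"
      unfolding c mat_mult_left by (simp add: mat_def vec_eq_iff)
    then show "A \<otimes>\<^bsub>SL3\<^esub> B \<in> SL3_center"
      using c by (auto simp: SL3_center_def power_mult_distrib intro!: exI[of _ "c * d"])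
  qed
  show ?thesis
  proof (rule normalI[OF sub], rule ballI)
    fix A assume "A \<in> carrier SL3"
    then show "SL3_center #>\<^bsub>SL3\<^esub> A = A <#\<^bsub>SL3\<^esub> SL3_center"
      unfolding r_coset_def l_coset_def
      by (auto simp: SL3_center_def mat_mult_left mat_mult_right)
  qed
qed

lemma group_PSL3: "group PSL3"
  unfolding PSL3_def by (rule normal.factorgroup_is_group[OF normal_SL3_center])

definition PSL3_topology :: "(complex^3^3) set topology" where
  "PSL3_topology = topology (\<lambda>U. U \<subseteq> carrier PSL3 \<and>
     openin (top_of_set (carrier SL3)) {A \<in> carrier SL3. SL3_center #>\<^bsub>SL3\<^esub> A \<in> U})"

lemma openin_PSL3_topology:
  "openin PSL3_topology U \<longleftrightarrow> U \<subseteq> carrier PSL3 \<and>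
     openin (top_of_set (carrier SL3)) {A \<in> carrier SL3. SL3_center #>\<^bsub>SL3\<^esub> A \<in> U}"
proof -
  let ?q = "\<lambda>U. {A \<in> carrier SL3. SL3_center #>\<^bsub>SL3\<^esub> A \<in> U}"
  let ?op = "\<lambda>U. U \<subseteq> carrier PSL3 \<and> openin (top_of_set (carrier SL3)) (?q U)"
  have "?op (S \<inter> T)" if "?op S" "?op T" for S T
  proof -
    have "?q (S \<inter> T) = ?q S \<inter> ?q T" by blast
    moreover have "openin (top_of_set (carrier SL3)) (?q S \<inter> ?q T)"
      using that by (intro openin_Int) blast+
    moreover have "S \<inter> T \<subseteq> carrier PSL3" using that by blast
    ultimately show ?thesis by (simp only: simp_thms)
  qed
  moreover have "?op (\<Union>\<K>)" if "\<forall>K\<in>\<K>. ?op K" for \<K>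
  proof -
    have "?q (\<Union>\<K>) = (\<Union>K\<in>\<K>. ?q K)" by blast
    moreover have "openin (top_of_set (carrier SL3)) (\<Union>K\<in>\<K>. ?q K)"
      using that by (intro openin_Union) blast
    moreover have "\<Union>\<K> \<subseteq> carrier PSL3" using that by blast
    ultimately show ?thesis by (simp only: simp_thms)
  qed
  ultimately have "istopology ?op" unfolding istopology_def by blast
  then show ?thesis unfolding PSL3_topology_def by (simp only: topology_inverse')
qed

definition discrete_subgroup :: "(complex^3^3) set set \<Rightarrow> bool" where
  "discrete_subgroup \<Gamma> \<longleftrightarrow> subgroup \<Gamma> PSL3 \<and> subtopology PSL3_topology \<Gamma> = discrete_topology \<Gamma>"

text \<open>An element of \<open>PSL3\<close> is a coset \<open>g\<close> of matrices; it acts through any of its representatives.\<close>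

definition act :: "(complex^3^3) set \<Rightarrow> cp2 \<Rightarrow> cp2" where
  "act g x = (THE y. \<exists>A\<in>g. \<exists>v. v \<noteq> 0 \<and> x = cp2_of v \<and> y = cp2_of (A *v v))"

lemma act_coset:
  assumes "det A = 1" "v \<noteq> 0"
  shows "act (SL3_center #>\<^bsub>SL3\<^esub> A) (cp2_of v) = cp2_of (A *v v)"
  unfolding act_def
proof (rule the_equality)
  have "mat 1 ** A \<in> SL3_center #>\<^bsub>SL3\<^esub> A"
    unfolding r_coset_def SL3_center_def by (force intro: exI[of _ "1 :: complex"])
  then show "\<exists>B\<in>SL3_center #>\<^bsub>SL3\<^esub> A. \<exists>w. w \<noteq> 0 \<and> cp2_of v = cp2_of w \<and> cp2_of (A *v v) = cp2_of (B *v w)"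
    using assms by (metis matrix_mul_lid)
next
  fix y
  assume "\<exists>B\<in>SL3_center #>\<^bsub>SL3\<^esub> A. \<exists>w. w \<noteq> 0 \<and> cp2_of v = cp2_of w \<and> y = cp2_of (B *v w)"
  then obtain c w where w: "c ^ 3 = 1" "w \<noteq> 0" "cp2_of v = cp2_of w" "y = cp2_of ((mat c ** A) *v w)"
    by (auto simp: r_coset_def SL3_center_def)
  then obtain d where d: "w = d *s v" using assms cp2_of_eq_iff by blast
  have nz: "B *v u \<noteq> 0" if "det B = 1" "u \<noteq> 0" for B :: "complex^3^3" and u
    using that invertible_det_nz[of B]
    by (metis invertible_def matrix_left_invertible_ker zero_neq_one)
  have "det (mat c ** A) = 1" using w(1) assms(1) by (simp add: det_mul det_mat3)
  moreover have "(mat c ** A) *v w = (c * d) *s (A *v v)"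
    unfolding d matrix_vector_mul_assoc[symmetric] mat_mult_vec
    by (simp add: matrix_vector_mult_scaleR vec.scale vector_smult_assoc)
  ultimately show "y = cp2_of (A *v v)"
    using nz[of "mat c ** A" w] nz[OF assms] w cp2_of_eq_iff[of "A *v v" "(mat c ** A) *v w"] by metis
qed

definition proper_region :: "(complex^3^3) set set \<Rightarrow> cp2 set \<Rightarrow> bool" where
  "proper_region \<Gamma> \<Omega> \<longleftrightarrow> \<Omega> \<noteq> {} \<and> open \<Omega> \<and> (\<Union>\<gamma>\<in>\<Gamma>. act \<gamma> ` \<Omega>) = \<Omega> \<and>
     (\<forall>K. compact K \<and> K \<subseteq> \<Omega> \<longrightarrow> finite {\<gamma> \<in> \<Gamma>. act \<gamma> ` K \<inter> K \<noteq> {}})"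

definition maximal_proper_region :: "(complex^3^3) set set \<Rightarrow> cp2 set \<Rightarrow> bool" where
  "maximal_proper_region \<Gamma> \<Omega> \<longleftrightarrow> proper_region \<Gamma> \<Omega> \<and> (\<nexists>\<Omega>'. proper_region \<Gamma> \<Omega>' \<and> \<Omega> \<subset> \<Omega>')"

definition normal_family_on :: "(cp2 \<Rightarrow> cp2) set \<Rightarrow> cp2 set \<Rightarrow> bool" where
  "normal_family_on F U \<longleftrightarrow> (\<forall>s :: nat \<Rightarrow> cp2 \<Rightarrow> cp2. range s \<subseteq> F \<longrightarrow>
     (\<exists>r f. strict_mono (r :: nat \<Rightarrow> nat) \<and>
        (\<forall>K. compact K \<and> K \<subseteq> U \<longrightarrow> uniform_limit K (s \<circ> r) f sequentially)))"

definition equicontinuity_set :: "(complex^3^3) set set \<Rightarrow> cp2 set" where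
  "equicontinuity_set \<Gamma> = {z. \<exists>U. open U \<and> z \<in> U \<and> normal_family_on (act ` \<Gamma>) U}"

definition cluster_points :: "(complex^3^3) set set \<Rightarrow> cp2 set \<Rightarrow> cp2 set" where
  "cluster_points \<Gamma> A = {x. \<forall>U. open U \<and> x \<in> U \<longrightarrow> infinite {\<gamma> \<in> \<Gamma>. act \<gamma> ` A \<inter> U \<noteq> {}}}"

definition kulkarni_L0 :: "(complex^3^3) set set \<Rightarrow> cp2 set" where
  "kulkarni_L0 \<Gamma> = closure {z. infinite {\<gamma> \<in> \<Gamma>. act \<gamma> z = z}}"

definition kulkarni_L1 :: "(complex^3^3) set set \<Rightarrow> cp2 set" where
  "kulkarni_L1 \<Gamma> = closure (\<Union>z\<in>- kulkarni_L0 \<Gamma>. cluster_points \<Gamma> {z})"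

definition kulkarni_L2 :: "(complex^3^3) set set \<Rightarrow> cp2 set" where
  "kulkarni_L2 \<Gamma> =
     closure (\<Union>K\<in>{K. compact K \<and> K \<subseteq> - (kulkarni_L0 \<Gamma> \<union> kulkarni_L1 \<Gamma>)}. cluster_points \<Gamma> K)"

definition kulkarni_limit_set :: "(complex^3^3) set set \<Rightarrow> cp2 set" where
  "kulkarni_limit_set \<Gamma> = kulkarni_L0 \<Gamma> \<union> kulkarni_L1 \<Gamma> \<union> kulkarni_L2 \<Gamma>"

definition kulkarni_region :: "(complex^3^3) set set \<Rightarrow> cp2 set" where
  "kulkarni_region \<Gamma> = - kulkarni_limit_set \<Gamma>"

definition general_position :: "cp2 set set \<Rightarrow> bool" where
  "general_position S \<longleftrightarrow>
     (\<forall>a\<in>S. \<forall>b\<in>S. \<forall>c\<in>S. a \<noteq> b \<and> b \<noteq> c \<and> a \<noteq> c \<longrightarrow> a \<inter> b \<inter> c = {})"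

text \<open>
  Finite sets of lines suffice: an infinite set of lines in general position has finite subsets
  of every cardinality, all in general position, so the supremum is then \<open>\<infinity>\<close>.
\<close>

definition LiG :: "cp2 set \<Rightarrow> enat" where
  "LiG \<Omega> = Sup {enat (card S) | S. finite S \<and> (\<forall>L\<in>S. complex_line L) \<and>
     general_position S \<and> \<Union>S \<subseteq> - \<Omega>}"

end

theory Submission
  imports Defs
begin

text \<open>
  Rescaled sequences of distinct elements of \<open>\<Gamma>\<close> subconverge to singular matrices \<open>T\<close>; let \<open>K\<close> be the
  union of the projectivised kernels of these limits. Off \<open>K\<close> the group acts equicontinuously and
  properly, and \<open>Eq(\<Gamma>)\<close> is exactly the complement of \<open>K\<close>. Both \<open>\<Omega>(\<Gamma>)\<close> and every maximal region of
  proper discontinuity contain the complement of \<open>K\<close>, the latter because adding that complement to a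
  region of proper discontinuity gives another one. So in all cases the complement of \<open>\<Omega>\<close> is an
  invariant subset of \<open>K\<close>.

  A limit \<open>T\<close> of rank one has a line as kernel. If \<open>\<Omega>\<close> meets that line in a point \<open>z\<close>, then, for suitable
  \<open>x\<^sub>n \<rightarrow> z\<close>, the points \<open>\<gamma>\<^sub>n x\<^sub>n\<close> accumulate at any prescribed point of a certain other line, which
  therefore misses \<open>\<Omega>\<close>. Hence \<open>LiG(\<Omega>) \<ge> 1\<close>.

  If \<open>LiG(\<Omega>)\<close> were finite and at least five, all lines in the complement of \<open>\<Omega>\<close> would pass through
  finitely many points, and a subgroup of finite index would fix three points. If these are not
  collinear the subgroup is diagonal and \<open>K\<close> lies in a triangle; if they are collinear, it fixes a line
  pointwise, and either \<open>K\<close> lies in that line or there is a fixed point off the line. So \<open>K\<close> lies in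
  three lines and cannot contain five.
\<close>

section \<open>Linear algebra in dimension three\<close>

text \<open>The set K of the overview is \<open>KER\<close> in the code. A limit of a sequence is
  always paired with a limit of the inverses, and each maps into the kernel of the other. So if
  moving points have images tending to a point outside \<open>KER\<close>, the limit of the moving
  points is already reached along the orbit of that one point. This is why joining the complement of
  \<open>KER\<close> to a region of proper discontinuity creates no new recurrence. On the other
  hand, any neighbourhood of a kernel point is spread along a whole line, which destroys
  equicontinuity there and also produces the omitted line. The bound four comes from a count. In
  general position a point lies on at most two lines of the configuration. With five lines, either
  at least three points carry infinitely many omitted lines, or two do and some line avoids both, or
  three lines avoid all such points; each case yields three fixed points. With four lines the count
  guarantees only two. Discreteness is needed again when the three points are collinear, since
  fixing a line pointwise does not by itself confine the kernels.\<close>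

definition dot3 :: "complex^3 \<Rightarrow> complex^3 \<Rightarrow> complex" where
  "dot3 a v = a $ 1 * v $ 1 + a $ 2 * v $ 2 + a $ 3 * v $ 3"

text \<open>Both products are bilinear, without conjugation, so \<open>dot3 (cross x y) w\<close> is
  the determinant with rows \<open>x\<close>, \<open>y\<close>, \<open>w\<close>, and a vector
  serves as a point or as a linear form. \<open>cross\<close> gives the line through two points and,
  dually, the common point of two lines.\<close>

definition cross :: "complex^3 \<Rightarrow> complex^3 \<Rightarrow> complex^3" where
  "cross x y = vector [x $ 2 * y $ 3 - x $ 3 * y $ 2, x $ 3 * y $ 1 - x $ 1 * y $ 3,
     x $ 1 * y $ 2 - x $ 2 * y $ 1]"

lemma dot3_add: "dot3 a (v + w) = dot3 a v + dot3 a w"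
  and dot3_scale: "dot3 a (c *s v) = c * dot3 a v"
  and dot3_scale_left: "dot3 (c *s a) v = c * dot3 a v"
  and dot3_diff: "dot3 a (v - w) = dot3 a v - dot3 a w"
  and dot3_zero [simp]: "dot3 a 0 = 0"
  and dot3_zero_left [simp]: "dot3 0 v = 0"
  and dot3_commute: "dot3 a v = dot3 v a"
  by (simp_all add: dot3_def algebra_simps)

lemma dot3_cross [simp]: "dot3 (cross x y) x = 0" "dot3 (cross x y) y = 0"
  by (simp_all add: dot3_def cross_def algebra_simps)

lemma dot3_nonzero:
  assumes "a \<noteq> 0" obtains v where "dot3 a v = 1" "v \<noteq> 0"
proof -
  obtain i where i: "a $ i \<noteq> 0" using assms by (auto simp: vec_eq_iff)
  have "dot3 a (axis i (1 / a $ i)) = 1"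
    using i exhaust_3[of i] by (auto simp: dot3_def axis_def)
  then show ?thesis using that dot3_zero by fastforce
qed

lemma cross_eq_0D:
  assumes "cross x y = 0" "x \<noteq> 0" shows "\<exists>c. y = c *s x"
proof -
  have e: "x $ 2 * y $ 3 = x $ 3 * y $ 2" "x $ 3 * y $ 1 = x $ 1 * y $ 3" "x $ 1 * y $ 2 = x $ 2 * y $ 1"
    using assms(1) by (auto simp: cross_def vec_eq_iff forall_3)
  obtain i where i: "x $ i \<noteq> 0" using assms by (auto simp: vec_eq_iff)
  have "y = (y $ i / x $ i) *s x"
    using i e exhaust_3[of i] by (auto simp: vec_eq_iff forall_3 field_simps)
  then show ?thesis ..
qed

lemma cross_scale: "cross x (c *s x) = 0"
  by (simp add: cross_def vec_eq_iff forall_3)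

lemma cross_eq_0_iff:
  assumes "v \<noteq> 0" "w \<noteq> 0" shows "cross v w = 0 \<longleftrightarrow> cp2_of v = cp2_of w"
  using cross_eq_0D[of v w] cross_scale assms by (auto simp: cp2_of_eq_iff)

text \<open>Cramer's rule with the denominator cleared, so that it also holds for dependent
  \<open>x\<close>, \<open>y\<close>, \<open>w\<close>.\<close>

lemma cramer:
  "dot3 (cross x y) w *s v =
     dot3 (cross y w) v *s x + dot3 (cross w x) v *s y + dot3 (cross x y) v *s w"
  by (simp add: dot3_def cross_def vec_eq_iff forall_3 algebra_simps)

lemma span_of_cross:
  assumes "cross x y \<noteq> 0" "dot3 (cross x y) v = 0"
  shows "\<exists>\<alpha> \<beta>. v = \<alpha> *s x + \<beta> *s y"
proof -
  obtain w where w: "dot3 (cross x y) w = 1" using dot3_nonzero assms(1) by metis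
  then show ?thesis using cramer[of x y w v] assms(2) by auto
qed

lemma basis_of_cross:
  assumes "dot3 (cross x y) w \<noteq> 0"
  shows "\<exists>\<alpha> \<beta> \<gamma>. v = \<alpha> *s x + \<beta> *s y + \<gamma> *s w"
proof -
  let ?d = "dot3 (cross x y) w"
  have "v = inverse ?d *s (?d *s v)" using assms by simp
  also have "\<dots> = (inverse ?d * dot3 (cross y w) v) *s x + (inverse ?d * dot3 (cross w x) v) *s y
      + (inverse ?d * dot3 (cross x y) v) *s w"
    by (simp only: cramer[of x y w v] vector_add_ldistrib vector_smult_assoc)
  finally show ?thesis by blast
qed

text \<open>The double product identity makes \<open>cross a (cross x y)\<close> vanish, so the two
  normals are parallel.\<close>

lemma normal_unique:
  assumes "a \<noteq> 0" "dot3 a x = 0" "dot3 a y = 0"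
  shows "\<exists>c. cross x y = c *s a"
proof -
  have "cross a (cross x y) = dot3 a y *s x - dot3 a x *s y"
    by (simp add: dot3_def cross_def vec_eq_iff forall_3 algebra_simps)
  then show ?thesis using assms cross_eq_0D by simp
qed

lemma normal_basis:
  assumes "a \<noteq> 0"
  obtains x y where "cross x y \<noteq> 0" "dot3 a x = 0" "dot3 a y = 0"
proof -
  obtain i where i: "a $ i \<noteq> 0" using assms by (auto simp: vec_eq_iff)
  note s = dot3_def cross_def vec_eq_iff forall_3
  consider "i = 1" | "i = 2" | "i = 3" using exhaust_3 by blast
  then show ?thesis
  proof cases
    case 1 show ?thesis
      by (rule that[of "vector [- a$2, a$1, 0]" "vector [- a$3, 0, a$1]"]) (use i 1 in \<open>auto simp: s\<close>)
  next
    case 2 show ?thesis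
      by (rule that[of "vector [a$2, - a$1, 0]" "vector [0, - a$3, a$2]"]) (use i 2 in \<open>auto simp: s\<close>)
  next
    case 3 show ?thesis
      by (rule that[of "vector [a$3, 0, - a$1]" "vector [0, a$3, - a$2]"]) (use i 3 in \<open>auto simp: s\<close>)
  qed
qed

lemma dot3_span_0:
  assumes "a \<noteq> 0" "dot3 a x = 0" "dot3 a y = 0" "cross x y \<noteq> 0"
  shows "dot3 a v = 0 \<longleftrightarrow> (\<exists>\<alpha> \<beta>. v = \<alpha> *s x + \<beta> *s y)"
proof
  assume v: "dot3 a v = 0"
  obtain c where c: "cross x y = c *s a" using normal_unique assms by blast
  with v have "dot3 (cross x y) v = 0" by (simp add: dot3_scale_left)
  then show "\<exists>\<alpha> \<beta>. v = \<alpha> *s x + \<beta> *s y" using span_of_cross assms by blast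
qed (use assms in \<open>auto simp: dot3_add dot3_scale\<close>)

section \<open>Projective lines as zero sets of linear forms\<close>

definition pline :: "complex^3 \<Rightarrow> cp2 set" where
  "pline a = {cp2_of v | v. v \<noteq> 0 \<and> dot3 a v = 0}"

lemma cp2_of_in_pline: "v \<noteq> 0 \<Longrightarrow> cp2_of v \<in> pline a \<longleftrightarrow> dot3 a v = 0"
  unfolding pline_def by (auto simp: cp2_of_eq_iff dot3_scale)

lemma complex_line_iff: "complex_line L \<longleftrightarrow> (\<exists>a. a \<noteq> 0 \<and> L = pline a)"
proof
  assume "complex_line L"
  then obtain W :: "(complex^3) set" where W: "vec.subspace W" "vec.dim W = 2" "L = cp2_of ` (W - {0})"
    unfolding complex_line_def by blast
  obtain B where B: "B \<subseteq> W" "vec.independent B" "W \<subseteq> vec.span B" "card B = 2"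
    using vec.basis_exists[of W] W(2) by metis
  then have WB: "W = vec.span B" using W(1) by (metis vec.span_minimal subset_antisym)
  obtain x y where xy: "B = {x, y}" "x \<noteq> y" using B(4) card_2_iff by metis
  have "x \<noteq> 0" using B(2) xy vec.dependent_zero by blast
  have "cross x y \<noteq> 0"
  proof
    assume "cross x y = 0"
    then obtain c where "y = c *s x" using cross_eq_0D \<open>x \<noteq> 0\<close> by blast
    moreover have "c *s x \<in> vec.span (B - {y})"
      by (rule vec.span_scale, rule vec.span_base) (use xy in auto)
    ultimately show False using B(2) xy unfolding vec.dependent_def by blast
  qed
  have "W = {v. dot3 (cross x y) v = 0}"
    unfolding WB xy(1) vec.span_insert vec.span_singleton
    using dot3_span_0[OF \<open>cross x y \<noteq> 0\<close> _ _ \<open>cross x y \<noteq> 0\<close>]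
    by (auto simp: algebra_simps)
  then have "L = pline (cross x y)" unfolding W(3) pline_def by auto
  with \<open>cross x y \<noteq> 0\<close> show "\<exists>a. a \<noteq> 0 \<and> L = pline a" by blast
next
  assume "\<exists>a. a \<noteq> 0 \<and> L = pline a"
  then obtain a where a: "a \<noteq> 0" "L = pline a" by blast
  obtain x y where xy: "cross x y \<noteq> 0" "dot3 a x = 0" "dot3 a y = 0" using normal_basis a by blast
  let ?W = "{v. dot3 a v = 0}"
  have sub: "vec.subspace ?W"
    by (rule vec.subspaceI) (auto simp: dot3_add dot3_scale)
  have "x \<noteq> 0" using xy(1) by (auto simp: cross_def vec_eq_iff forall_3)
  have "x \<noteq> y" using xy(1) cross_scale[of x 1] by (auto)
  have W: "?W \<subseteq> vec.span {x, y}"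
  proof
    fix v assume "v \<in> ?W"
    then obtain \<alpha> \<beta> where "v = \<alpha> *s x + \<beta> *s y"
      using dot3_span_0[OF a(1) xy(2,3,1)] by blast
    moreover have "\<alpha> *s x \<in> vec.span {x, y}" "\<beta> *s y \<in> vec.span {x, y}"
      by (rule vec.span_scale, rule vec.span_base, simp)+
    ultimately show "v \<in> vec.span {x, y}" using vec.span_add by blast
  qed
  have "y \<notin> range (\<lambda>c. c *s x)" using xy(1) cross_scale by auto
  then have "vec.independent {y, x}"
    using \<open>x \<noteq> 0\<close> vec.independent_insert[of y "{x}"] by (simp add: vec.span_singleton)
  then have "vec.independent {x, y}" by (simp add: insert_commute)
  then have "vec.dim ?W = 2"
    using vec.dim_unique[of "{x,y}" ?W] W xy \<open>x \<noteq> y\<close> by (auto simp: card_2_iff)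
  then show "complex_line L" unfolding complex_line_def using sub a(2)
    by (intro exI[of _ ?W]) (auto simp: pline_def)
qed

section \<open>Points and lines of the projective plane\<close>

lemma line_through:
  assumes "x \<noteq> y" obtains L where "complex_line L" "x \<in> L" "y \<in> L"
proof -
  obtain v w where vw: "v \<noteq> 0" "x = cp2_of v" "w \<noteq> 0" "y = cp2_of w" using cp2_cases by metis
  then have "cross v w \<noteq> 0" using assms cross_eq_0_iff by blast
  then show ?thesis
    using that[of "pline (cross v w)"] vw by (auto simp: complex_line_iff cp2_of_in_pline)
qed

lemma line_unique:
  assumes "complex_line L" "complex_line M" "x \<noteq> y" "x \<in> L" "y \<in> L" "x \<in> M" "y \<in> M"
  shows "L = M"
proof -
  obtain v w where vw: "v \<noteq> 0" "x = cp2_of v" "w \<noteq> 0" "y = cp2_of w" using cp2_cases by metis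
  then have c: "cross v w \<noteq> 0" using assms cross_eq_0_iff by blast
  have "N = cp2_of ` ({u. \<exists>\<alpha> \<beta>. u = \<alpha> *s v + \<beta> *s w} - {0})"
    if "complex_line N" "x \<in> N" "y \<in> N" for N
  proof -
    obtain a where "a \<noteq> 0" "N = pline a" using \<open>complex_line N\<close> complex_line_iff by blast
    then have "dot3 a u = 0 \<longleftrightarrow> (\<exists>\<alpha> \<beta>. u = \<alpha> *s v + \<beta> *s w)" for u
      using that vw c by (intro dot3_span_0) (auto simp: cp2_of_in_pline)
    then show ?thesis using \<open>N = pline a\<close> by (auto simp: pline_def)
  qed
  from this[OF assms(1,4,5)] this[OF assms(2,6,7)] show ?thesis by simp
qed

lemma lines_meet:
  assumes "complex_line L" "complex_line M" obtains x where "x \<in> L" "x \<in> M"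
proof -
  obtain a b where ab: "a \<noteq> 0" "b \<noteq> 0" "L = pline a" "M = pline b"
    using assms complex_line_iff by metis
  show ?thesis
  proof (cases "cross a b = 0")
    case False
    have "cp2_of (cross a b) \<in> L \<inter> M"
      using False ab by (simp add: cp2_of_in_pline dot3_commute[of _ "cross a b"])
    then show ?thesis using that by blast
  next
    case True
    then obtain c where c: "b = c *s a" using cross_eq_0D ab by blast
    obtain x y where "cross x y \<noteq> 0" "dot3 a x = 0" using normal_basis ab by metis
    then have "x \<noteq> 0" by (auto simp: cross_def vec_eq_iff forall_3)
    then have "cp2_of x \<in> L \<inter> M" using ab c \<open>dot3 a x = 0\<close>
      by (simp add: cp2_of_in_pline dot3_scale_left)
    then show ?thesis using that by blast
  qed
qed

text \<open>The vectors \<open>p + t *s q\<close> parametrise injectively the line through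
  \<open>p\<close> and \<open>q\<close> without \<open>q\<close>. This shows that lines are
  infinite, and later that a blow-up has more than one limit.\<close>

lemma affine_points_distinct:
  assumes "cross p q \<noteq> 0" shows "p + t *s q \<noteq> 0"
    and "cp2_of (p + t *s q) = cp2_of (p + s *s q) \<Longrightarrow> t = s"
    and "cp2_of (p + t *s q) \<noteq> cp2_of q"
proof -
  have c: "cross (p + t *s q) (p + s *s q) = (s - t) *s cross p q" for t s
    by (simp add: cross_def vec_eq_iff forall_3 algebra_simps)
  have c': "cross (p + t *s q) q = cross p q" for t
    by (simp add: cross_def vec_eq_iff forall_3 algebra_simps)
  have q: "q \<noteq> 0" using assms by (auto simp: cross_def vec_eq_iff forall_3)
  show nz: "p + t *s q \<noteq> 0" for t
    using c'[of t] assms by (auto simp: cross_def vec_eq_iff forall_3)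
  show "t = s" if "cp2_of (p + t *s q) = cp2_of (p + s *s q)"
    using that cross_eq_0_iff[OF nz nz, of t s] c[of t s] assms by simp
  show "cp2_of (p + t *s q) \<noteq> cp2_of q"
    using cross_eq_0_iff[OF nz q, of t] c'[of t] assms by simp
qed

lemma line_infinite:
  assumes "complex_line L" shows "infinite L"
proof -
  obtain a where a: "a \<noteq> 0" "L = pline a" using assms complex_line_iff by blast
  obtain x y where xy: "cross x y \<noteq> 0" "dot3 a x = 0" "dot3 a y = 0" using normal_basis a by blast
  have "inj (\<lambda>t. cp2_of (x + t *s y))"
    using affine_points_distinct(2)[OF xy(1)] by (auto intro: injI)
  moreover have "range (\<lambda>t. cp2_of (x + t *s y)) \<subseteq> L"
    using a(2) xy affine_points_distinct(1)[OF xy(1)]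
    by (auto simp: cp2_of_in_pline dot3_add dot3_scale)
  moreover have "infinite (UNIV :: complex set)" by (simp add: infinite_UNIV_char_0)
  ultimately show ?thesis using finite_subset finite_imageD by metis
qed

text \<open>Distinct lines share at most one point and a line is infinite, so finitely many other
  lines cannot cover it. This turns a covering of \<open>KER\<close> by three lines into a bound on
  the number of lines.\<close>

lemma line_in_finite_Union:
  assumes "complex_line L" "finite M" "\<And>m. m \<in> M \<Longrightarrow> complex_line m" "L \<subseteq> \<Union>M"
  shows "L \<in> M"
proof (rule ccontr)
  assume "L \<notin> M"
  have "finite (L \<inter> m)" if "m \<in> M" for m
  proof -
    have "x = y" if "x \<in> L \<inter> m" "y \<in> L \<inter> m" for x y
      using line_unique[of L m x y] assms \<open>m \<in> M\<close> \<open>L \<notin> M\<close> that by auto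
    then have "\<exists>z. L \<inter> m \<subseteq> {z}" by blast
    then show ?thesis using finite_subset by auto
  qed
  then have "finite (\<Union>m\<in>M. L \<inter> m)" using assms(2) by blast
  moreover have "(\<Union>m\<in>M. L \<inter> m) = L" using assms(4) by blast
  ultimately show False using line_infinite assms(1) by simp
qed

section \<open>The action of matrices on the projective plane\<close>

definition papp :: "complex^3^3 \<Rightarrow> cp2 \<Rightarrow> cp2" where
  "papp A x = cp2_of (A *v rep_cp2 x)"

definition pker :: "complex^3^3 \<Rightarrow> cp2 set" where
  "pker T = {x. T *v rep_cp2 x = 0}"

lemma rep_cp2: "rep_cp2 x \<noteq> 0" "cp2_of (rep_cp2 x) = x"
  using Quotient_rep_reflp[OF Quotient_cp2, of x] Quotient_abs_rep[OF Quotient_cp2, of x]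
  by (auto simp: cp2_of_def proj_rel_def)

lemma rep_cp2_of: "v \<noteq> 0 \<Longrightarrow> \<exists>c. c \<noteq> 0 \<and> rep_cp2 (cp2_of v) = c *s v"
  using rep_cp2[of "cp2_of v"] cp2_of_eq_iff[of v "rep_cp2 (cp2_of v)"] by auto

lemma cp2_of_scale: "c \<noteq> 0 \<Longrightarrow> v \<noteq> 0 \<Longrightarrow> cp2_of (c *s v) = cp2_of v"
  using cp2_of_eq_iff[of v "c *s v"] by auto

lemma cp2_of_scale0: "c \<noteq> 0 \<Longrightarrow> cp2_of (c *s v) = cp2_of v"
  by (cases "v = 0") (auto simp: cp2_of_scale)

lemma scaleR_complex_vec: "(r::real) *\<^sub>R (v :: complex^3) = complex_of_real r *s v"
  unfolding vec_eq_iff vector_scaleR_component vector_smult_component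
  by (simp add: scaleR_conv_of_real)

lemma cp2_of_scaleR: "r \<noteq> 0 \<Longrightarrow> cp2_of (r *\<^sub>R v) = cp2_of v"
  by (simp add: scaleR_complex_vec cp2_of_scale0)

lemma papp_cp2_of: "v \<noteq> 0 \<Longrightarrow> papp A (cp2_of v) = cp2_of (A *v v)"
  using rep_cp2_of[of v] by (auto simp: papp_def vec.scale cp2_of_scale0)

lemma cp2_of_in_pker: "v \<noteq> 0 \<Longrightarrow> cp2_of v \<in> pker T \<longleftrightarrow> T *v v = 0"
  using rep_cp2_of[of v] by (auto simp: pker_def vec.scale)

lemma papp_mult:
  assumes "x \<notin> pker B" shows "papp (A ** B) x = papp A (papp B x)"
proof -
  obtain v where "v \<noteq> 0" "x = cp2_of v" by (rule cp2_cases)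
  then show ?thesis using assms
    by (simp add: papp_cp2_of cp2_of_in_pker matrix_vector_mul_assoc)
qed

lemma papp_one [simp]: "papp (mat 1) x = x"
  by (simp add: papp_def rep_cp2)

text \<open>The adjugate: the inverse in determinant one, but polynomial in the entries, so that it
  passes to limits by continuity.\<close>

definition adj3 :: "complex^3^3 \<Rightarrow> complex^3^3" where
  "adj3 A = transpose (vector [cross (A $ 2) (A $ 3), cross (A $ 3) (A $ 1), cross (A $ 1) (A $ 2)])"

lemma adj3_right: "A ** adj3 A = mat (det A)"
  by (simp add: vec_eq_iff forall_3 matrix_matrix_mult_def sum_3 adj3_def transpose_def cross_def
      mat_def det_3 algebra_simps)

lemma adj3_left: "adj3 A ** A = mat (det A)"
  by (simp add: vec_eq_iff forall_3 matrix_matrix_mult_def sum_3 adj3_def transpose_def cross_def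
      mat_def det_3 algebra_simps)

lemma adj3_inverse:
  assumes "det A = 1"
  shows "A ** adj3 A = mat 1" "adj3 A ** A = mat 1" "det (adj3 A) = 1"
    "adj3 A *v (A *v v) = v" "A *v (adj3 A *v v) = v" "A *v v = 0 \<longleftrightarrow> v = 0" "adj3 (adj3 A) = A"
proof -
  show 1: "A ** adj3 A = mat 1" and 2: "adj3 A ** A = mat 1"
    using assms by (simp_all add: adj3_right adj3_left)
  show d: "det (adj3 A) = 1" using arg_cong[OF 1, of det] assms by (simp add: det_mul)
  show "adj3 A *v (A *v v) = v" "A *v (adj3 A *v v) = v"
    by (simp_all add: matrix_vector_mul_assoc 1 2)
  then show "A *v v = 0 \<longleftrightarrow> v = 0" by (metis vec.zero)
  show "adj3 (adj3 A) = A"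
    using arg_cong[OF 1, of "\<lambda>B. B ** adj3 (adj3 A)"] adj3_right[of "adj3 A"] d
    by (simp add: matrix_mul_assoc[symmetric])
qed

lemma pker_det1: "det A = 1 \<Longrightarrow> pker A = {}"
  by (simp add: pker_def adj3_inverse rep_cp2)

lemma papp_inverse:
  assumes "det A = 1" shows "papp A (papp (adj3 A) x) = x" "papp (adj3 A) (papp A x) = x"
  using papp_mult[of x "adj3 A" A] papp_mult[of x A "adj3 A"] assms
  by (simp_all add: pker_det1 adj3_inverse)

lemma papp_bij: "det A = 1 \<Longrightarrow> bij (papp A)"
  by (rule o_bij[of "papp (adj3 A)"]) (auto simp: papp_inverse)

text \<open>If \<open>L\<close> is the kernel of the form \<open>a\<close>, its image is the kernel
  of \<open>a\<close> composed with the inverse matrix.\<close>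

lemma papp_line:
  assumes "det A = 1" "complex_line L" shows "complex_line (papp A ` L)"
proof -
  obtain a where a: "a \<noteq> 0" "L = pline a" using assms complex_line_iff by blast
  have tr: "dot3 b (M *v v) = dot3 (b v* M) v" for b M v
    by (simp add: dot3_def matrix_vector_mult_def vector_matrix_mult_def sum_3 algebra_simps)
  have "papp A ` L = pline (a v* adj3 A)"
  proof (intro equalityI subsetI)
    fix x assume "x \<in> papp A ` L"
    then obtain v where "v \<noteq> 0" "dot3 a v = 0" "x = papp A (cp2_of v)"
      unfolding a pline_def by blast
    then show "x \<in> pline (a v* adj3 A)" using assms
      by (simp add: papp_cp2_of cp2_of_in_pline adj3_inverse tr[symmetric])
  next
    fix x assume "x \<in> pline (a v* adj3 A)"
    then obtain v where v: "v \<noteq> 0" "dot3 a (adj3 A *v v) = 0" "x = cp2_of v"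
      unfolding pline_def tr by blast
    then have "x = papp A (cp2_of (adj3 A *v v))" "adj3 A *v v \<noteq> 0" using assms
      by (simp_all add: papp_cp2_of adj3_inverse)
    then show "x \<in> papp A ` L" using v a by (simp add: cp2_of_in_pline)
  qed
  moreover have "a v* adj3 A \<noteq> 0"
  proof
    assume "a v* adj3 A = 0"
    then have "dot3 a (adj3 A *v (A *v v)) = 0" for v unfolding tr by (simp add: dot3_def)
    then show False using dot3_nonzero[OF a(1)] assms by (metis adj3_inverse(4) zero_neq_one)
  qed
  ultimately show ?thesis using complex_line_iff by blast
qed

section \<open>Continuity of the matrix action and compactness of the plane\<close>

lemma tendsto_matrix_vector_mult:
  fixes A :: "'a \<Rightarrow> complex^3^3"
  assumes "(A \<longlongrightarrow> T) F" "(v \<longlongrightarrow> w) F" shows "((\<lambda>n. A n *v v n) \<longlongrightarrow> T *v w) F"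
  unfolding matrix_vector_mult_def
  by (intro vec_tendstoI, simp only: vec_lambda_beta) (intro tendsto_intros assms)

lemma tendsto_matrix_matrix_mult:
  fixes A :: "'a \<Rightarrow> complex^3^3"
  assumes "(A \<longlongrightarrow> T) F" "(B \<longlongrightarrow> S) F" shows "((\<lambda>n. A n ** B n) \<longlongrightarrow> T ** S) F"
  unfolding matrix_matrix_mult_def
  by (intro vec_tendstoI, simp only: vec_lambda_beta) (intro tendsto_intros assms)

lemma tendsto_cross:
  assumes "(A \<longlongrightarrow> a) F" "(B \<longlongrightarrow> b) F" shows "((\<lambda>n. cross (A n) (B n)) \<longlongrightarrow> cross a b) F"
proof (rule vec_tendstoI)
  fix i :: 3
  consider "i = 1" | "i = 2" | "i = 3" using exhaust_3 by blast
  then show "((\<lambda>n. cross (A n) (B n) $ i) \<longlongrightarrow> cross a b $ i) F"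
    by cases (simp only: cross_def vector_3, intro tendsto_intros assms)+
qed

lemma tendsto_adj3:
  assumes "(A \<longlongrightarrow> T) F" shows "((\<lambda>n. adj3 (A n)) \<longlongrightarrow> adj3 T) F"
proof (intro vec_tendstoI)
  fix i j :: 3
  have c: "((\<lambda>n. cross (A n $ p) (A n $ q) $ i) \<longlongrightarrow> cross (T $ p) (T $ q) $ i) F" for p q
    by (intro tendsto_vec_nth tendsto_cross assms)
  consider "j = 1" | "j = 2" | "j = 3" using exhaust_3 by blast
  then show "((\<lambda>n. adj3 (A n) $ i $ j) \<longlongrightarrow> adj3 T $ i $ j) F"
    by cases (simp_all only: adj3_def transpose_def vec_lambda_beta vector_3 c)
qed

lemma tendsto_det:
  fixes A :: "'a \<Rightarrow> complex^3^3"
  assumes "(A \<longlongrightarrow> T) F" shows "((\<lambda>n. det (A n)) \<longlongrightarrow> det T) F"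
  unfolding det_3 by (intro tendsto_intros assms)

lemma dist_cp2_of: "v \<noteq> 0 \<Longrightarrow> w \<noteq> 0 \<Longrightarrow> dist (cp2_of v) (cp2_of w) = dist (proj_matrix v) (proj_matrix w)"
  by (simp add: dist_cp2_def cp2_matrix_of dist_norm)

lemma tendsto_cp2_of:
  assumes "(f \<longlongrightarrow> v) F" "v \<noteq> 0" shows "((\<lambda>n. cp2_of (f n)) \<longlongrightarrow> cp2_of v) F"
proof (rule tendstoI)
  fix e :: real assume "e > 0"
  have "isCont proj_matrix v"
    using continuous_on_proj_matrix assms(2) continuous_on_eq_continuous_at[of "- {0}"] by blast
  then have "((\<lambda>n. proj_matrix (f n)) \<longlongrightarrow> proj_matrix v) F"
    using assms(1) isCont_tendsto_compose by blast
  from tendstoD[OF this \<open>e > 0\<close>] tendsto_imp_eventually_ne[OF assms]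
  show "\<forall>\<^sub>F n in F. dist (cp2_of (f n)) (cp2_of v) < e"
    by eventually_elim (simp add: dist_cp2_of assms(2))
qed

text \<open>The orthogonal projections onto the lines \<open>x n\<close> converge, so applying them
  to the fixed vector \<open>v\<close> gives representatives tending to \<open>v\<close>. Only
  finitely many of these can vanish; there an arbitrary representative is put in.\<close>

lemma cp2_lift_seq:
  assumes "(x :: nat \<Rightarrow> cp2) \<longlonglongrightarrow> cp2_of v" "v \<noteq> 0"
  obtains w where "\<And>n. w n \<noteq> 0" "\<And>n. cp2_of (w n) = x n" "w \<longlonglongrightarrow> v"
proof -
  have "(\<lambda>n. cp2_matrix (x n)) \<longlonglongrightarrow> cp2_matrix (cp2_of v)"
    using assms(1) by (simp add: tendsto_iff dist_cp2_def dist_norm)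
  from tendsto_matrix_vector_mult[OF this tendsto_const[of v]]
  have lim: "(\<lambda>n. cp2_matrix (x n) *v v) \<longlonglongrightarrow> v"
    using assms by (simp add: cp2_matrix_of proj_matrix_self)
  define w where "w n = (if cp2_matrix (x n) *v v = 0 then rep_cp2 (x n) else cp2_matrix (x n) *v v)" for n
  have "\<forall>\<^sub>F n in sequentially. cp2_matrix (x n) *v v = w n"
    using tendsto_imp_eventually_ne[OF lim assms(2)] by eventually_elim (simp add: w_def)
  then have "w \<longlonglongrightarrow> v" using lim by (rule Lim_transform_eventually[rotated])
  moreover have "w n \<noteq> 0 \<and> cp2_of (w n) = x n" for n
  proof (cases "cp2_matrix (x n) *v v = 0")
    case True then show ?thesis by (simp add: w_def rep_cp2)
  next
    case False
    obtain u where u: "u \<noteq> 0" "x n = cp2_of u" by (rule cp2_cases)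
    then obtain c where c: "cp2_matrix (x n) *v v = c *s u"
      by (metis cp2_matrix_of proj_matrix_mult_vec)
    with False have "c \<noteq> 0" by auto
    then show ?thesis using False c u by (simp add: w_def cp2_of_scale0)
  qed
  ultimately show ?thesis using that by blast
qed

lemma cp2_seq_compact:
  obtains r x where "strict_mono (r :: nat \<Rightarrow> nat)" "((f :: nat \<Rightarrow> cp2) \<circ> r) \<longlonglongrightarrow> x"
proof -
  define v where "v n = (1 / norm (rep_cp2 (f n))) *\<^sub>R rep_cp2 (f n)" for n
  have v: "norm (v n) = 1" "cp2_of (v n) = f n" for n
    using rep_cp2[of "f n"] by (simp_all add: v_def cp2_of_scaleR)
  then have "\<forall>n. v n \<in> sphere 0 1" by simp
  then obtain l r where l: "l \<in> sphere 0 1" "strict_mono r" "(v \<circ> r) \<longlonglongrightarrow> l"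
    using compact_sphere[of "0 :: complex^3" 1] unfolding compact_def by metis
  have "l \<noteq> 0" using l by auto
  with tendsto_cp2_of[OF l(3)] have "(f \<circ> r) \<longlonglongrightarrow> cp2_of l"
    by (simp add: v o_def)
  with l(2) show ?thesis using that by blast
qed

lemma compact_UNIV_cp2: "compact (UNIV :: cp2 set)"
  unfolding compact_def using cp2_seq_compact by (metis UNIV_I)

lemma compact_cp2: "closed (K :: cp2 set) \<Longrightarrow> compact K"
  using compact_Int_closed[OF compact_UNIV_cp2, of K] by simp

lemma scaleR_matrix_vector_assoc:
  fixes A :: "complex^3^3" shows "(r *\<^sub>R A) *v v = r *\<^sub>R (A *v v)"
  by (simp add: vec_eq_iff matrix_vector_mult_def scaleR_sum_right)

text \<open>Scaling does not change the projective map, and off the kernel of \<open>T\<close> the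
  limit vector is nonzero, so convergence descends from vectors to points. Since \<open>x\<close>
  may vary, this is continuous convergence, which later becomes uniformity on compact sets.\<close>

lemma papp_tendsto:
  assumes "(\<lambda>n. (c n :: real) *\<^sub>R A n) \<longlonglongrightarrow> T" "x \<longlonglongrightarrow> y" "y \<notin> pker T"
  shows "(\<lambda>n. papp (A n) (x n)) \<longlonglongrightarrow> papp T y"
proof -
  obtain v where v: "v \<noteq> 0" "y = cp2_of v" by (rule cp2_cases)
  obtain w where w: "\<And>n. w n \<noteq> 0" "\<And>n. cp2_of (w n) = x n" "w \<longlonglongrightarrow> v"
    using cp2_lift_seq assms(2) v by metis
  have T: "T *v v \<noteq> 0" using assms(3) v by (simp add: cp2_of_in_pker)
  have lim: "(\<lambda>n. (c n *\<^sub>R A n) *v w n) \<longlonglongrightarrow> T *v v"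
    by (intro tendsto_matrix_vector_mult assms w)
  have "(\<lambda>n. cp2_of ((c n *\<^sub>R A n) *v w n)) \<longlonglongrightarrow> cp2_of (T *v v)"
    by (intro tendsto_cp2_of lim T)
  moreover have "\<forall>\<^sub>F n in sequentially. cp2_of ((c n *\<^sub>R A n) *v w n) = papp (A n) (x n)"
    using tendsto_imp_eventually_ne[OF lim T]
  proof eventually_elim
    case (elim n)
    have "(c n *\<^sub>R A n) *v w n = c n *\<^sub>R (A n *v w n)"
      by (simp add: scaleR_matrix_vector_assoc)
    moreover from this elim have "c n \<noteq> 0" by auto
    moreover have "papp (A n) (x n) = cp2_of (A n *v w n)"
      using papp_cp2_of[OF w(1), of "A n" n] by (simp only: w(2))
    ultimately show ?case by (simp only: cp2_of_scaleR not_False_eq_True)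
  qed
  ultimately have "(\<lambda>n. papp (A n) (x n)) \<longlonglongrightarrow> cp2_of (T *v v)"
    by (rule Lim_transform_eventually)
  then show ?thesis using v by (simp add: papp_cp2_of)
qed

lemma papp_continuous:
  assumes "det A = 1" "x \<longlonglongrightarrow> y" shows "(\<lambda>n. papp A (x n)) \<longlonglongrightarrow> papp A y"
  using papp_tendsto[of "\<lambda>_. 1" "\<lambda>_. A" A x y] assms by (simp add: pker_det1)

section \<open>Limits of discrete matrix groups\<close>

text \<open>The group is lifted from cosets to matrices so that limits can be taken in a vector
  space. Discreteness enters as finiteness of norm balls.\<close>

locale discrete_matrix_group =
  fixes G :: "(complex^3^3) set"
  assumes det_G: "A \<in> G \<Longrightarrow> det A = 1"
    and mult_G: "A \<in> G \<Longrightarrow> B \<in> G \<Longrightarrow> A ** B \<in> G"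
    and inverse_G: "A \<in> G \<Longrightarrow> adj3 A \<in> G"
    and finite_balls: "finite {A \<in> G. norm A \<le> R}"
    and infinite_G: "infinite G"
begin

lemmas inverse_simps [simp] = adj3_inverse[OF det_G] papp_inverse[OF det_G] pker_det1[OF det_G]

definition escaping :: "(nat \<Rightarrow> complex^3^3) \<Rightarrow> bool" where
  "escaping A \<longleftrightarrow> (\<forall>n. A n \<in> G) \<and> (\<forall>B. \<forall>\<^sub>F n in sequentially. A n \<noteq> B)"

text \<open>Scalars tending to 0 make \<open>T\<close> singular and exclude constant sequences, so
  that group elements are not limits of themselves.\<close>

definition limit_of :: "(nat \<Rightarrow> complex^3^3) \<Rightarrow> complex^3^3 \<Rightarrow> bool" where
  "limit_of A T \<longleftrightarrow> (\<forall>n. A n \<in> G) \<and> T \<noteq> 0 \<and>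
     (\<exists>c :: nat \<Rightarrow> real. c \<longlonglongrightarrow> 0 \<and> (\<lambda>n. c n *\<^sub>R A n) \<longlonglongrightarrow> T)"

definition KER :: "cp2 set" where
  "KER = (\<Union>T\<in>{T. \<exists>A. limit_of A T}. pker T)"

lemma KER_I: "limit_of A T \<Longrightarrow> x \<in> pker T \<Longrightarrow> x \<in> KER"
  unfolding KER_def by blast

section \<open>Escaping sequences and their rescaled limits\<close>

lemma escaping_G: "escaping A \<Longrightarrow> A n \<in> G"
  and limit_of_G: "limit_of A T \<Longrightarrow> A n \<in> G"
  unfolding escaping_def limit_of_def by auto

lemma escaping_inj: "range A \<subseteq> G \<Longrightarrow> inj A \<Longrightarrow> escaping A"
  unfolding escaping_def
proof (intro conjI allI)
  fix B assume *: "range A \<subseteq> G" "inj A"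
  then have "finite (A -` {B})" by (intro finite_vimageI) auto
  then have "\<forall>\<^sub>F n in cofinite. A n \<noteq> B" by (simp add: eventually_cofinite vimage_def)
  then show "\<forall>\<^sub>F n in sequentially. A n \<noteq> B" by (simp add: cofinite_eq_sequentially)
qed auto

lemma escaping_exists: obtains A where "escaping A"
proof -
  obtain A :: "nat \<Rightarrow> complex^3^3" where "inj A" "range A \<subseteq> G"
    using infinite_countable_subset[OF infinite_G] by blast
  then show ?thesis using that escaping_inj by blast
qed

lemma escaping_finite:
  assumes "escaping A" "finite F" shows "\<forall>\<^sub>F n in sequentially. A n \<notin> F"
proof -
  have "\<forall>\<^sub>F n in sequentially. \<forall>B\<in>F. A n \<noteq> B"
    using assms by (intro eventually_ball_finite) (auto simp: escaping_def)
  then show ?thesis by (rule eventually_mono) auto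
qed

lemma escaping_norm:
  assumes "escaping A" shows "filterlim (\<lambda>n. norm (A n)) at_top sequentially"
  unfolding filterlim_at_top
proof
  fix R :: real
  from escaping_finite[OF assms finite_balls[of R]]
  show "\<forall>\<^sub>F n in sequentially. R \<le> norm (A n)"
    by (rule eventually_mono) (use assms escaping_G in auto)
qed

lemma escaping_subseq: "escaping A \<Longrightarrow> strict_mono r \<Longrightarrow> escaping (A \<circ> r)"
  unfolding escaping_def using eventually_subseq by fastforce

lemma escaping_map:
  assumes "escaping A" "\<And>n. h (A n) \<in> G" "\<And>B C. B \<in> G \<Longrightarrow> C \<in> G \<Longrightarrow> h B = h C \<Longrightarrow> B = C"
  shows "escaping (\<lambda>n. h (A n))"
  unfolding escaping_def
proof (intro conjI allI)
  fix B
  have "finite {C \<in> G. h C = B}"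
  proof (cases "\<exists>C\<in>G. h C = B")
    case True
    then obtain C where "C \<in> G" "h C = B" by blast
    then have "{C \<in> G. h C = B} \<subseteq> {C}" using assms(3) by auto
    then show ?thesis using finite_subset by blast
  qed (auto intro: finite_subset[of _ "{}"])
  from escaping_finite[OF assms(1) this]
  show "\<forall>\<^sub>F n in sequentially. h (A n) \<noteq> B"
    by (rule eventually_mono) (use assms(1) escaping_G in auto)
qed (use assms in auto)

lemma escaping_inverse:
  assumes "escaping A" shows "escaping (\<lambda>n. adj3 (A n))"
  by (rule escaping_map[OF assms]) (metis assms escaping_G inverse_G, metis inverse_simps(7))

lemma cancel_left: "B \<in> G \<Longrightarrow> B ** X = B ** Y \<Longrightarrow> X = Y"
  by (metis inverse_simps(2) matrix_mul_assoc matrix_mul_lid)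

lemma cancel_right: "B \<in> G \<Longrightarrow> X ** B = Y ** B \<Longrightarrow> X = Y"
  by (metis inverse_simps(1) matrix_mul_assoc matrix_mul_rid)

lemma escaping_mult_left:
  assumes "escaping A" "B \<in> G" shows "escaping (\<lambda>n. B ** A n)"
  by (rule escaping_map[OF assms(1)]) (use assms in \<open>auto intro: mult_G escaping_G dest: cancel_left\<close>)

lemma escaping_mult_right:
  assumes "escaping A" "B \<in> G" shows "escaping (\<lambda>n. A n ** B)"
  by (rule escaping_map[OF assms(1)]) (use assms in \<open>auto intro: mult_G escaping_G dest: cancel_right\<close>)

lemma limit_of_escaping:
  assumes "limit_of A T" shows "escaping A"
  unfolding escaping_def
proof (intro conjI allI)
  fix B
  obtain c :: "nat \<Rightarrow> real" where c: "c \<longlonglongrightarrow> 0" "(\<lambda>n. c n *\<^sub>R A n) \<longlonglongrightarrow> T"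
    using assms by (auto simp: limit_of_def)
  have "(\<lambda>n. c n *\<^sub>R A n - c n *\<^sub>R B) \<longlonglongrightarrow> T - 0 *\<^sub>R B"
    by (intro tendsto_intros c)
  moreover have "T - 0 *\<^sub>R B \<noteq> 0" using assms by (simp add: limit_of_def)
  ultimately have "\<forall>\<^sub>F n in sequentially. c n *\<^sub>R A n - c n *\<^sub>R B \<noteq> 0"
    by (rule tendsto_imp_eventually_ne)
  then show "\<forall>\<^sub>F n in sequentially. A n \<noteq> B" by (rule eventually_mono) auto
qed (use assms limit_of_G in auto)

lemma limit_of_subseq: "limit_of A T \<Longrightarrow> strict_mono r \<Longrightarrow> limit_of (A \<circ> r) T"
proof -
  assume T: "limit_of A T" and r: "strict_mono r"
  then obtain c :: "nat \<Rightarrow> real" where c: "c \<longlonglongrightarrow> 0" "(\<lambda>n. c n *\<^sub>R A n) \<longlonglongrightarrow> T"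
    by (auto simp: limit_of_def)
  show ?thesis
    unfolding limit_of_def
    using T LIMSEQ_subseq_LIMSEQ[OF c(1) r] LIMSEQ_subseq_LIMSEQ[OF c(2) r]
    by (intro conjI exI[of _ "c \<circ> r"]) (auto simp: limit_of_def o_def)
qed

text \<open>Division by the norm puts the matrices on a compact sphere, and the factors
  \<open>1 / norm (A n)\<close> tend to 0 because norm balls are finite.\<close>

lemma escaping_limit:
  assumes "escaping A" obtains r T where "strict_mono r" "limit_of (A \<circ> r) T"
proof -
  define M where "M n = (1 / norm (A n)) *\<^sub>R A n" for n
  have nz: "A n \<noteq> 0" for n
    using escaping_G[OF assms, of n] det_G[of "A n"] by (auto simp: det_3)
  then have "\<forall>n. M n \<in> sphere 0 1" by (simp add: M_def)
  then obtain T r where T: "T \<in> sphere 0 1" "strict_mono r" "(M \<circ> r) \<longlonglongrightarrow> T"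
    using compact_sphere[of "0 :: complex^3^3" 1] unfolding compact_def by metis
  have "(\<lambda>n. 1 / norm (A n)) \<longlonglongrightarrow> 0"
    using tendsto_divide_0[OF tendsto_const filterlim_at_top_imp_at_infinity[OF escaping_norm[OF assms]]] .
  then have "(\<lambda>n. 1 / norm ((A \<circ> r) n)) \<longlonglongrightarrow> 0"
    using LIMSEQ_subseq_LIMSEQ[OF _ T(2)] unfolding o_def by blast
  then have "limit_of (A \<circ> r) T"
    unfolding limit_of_def using T escaping_G[OF assms] by (auto simp: M_def o_def)
  then show ?thesis using that T(2) by blast
qed

text \<open>The scaled matrix times the scaled inverse is \<open>c n * d n\<close> times the
  identity, which tends to 0.\<close>

lemma limit_of_cancel:
  assumes "limit_of A T" "limit_of (\<lambda>n. adj3 (A n)) T'" shows "T ** T' = 0" "T' ** T = 0"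
proof -
  obtain c d :: "nat \<Rightarrow> real" where c: "c \<longlonglongrightarrow> 0" "(\<lambda>n. c n *\<^sub>R A n) \<longlonglongrightarrow> T"
      "d \<longlonglongrightarrow> 0" "(\<lambda>n. d n *\<^sub>R adj3 (A n)) \<longlonglongrightarrow> T'"
    using assms by (auto simp: limit_of_def)
  have s: "(a *\<^sub>R X) ** (b *\<^sub>R Y) = (a * b) *\<^sub>R (X ** Y)" for a b and X Y :: "complex^3^3"
    by (simp add: vec_eq_iff matrix_matrix_mult_def scaleR_sum_right mult_ac)
  have G: "A n \<in> G" for n using assms limit_of_G by blast
  have z: "(\<lambda>n. (c n * d n) *\<^sub>R mat 1) \<longlonglongrightarrow> (0 * 0) *\<^sub>R (mat 1 :: complex^3^3)"
    "(\<lambda>n. (d n * c n) *\<^sub>R mat 1) \<longlonglongrightarrow> (0 * 0) *\<^sub>R (mat 1 :: complex^3^3)"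
    by (intro tendsto_intros c)+
  show "T ** T' = 0" "T' ** T = 0"
    using tendsto_matrix_matrix_mult[OF c(2,4)] tendsto_matrix_matrix_mult[OF c(4,2)] z
    by (auto simp: s G intro: LIMSEQ_unique)
qed

lemma escaping_limit_pair:
  assumes "escaping A"
  obtains r T T' where "strict_mono r" "limit_of (A \<circ> r) T" "limit_of (\<lambda>n. adj3 ((A \<circ> r) n)) T'"
    "T ** T' = 0" "T' ** T = 0"
proof -
  obtain r T where r: "strict_mono r" "limit_of (A \<circ> r) T" using escaping_limit assms by blast
  obtain r' T' where r': "strict_mono r'" "limit_of ((\<lambda>n. adj3 ((A \<circ> r) n)) \<circ> r') T'"
    using escaping_limit[OF escaping_inverse[OF escaping_subseq[OF assms r(1)]]] by blast
  have 1: "limit_of (A \<circ> (r \<circ> r')) T" using limit_of_subseq[OF r(2) r'(1)] by (simp add: o_assoc)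
  have 2: "limit_of (\<lambda>n. adj3 ((A \<circ> (r \<circ> r')) n)) T'" using r' by (simp add: o_def)
  show ?thesis
    by (rule that[OF strict_mono_o[OF r(1) r'(1)] 1 2 limit_of_cancel[OF 1 2]])
qed

lemma limit_of_papp:
  assumes "limit_of A T" "x \<longlonglongrightarrow> y" "y \<notin> pker T"
  shows "(\<lambda>n. papp (A n) (x n)) \<longlonglongrightarrow> papp T y"
  using assms papp_tendsto unfolding limit_of_def by blast

lemma papp_in_pker:
  assumes "T' ** T = 0" "y \<notin> pker T" shows "papp T y \<in> pker T'"
proof -
  obtain v where v: "v \<noteq> 0" "y = cp2_of v" by (rule cp2_cases)
  then show ?thesis using assms
    by (simp add: papp_cp2_of cp2_of_in_pker matrix_vector_mul_assoc)
qed

lemma limit_of_mult_left: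
  assumes "limit_of A T" "B \<in> G" shows "limit_of (\<lambda>n. B ** A n) (B ** T)"
proof -
  obtain c :: "nat \<Rightarrow> real" where c: "c \<longlonglongrightarrow> 0" "(\<lambda>n. c n *\<^sub>R A n) \<longlonglongrightarrow> T"
    using assms by (auto simp: limit_of_def)
  have "(\<lambda>n. B ** (c n *\<^sub>R A n)) \<longlonglongrightarrow> B ** T"
    by (intro tendsto_matrix_matrix_mult c tendsto_const)
  moreover have "B ** (c n *\<^sub>R A n) = c n *\<^sub>R (B ** A n)" for n
    by (simp add: vec_eq_iff matrix_matrix_mult_def scaleR_sum_right)
  moreover have "B ** T \<noteq> 0"
    using cancel_left[OF assms(2), of T 0] assms(1) by (auto simp: limit_of_def)
  ultimately show ?thesis using assms c(1) mult_G by (auto simp: limit_of_def)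
qed

lemma limit_of_mult_right:
  assumes "limit_of A T" "B \<in> G" shows "limit_of (\<lambda>n. A n ** B) (T ** B)"
proof -
  obtain c :: "nat \<Rightarrow> real" where c: "c \<longlonglongrightarrow> 0" "(\<lambda>n. c n *\<^sub>R A n) \<longlonglongrightarrow> T"
    using assms by (auto simp: limit_of_def)
  have "(\<lambda>n. (c n *\<^sub>R A n) ** B) \<longlonglongrightarrow> T ** B"
    by (intro tendsto_matrix_matrix_mult c tendsto_const)
  moreover have "(c n *\<^sub>R A n) ** B = c n *\<^sub>R (A n ** B)" for n
    by (simp add: vec_eq_iff matrix_matrix_mult_def scaleR_sum_right)
  moreover have "T ** B \<noteq> 0"
    using cancel_right[OF assms(2), of T 0] assms(1) by (auto simp: limit_of_def)
  ultimately show ?thesis using assms c(1) mult_G by (auto simp: limit_of_def)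
qed

text \<open>Moving a kernel by \<open>B\<close> amounts to composing the limit on the right with the
  inverse of \<open>B\<close>, and right translates of the sequence stay in the group.\<close>

lemma KER_invariant:
  assumes "B \<in> G" "x \<in> KER" shows "papp B x \<in> KER"
proof -
  obtain A T where T: "limit_of A T" "x \<in> pker T" using assms by (auto simp: KER_def)
  obtain v where v: "v \<noteq> 0" "x = cp2_of v" by (rule cp2_cases)
  have "papp B x \<in> pker (T ** adj3 B)"
    using T v assms(1)
    by (simp add: papp_cp2_of cp2_of_in_pker matrix_vector_mul_assoc[symmetric])
  then show ?thesis using limit_of_mult_right[OF T(1) inverse_G[OF assms(1)]] KER_I by blast
qed

text \<open>Write \<open>x n\<close> as the inverse of \<open>A n\<close> applied to its image. As
  \<open>q\<close> is not in the kernel of the inverse limit \<open>T'\<close>, the points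
  \<open>x n\<close> subconverge to \<open>papp T' q\<close>, which \<open>T\<close> kills.
  Replacing the moving images by the constant \<open>q\<close> gives the same limit.\<close>

lemma dynamically_related:
  assumes "escaping A" "x \<longlonglongrightarrow> p" "(\<lambda>n. papp (A n) (x n)) \<longlonglongrightarrow> q" "q \<notin> KER"
  obtains r where "strict_mono r" "(\<lambda>n. papp (adj3 (A (r n))) q) \<longlonglongrightarrow> p" "p \<in> KER"
proof -
  obtain r T T' where r: "strict_mono r" "limit_of (A \<circ> r) T" "limit_of (\<lambda>n. adj3 ((A \<circ> r) n)) T'"
    "T ** T' = 0" "T' ** T = 0"
    using escaping_limit_pair assms(1) by blast
  have q: "q \<notin> pker T'" using r(3) KER_I assms(4) by blast
  have "(\<lambda>n. papp (A (r n)) (x (r n))) \<longlonglongrightarrow> q"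
    using LIMSEQ_subseq_LIMSEQ[OF assms(3) r(1)] by (simp add: o_def)
  from limit_of_papp[OF r(3) this q] have "(x \<circ> r) \<longlonglongrightarrow> papp T' q"
    using escaping_G[OF assms(1)] by (simp add: o_def)
  then have p: "p = papp T' q"
    using LIMSEQ_subseq_LIMSEQ[OF assms(2) r(1)] LIMSEQ_unique by blast
  have "p \<in> KER" using KER_I[OF r(2)] papp_in_pker[OF r(4) q] p by simp
  then show ?thesis using that[OF r(1)] limit_of_papp[OF r(3) tendsto_const q] p by (simp add: o_def)
qed

text \<open>The diagonal argument for limits of limits is absorbed in the closed set
  \<open>Z\<close>: its members \<open>(0, T)\<close> with \<open>T\<close> nonzero are exactly the
  limits. Normalising \<open>T\<close> to norm one keeps the accumulated matrix nonzero.\<close>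

lemma closed_KER: "closed KER"
  unfolding closed_sequential_limits
proof (intro allI impI)
  fix x l assume *: "(\<forall>n. x n \<in> KER) \<and> x \<longlonglongrightarrow> l"
  define Z where "Z = closure {(c, c *\<^sub>R A) | c A. A \<in> G}"
  have ZI: "limit_of A T \<Longrightarrow> (0, T) \<in> Z" for A T
    unfolding limit_of_def Z_def closure_sequential
    by (auto intro!: tendsto_Pair) (metis (mono_tags, lifting) tendsto_Pair)
  have ZD: "\<exists>A. limit_of A T" if T: "(0, T) \<in> Z" "T \<noteq> 0" for T
  proof -
    obtain f where f: "\<And>n. f n \<in> {(c, c *\<^sub>R A) | c A. A \<in> G}" "f \<longlonglongrightarrow> (0, T)"
      using T(1) unfolding Z_def closure_sequential by blast
    have "\<forall>n. \<exists>A. A \<in> G \<and> snd (f n) = fst (f n) *\<^sub>R A"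
    proof
      fix n show "\<exists>A. A \<in> G \<and> snd (f n) = fst (f n) *\<^sub>R A" using f(1)[of n] by auto
    qed
    then obtain A where A: "\<And>n. A n \<in> G" "\<And>n. snd (f n) = fst (f n) *\<^sub>R A n" by metis
    have "(\<lambda>n. fst (f n)) \<longlonglongrightarrow> 0" "(\<lambda>n. fst (f n) *\<^sub>R A n) \<longlonglongrightarrow> T"
      using tendsto_fst[OF f(2)] tendsto_snd[OF f(2)] by (simp_all add: A)
    then show ?thesis unfolding limit_of_def using A T(2) by blast
  qed
  have "\<exists>T. norm T = 1 \<and> (0, T) \<in> Z \<and> x n \<in> pker T" for n
  proof -
    obtain A T where T: "limit_of A T" "x n \<in> pker T"
      using * unfolding KER_def by blast
    then obtain c :: "nat \<Rightarrow> real" where c: "c \<longlonglongrightarrow> 0" "(\<lambda>n. c n *\<^sub>R A n) \<longlonglongrightarrow> T"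
      by (auto simp: limit_of_def)
    have "T \<noteq> 0" using T by (simp add: limit_of_def)
    have "(\<lambda>n. (1 / norm T) *\<^sub>R c n *\<^sub>R A n) \<longlonglongrightarrow> (1 / norm T) *\<^sub>R T" "(\<lambda>n. 1 / norm T * c n) \<longlonglongrightarrow> 1 / norm T * 0"
      by (intro tendsto_intros c)+
    then have "limit_of A ((1 / norm T) *\<^sub>R T)"
      using \<open>T \<noteq> 0\<close> T(1) unfolding limit_of_def
      by (auto intro!: exI[of _ "\<lambda>n. c n / norm T"])
    moreover have "x n \<in> pker ((1 / norm T) *\<^sub>R T)"
      using T(2) by (simp add: pker_def scaleR_matrix_vector_assoc)
    ultimately show ?thesis using ZI \<open>T \<noteq> 0\<close> by (intro exI[of _ "(1 / norm T) *\<^sub>R T"]) auto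
  qed
  then obtain T where T: "\<And>n. T n \<in> sphere 0 1" "\<And>n. (0, T n) \<in> Z" "\<And>n. x n \<in> pker (T n)"
    by simp metis
  obtain S r where S: "S \<in> sphere 0 1" "strict_mono r" "(T \<circ> r) \<longlonglongrightarrow> S"
    using compact_sphere[of "0 :: complex^3^3" 1] T(1) unfolding compact_def by metis
  have "(\<lambda>n. (0, (T \<circ> r) n)) \<longlonglongrightarrow> (0, S)"
    using S(3) by (intro tendsto_intros)
  moreover have "closed Z" unfolding Z_def by simp
  ultimately have "(0, S) \<in> Z"
    using T(2) closed_sequentially[of Z "\<lambda>n. (0, (T \<circ> r) n)"] by simp
  then obtain A where A: "limit_of A S" using ZD S(1) by fastforce
  obtain v where v: "v \<noteq> 0" "l = cp2_of v" by (rule cp2_cases)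
  obtain w where w: "\<And>n. w n \<noteq> 0" "\<And>n. cp2_of (w n) = x n" "w \<longlonglongrightarrow> v"
    using cp2_lift_seq * v by metis
  have "(\<lambda>n. (T \<circ> r) n *v (w \<circ> r) n) \<longlonglongrightarrow> S *v v"
    by (intro tendsto_matrix_vector_mult S LIMSEQ_subseq_LIMSEQ[OF w(3) S(2)])
  moreover have "T n *v w n = 0" for n
    using T(3)[of n] w(1)[of n] cp2_of_in_pker[of "w n"] by (simp add: w)
  ultimately have "(\<lambda>n. 0) \<longlonglongrightarrow> S *v v" by (simp add: o_def)
  then have "S *v v = 0" by (simp add: LIMSEQ_const_iff)
  then show "l \<in> KER" using KER_I[OF A] v by (simp add: cp2_of_in_pker)
qed

text \<open>If \<open>T\<close> has rank one, its kernel is a plane in the vector space. Otherwise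
  the image of \<open>T\<close> contains a plane, which the nonzero limit \<open>T'\<close> of the
  inverses kills, so that \<open>T'\<close> serves instead.\<close>

lemma limit_of_line:
  obtains A T L where "limit_of A T" "complex_line L" "L \<subseteq> pker T"
proof -
  note line = that
  have *: "thesis" if T: "limit_of A T" "a \<noteq> 0" "\<And>v. dot3 a v = 0 \<Longrightarrow> T *v v = 0" for A T a
    by (rule line[OF T(1), of "pline a"])
      (use T in \<open>auto simp: complex_line_iff pline_def cp2_of_in_pker\<close>)
  obtain A where "escaping A" by (rule escaping_exists)
  then obtain r T T' where T: "limit_of (A \<circ> r) T" "limit_of (\<lambda>n. adj3 ((A \<circ> r) n)) T'" "T' ** T = 0"
    using escaping_limit_pair[OF \<open>escaping A\<close>] by blast
  have row: "(M *v v) $ i = dot3 (M $ i) v" for M :: "complex^3^3" and v i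
    by (simp add: matrix_vector_mult_def dot3_def sum_3)
  show thesis
  proof (cases "\<forall>x y. cross (T *v x) (T *v y) = 0")
    case True
    have "T \<noteq> 0" using T(1) by (simp add: limit_of_def)
    then obtain i where i: "T $ i \<noteq> 0" by (auto simp: vec_eq_iff)
    obtain u where u: "dot3 (T $ i) u = 1" using dot3_nonzero[OF i] by blast
    then have Tu: "(T *v u) $ i = 1" by (simp add: row)
    have "T *v v = 0" if v: "dot3 (T $ i) v = 0" for v
    proof -
      have "T *v u \<noteq> 0" using Tu by auto
      then obtain c where c: "T *v v = c *s (T *v u)" using True cross_eq_0D by blast
      from arg_cong[OF this, of "\<lambda>w. w $ i"] have "c = 0" using Tu v by (simp add: row)
      then show ?thesis using c by simp
    qed
    then show ?thesis using * T(1) i by blast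
  next
    case False
    then obtain x y where xy: "cross (T *v x) (T *v y) \<noteq> 0" by blast
    have k: "T' *v (T *v z) = 0" for z using T(3) by (simp add: matrix_vector_mul_assoc)
    have "T' \<noteq> 0" using T(2) by (simp add: limit_of_def)
    then obtain i where i: "T' $ i \<noteq> 0" by (auto simp: vec_eq_iff)
    have d: "dot3 (T' $ i) (T *v z) = 0" for z
      using arg_cong[OF k[of z], of "\<lambda>w. w $ i"] by (simp add: row)
    have "T' *v v = 0" if v: "dot3 (T' $ i) v = 0" for v
      using v unfolding dot3_span_0[OF i d d xy]
      by (auto simp: matrix_vector_right_distrib vec.scale k)
    then show ?thesis using * T(2) i by blast
  qed
qed

text \<open>After scaling, the image of \<open>v\<close> tends to 0 and that of \<open>u\<close> to
  \<open>T *v u\<close>. Perturbing \<open>v\<close> by multiples of \<open>u\<close> comparable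
  with what remains of the image of \<open>v\<close> realises every mixture of the two directions,
  so the limits are all points but one of a line.\<close>

lemma blow_up:
  assumes "limit_of A T" "T *v v = 0" "v \<noteq> 0" "T *v u \<noteq> 0"
  obtains r s where "strict_mono r" "cross s (T *v u) \<noteq> 0"
    "\<And>\<tau>. \<exists>x. x \<longlonglongrightarrow> cp2_of v \<and>
       (\<lambda>n. papp (A (r n)) (x n)) \<longlonglongrightarrow> cp2_of (s + \<tau> *s (T *v u))"
proof -
  obtain c :: "nat \<Rightarrow> real" where c: "c \<longlonglongrightarrow> 0" "(\<lambda>n. c n *\<^sub>R A n) \<longlonglongrightarrow> T"
    using assms by (auto simp: limit_of_def)
  define p where "p n = (c n *\<^sub>R A n) *v u" for n
  define q where "q n = (c n *\<^sub>R A n) *v v" for n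
  have p: "p \<longlonglongrightarrow> T *v u" and q: "q \<longlonglongrightarrow> 0"
    using tendsto_matrix_vector_mult[OF c(2) tendsto_const[of u]]
      tendsto_matrix_vector_mult[OF c(2) tendsto_const[of v]] assms(2)
    by (simp_all add: p_def[abs_def] q_def[abs_def])
  obtain i where i: "(T *v u) $ i \<noteq> 0" using assms(4) by (auto simp: vec_eq_iff)
  have p_i: "(\<lambda>n. p n $ i) \<longlonglongrightarrow> (T *v u) $ i" by (intro tendsto_intros p)
  \<comment> \<open>This choice annihilates the \<open>i\<close>-th coordinate of
    \<open>s n\<close>, while that of \<open>T *v u\<close> is nonzero; the limiting direction of
    \<open>s n\<close> therefore stays independent of \<open>T *v u\<close>.\<close>
  define \<alpha> where "\<alpha> n = q n $ i / p n $ i" for n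
  define s where "s n = q n - \<alpha> n *s p n" for n
  define h where "h n = (1 / norm (s n)) *\<^sub>R s n" for n
  have "(\<lambda>n. q n $ i / p n $ i) \<longlonglongrightarrow> 0 $ i / (T *v u) $ i"
    by (intro tendsto_intros p q i)
  then have \<alpha>: "\<alpha> \<longlonglongrightarrow> 0" by (simp add: \<alpha>_def[abs_def])
  have "(\<lambda>n. \<alpha> n *s p n) \<longlonglongrightarrow> 0 *s (T *v u)"
    unfolding vector_scalar_mult_def
    by (intro vec_tendstoI, simp only: vec_lambda_beta) (intro tendsto_intros \<alpha> p)
  then have s: "s \<longlonglongrightarrow> 0" using tendsto_diff[OF q] by (fastforce simp: s_def[abs_def])
  have ind: "v + e *s u \<noteq> 0" for e
  proof
    assume e: "v + e *s u = 0"
    then have "T *v (v + e *s u) = 0" by simp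
    then have "e = 0" using assms by (simp add: matrix_vector_right_distrib vec.scale)
    then show False using e assms(3) by simp
  qed
  have ev: "\<forall>\<^sub>F n in sequentially. p n $ i \<noteq> 0"
    using tendsto_imp_eventually_ne[OF p_i i] .
  have good: "s n $ i = 0 \<and> s n \<noteq> 0 \<and> c n \<noteq> 0" if n: "p n $ i \<noteq> 0" for n
  proof (intro conjI)
    show "s n $ i = 0" using n by (simp add: s_def \<alpha>_def)
    show "c n \<noteq> 0" using n by (auto simp: p_def)
    have "s n = (c n *\<^sub>R A n) *v (v + (- \<alpha> n) *s u)"
      unfolding matrix_vector_right_distrib vec.scale s_def p_def q_def by (simp add: vec_eq_iff)
    then show "s n \<noteq> 0" using \<open>c n \<noteq> 0\<close> limit_of_G[OF assms(1)] ind[of "- \<alpha> n"]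
      by (simp add: scaleR_matrix_vector_assoc)
  qed
  have "\<forall>n. h n \<in> cball 0 1" by (simp add: h_def)
  then obtain l r where l: "strict_mono r" "(h \<circ> r) \<longlonglongrightarrow> l"
    using compact_cball[of "0 :: complex^3" 1] unfolding compact_def by metis
  have evr: "\<forall>\<^sub>F n in sequentially. p (r n) $ i \<noteq> 0" using eventually_subseq[OF l(1) ev] .
  have "(\<lambda>n. norm ((h \<circ> r) n)) \<longlonglongrightarrow> norm l" "(\<lambda>n. (h \<circ> r) n $ i) \<longlonglongrightarrow> l $ i"
    by (intro tendsto_intros l)+
  moreover have "\<forall>\<^sub>F n in sequentially. norm ((h \<circ> r) n) = 1" "\<forall>\<^sub>F n in sequentially. (h \<circ> r) n $ i = 0"
    using evr by (eventually_elim, use good in \<open>simp add: h_def\<close>)+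
  ultimately have l1: "norm l = 1" and li: "l $ i = 0"
    by (metis tendsto_eventually LIMSEQ_unique)+
  have "cross l (T *v u) \<noteq> 0"
  proof
    assume "cross l (T *v u) = 0"
    then obtain e where "T *v u = e *s l" using cross_eq_0D[of l] l1 by force
    then show False using i li by simp
  qed
  moreover have "\<exists>x. x \<longlonglongrightarrow> cp2_of v \<and>
       (\<lambda>n. papp (A (r n)) (x n)) \<longlonglongrightarrow> cp2_of (l + \<tau> *s (T *v u))" for \<tau>
  proof -
    \<comment> \<open>The term \<open>- \<alpha> n\<close> cancels the component of the image along
      \<open>p n\<close>. What is left has size \<open>norm (s n)\<close>, so a correction of that
      size survives the normalisation as \<open>\<tau> *s p n\<close>.\<close>
    define e where "e n = - \<alpha> n + \<tau> * of_real (norm (s n))" for n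
    have e: "e \<longlonglongrightarrow> - 0 + \<tau> * of_real (norm (0 :: complex^3))"
      unfolding e_def[abs_def] by (intro tendsto_intros \<alpha> s)
    then have e: "e \<longlonglongrightarrow> 0" by simp
    have "(\<lambda>n. v + e n *s u) \<longlonglongrightarrow> v + 0 *s u"
      unfolding vector_scalar_mult_def
      by (intro vec_tendstoI, simp only: vec_lambda_beta vector_add_component) (intro tendsto_intros e)
    then have "(\<lambda>n. cp2_of (v + e n *s u)) \<longlonglongrightarrow> cp2_of v" using tendsto_cp2_of assms(3) by fastforce
    then have x: "(\<lambda>n. cp2_of (v + e (r n) *s u)) \<longlonglongrightarrow> cp2_of v"
      using LIMSEQ_subseq_LIMSEQ[OF _ l(1)] by (fastforce simp: o_def)
    have "(\<lambda>n. (h \<circ> r) n + \<tau> *s (p \<circ> r) n) \<longlonglongrightarrow> l + \<tau> *s (T *v u)"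
      unfolding vector_scalar_mult_def
      by (intro vec_tendstoI, simp only: vec_lambda_beta vector_add_component)
        (intro tendsto_intros l LIMSEQ_subseq_LIMSEQ[OF p l(1)])
    then have "(\<lambda>n. cp2_of ((h \<circ> r) n + \<tau> *s (p \<circ> r) n)) \<longlonglongrightarrow> cp2_of (l + \<tau> *s (T *v u))"
      by (rule tendsto_cp2_of) (use affine_points_distinct(1) \<open>cross l (T *v u) \<noteq> 0\<close> in blast)
    moreover have "\<forall>\<^sub>F n in sequentially. cp2_of ((h \<circ> r) n + \<tau> *s (p \<circ> r) n)
        = papp (A (r n)) (cp2_of (v + e (r n) *s u))"
      using evr
    proof eventually_elim
      case (elim n)
      let ?n = "r n"
      have "c ?n *\<^sub>R (A ?n *v (v + e ?n *s u)) = q ?n + e ?n *s p ?n"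
        unfolding p_def q_def scaleR_matrix_vector_assoc[symmetric] by (simp add: matrix_vector_right_distrib vec.scale)
      also have "\<dots> = norm (s ?n) *\<^sub>R (h ?n + \<tau> *s p ?n)"
      proof -
        have "norm (s ?n) *\<^sub>R h ?n = s ?n" using good[OF elim] by (simp add: h_def)
        moreover have "q ?n = s ?n + \<alpha> ?n *s p ?n" by (simp add: s_def)
        ultimately show ?thesis
          unfolding scaleR_add_right scaleR_complex_vec[of _ "\<tau> *s p ?n"] e_def
          by (simp add: vec_eq_iff algebra_simps)
      qed
      finally have "cp2_of (A ?n *v (v + e ?n *s u)) = cp2_of (h ?n + \<tau> *s p ?n)"
        using good[OF elim] by (metis cp2_of_scaleR norm_eq_zero)
      then show ?case using ind by (simp add: papp_cp2_of)
    qed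
    ultimately have "(\<lambda>n. papp (A (r n)) (cp2_of (v + e (r n) *s u))) \<longlonglongrightarrow> cp2_of (l + \<tau> *s (T *v u))"
      by (rule Lim_transform_eventually)
    with x show ?thesis by blast
  qed
  ultimately show ?thesis using that l(1) by blast
qed

end

section \<open>Subgroups of finite index with three fixed points\<close>

lemma combination_0:
  assumes "cross v w \<noteq> 0" "a *s v + b *s w = c *s v + d *s w" shows "a = c" "b = d"
proof -
  have "cross (a *s v + b *s w) w = a *s cross v w" "cross v (a *s v + b *s w) = b *s cross v w" for a b
    by (simp_all add: cross_def vec_eq_iff forall_3 algebra_simps)
  then show "a = c" "b = d" using assms by (metis vector_mul_rcancel)+
qed

lemma dot3_cross_cyclic:
  "dot3 (cross x y) z = dot3 (cross y z) x" "dot3 (cross x y) z = dot3 (cross z x) y"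
  by (simp_all add: dot3_def cross_def algebra_simps)

lemma matrix_eq_0I:
  fixes T :: "complex^3^3" assumes "\<And>v. T *v v = 0" shows "T = 0"
  using assms by (simp add: matrix_eq)

context discrete_matrix_group
begin

text \<open>A convergent sequence is bounded, so it takes only finitely many values in the
  group.\<close>

lemma discrete_convergent:
  assumes "\<And>n :: nat. C n \<in> G" "C \<longlonglongrightarrow> X" shows "\<forall>\<^sub>F n in sequentially. C n = X"
proof -
  obtain R where R: "\<And>n. norm (C n) \<le> R"
    using convergent_imp_bounded[OF assms(2)] bounded_iff[of "range C"] by auto
  let ?F = "{A \<in> G. norm A \<le> R} - {X}"
  have "open (- ?F)" using finite_balls finite_imp_closed by blast
  then have "\<forall>\<^sub>F n in sequentially. C n \<in> - ?F"
    using topological_tendstoD[OF assms(2)] by blast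
  then show ?thesis by (rule eventually_mono) (use assms(1) R in auto)
qed

end

locale finite_index_subgroup = discrete_matrix_group +
  fixes H D :: "(complex^3^3) set"
  assumes sub_G: "A \<in> H \<Longrightarrow> A \<in> G"
    and mult_H: "A \<in> H \<Longrightarrow> B \<in> H \<Longrightarrow> A ** B \<in> H"
    and inverse_H: "A \<in> H \<Longrightarrow> adj3 A \<in> H"
    and finite_D: "finite D" "D \<subseteq> G"
    and cosets: "A \<in> G \<Longrightarrow> \<exists>d\<in>D. \<exists>B\<in>H. A = d ** B"
begin

text \<open>By pigeonhole the coset representative is constant along a subsequence, and removing a
  factor on the left does not change the kernel; hence the use of left cosets. So \<open>KER\<close>
  is determined by the limits of \<open>H\<close> alone.\<close>

lemma limit_in_subgroup:
  assumes "limit_of A T"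
  obtains B T0 where "limit_of B T0" "\<And>n. B n \<in> H" "pker T = pker T0"
proof -
  have "\<forall>n. \<exists>d B. d \<in> D \<and> B \<in> H \<and> A n = d ** B" using cosets limit_of_G[OF assms] by blast
  then obtain d B where d: "\<And>n. d n \<in> D" "\<And>n. B n \<in> H" "\<And>n. A n = d n ** B n" by metis
  have "finite (d ` UNIV)" by (rule finite_subset[of _ D]) (use d(1) finite_D in auto)
  then obtain n0 where n0: "infinite {n \<in> UNIV. d n = d n0}"
    using pigeonhole_infinite[OF infinite_UNIV_nat, of d] by blast
  then obtain r :: "nat \<Rightarrow> nat" where r1: "strict_mono r" "\<forall>n. r n \<in> {n \<in> UNIV. d n = d n0}"
    using infinite_enumerate[OF n0] by blast
  then have r: "strict_mono r" "\<And>n. d (r n) = d n0" by auto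
  have dG: "d n0 \<in> G" using d(1) finite_D by blast
  have "adj3 (d n0) ** A (r n) = B (r n)" for n
    using dG by (simp add: d(3) r(2) matrix_mul_assoc)
  then have "limit_of (\<lambda>n. B (r n)) (adj3 (d n0) ** T)"
    using limit_of_mult_left[OF limit_of_subseq[OF assms r(1)] inverse_G[OF dG]] by (simp add: o_def)
  moreover have "pker T = pker (adj3 (d n0) ** T)"
    using inverse_simps(6)[OF inverse_G[OF dG]]
    by (simp add: pker_def matrix_vector_mul_assoc[symmetric])
  ultimately show ?thesis using that d(2) by blast
qed

text \<open>For nonzero \<open>v\<close>, being an eigenvector is the closed condition
  \<open>cross v (A *v v) = 0\<close>.\<close>

lemma limit_eigenvector:
  assumes "limit_of B T" "\<And>n. B n \<in> H" "v \<noteq> 0" "\<And>A. A \<in> H \<Longrightarrow> \<exists>l. A *v v = l *s v"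
  shows "\<exists>t. T *v v = t *s v"
proof -
  obtain c :: "nat \<Rightarrow> real" where c: "c \<longlonglongrightarrow> 0" "(\<lambda>n. c n *\<^sub>R B n) \<longlonglongrightarrow> T"
    using assms(1) by (auto simp: limit_of_def)
  have "cross v ((c n *\<^sub>R B n) *v v) = 0" for n
  proof -
    obtain l where "B n *v v = l *s v" using assms by blast
    then have "(c n *\<^sub>R B n) *v v = (of_real (c n) * l) *s v"
      by (simp add: scaleR_matrix_vector_assoc scaleR_complex_vec)
    then show ?thesis by (simp add: cross_scale)
  qed
  moreover have "(\<lambda>n. cross v ((c n *\<^sub>R B n) *v v)) \<longlonglongrightarrow> cross v (T *v v)"
    by (intro tendsto_cross tendsto_const tendsto_matrix_vector_mult c)
  ultimately have "cross v (T *v v) = 0" by (simp add: LIMSEQ_const_iff)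
  then show ?thesis using cross_eq_0D assms(3) by blast
qed

text \<open>All of \<open>H\<close>, hence every limit \<open>T\<close> of it, is diagonal in the
  basis \<open>v1\<close>, \<open>v2\<close>, \<open>v3\<close>. Some diagonal entry of
  \<open>T\<close> is nonzero, and vectors in the kernel lack the corresponding coordinate.\<close>

lemma KER_triangle:
  assumes ind: "dot3 (cross v1 v2) v3 \<noteq> 0"
    and eigen: "\<And>A. A \<in> H \<Longrightarrow> \<exists>l. A *v v1 = l *s v1" "\<And>A. A \<in> H \<Longrightarrow> \<exists>l. A *v v2 = l *s v2"
      "\<And>A. A \<in> H \<Longrightarrow> \<exists>l. A *v v3 = l *s v3"
  shows "KER \<subseteq> \<Union>{pline (cross v1 v2), pline (cross v2 v3), pline (cross v3 v1)}"
proof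
  fix x assume "x \<in> KER"
  then obtain A S where S: "limit_of A S" "x \<in> pker S" by (auto simp: KER_def)
  then obtain B T where T: "limit_of B T" "\<And>n. B n \<in> H" "x \<in> pker T"
    using limit_in_subgroup by metis
  obtain z where z: "z \<noteq> 0" "x = cp2_of z" by (rule cp2_cases)
  then have Tz: "T *v z = 0" using T by (simp add: cp2_of_in_pker)
  have nz: "v1 \<noteq> 0" "v2 \<noteq> 0" "v3 \<noteq> 0" using ind by (auto simp: cross_def dot3_def)
  obtain t1 t2 t3 where t: "T *v v1 = t1 *s v1" "T *v v2 = t2 *s v2" "T *v v3 = t3 *s v3"
    using limit_eigenvector[OF T(1,2)] nz eigen by meson
  obtain a b c where abc: "z = a *s v1 + b *s v2 + c *s v3" using basis_of_cross[OF ind] by blast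
  have T0: "(t1 * a) *s v1 + (t2 * b) *s v2 + (t3 * c) *s v3 = 0"
    using Tz t by (simp add: abc matrix_vector_right_distrib vec.scale vector_smult_assoc mult.commute)
  note cyc = dot3_cross_cyclic[of v1 v2 v3]
  have 0: "t1 * a = 0" "t2 * b = 0" "t3 * c = 0"
    using arg_cong[OF T0, of "dot3 (cross v1 v2)"] arg_cong[OF T0, of "dot3 (cross v2 v3)"]
      arg_cong[OF T0, of "dot3 (cross v3 v1)"] ind
    by (simp_all add: dot3_add dot3_scale cyc[symmetric])
  have "t1 \<noteq> 0 \<or> t2 \<noteq> 0 \<or> t3 \<noteq> 0"
  proof (rule ccontr)
    assume t0: "\<not> ?thesis"
    have "T *v v = 0" for v
    proof -
      obtain a b c where "v = a *s v1 + b *s v2 + c *s v3" using basis_of_cross[OF ind] by blast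
      then show ?thesis using t0 t by (simp add: matrix_vector_right_distrib vec.scale)
    qed
    then show False using T(1) matrix_eq_0I by (auto simp: limit_of_def)
  qed
  then have "dot3 (cross v1 v2) z = 0 \<or> dot3 (cross v2 v3) z = 0 \<or> dot3 (cross v3 v1) z = 0"
    using 0 by (auto simp: abc dot3_add dot3_scale)
  then show "x \<in> \<Union>{pline (cross v1 v2), pline (cross v2 v3), pline (cross v3 v1)}"
    using z by (auto simp: cp2_of_in_pline)
qed

text \<open>
  If a limit of the subgroup does not vanish on the axis, conjugation by the approximating
  sequence shrinks translations, so by discreteness there are none; then the subgroup is abelian
  and the isolated eigenvector of one element is a common eigenvector.
\<close>

lemma axis_cases:
  assumes a: "a \<noteq> 0" and axis: "\<And>A. A \<in> H \<Longrightarrow> \<exists>l. \<forall>v. dot3 a v = 0 \<longrightarrow> A *v v = l *s v"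
    and not_axis: "\<not> KER \<subseteq> pline a"
  obtains u where "dot3 a u \<noteq> 0" "\<And>A. A \<in> H \<Longrightarrow> \<exists>l. A *v u = l *s u"
proof -
  obtain A S x where S: "limit_of A S" "x \<in> pker S" "x \<notin> pline a"
    using not_axis by (auto simp: KER_def)
  then obtain B T where T: "limit_of B T" "\<And>n. B n \<in> H" "x \<in> pker T"
    using limit_in_subgroup by metis
  obtain z where z: "z \<noteq> 0" "x = cp2_of z" by (rule cp2_cases)
  then have z: "T *v z = 0" "dot3 a z \<noteq> 0" using T S by (simp_all add: cp2_of_in_pker cp2_of_in_pline)
  define e where "e = (1 / dot3 a z) *s z"
  have e: "T *v e = 0" "dot3 a e = 1" using z by (simp_all add: e_def vec.scale dot3_scale)
  \<comment> \<open>A map that is \<open>l\<close> on the kernel of \<open>a\<close> is determined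
    by one more vector \<open>u\<close>. Its eigenvalue on the quotient by that kernel is
    \<open>l + dot3 a u\<close>, called \<open>k n\<close> for the sequence
    \<open>B\<close>.\<close>
  define form where "form A l u \<longleftrightarrow> (\<forall>v. A *v v = l *s v + dot3 a v *s u)" for A l u
  have form_ex: "\<exists>l u. form A l u" if AH: "A \<in> H" for A
  proof -
    obtain l where l: "\<And>v. dot3 a v = 0 \<Longrightarrow> A *v v = l *s v" using axis[OF AH] by blast
    have "A *v v = l *s v + dot3 a v *s (A *v e - l *s e)" for v
    proof -
      have "A *v (v - dot3 a v *s e) = l *s (v - dot3 a v *s e)"
        by (rule l) (simp add: dot3_diff dot3_scale e)
      then show ?thesis
        by (simp add: matrix_vector_mult_diff_distrib vec.scale algebra_simps vec_eq_iff)
    qed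
    then show ?thesis unfolding form_def by blast
  qed
  have form_dot: "dot3 a (A *v v) = (l + dot3 a u) * dot3 a v" if "form A l u" for A l u v
    using that by (simp add: form_def dot3_add dot3_scale algebra_simps)
  obtain x0 y0 where xy: "cross x0 y0 \<noteq> 0" "dot3 a x0 = 0" using normal_basis a by metis
  then have x0: "x0 \<noteq> 0" by (auto simp: cross_def vec_eq_iff forall_3)
  have form_nz: "l \<noteq> 0" "l + dot3 a u \<noteq> 0" if "form A l u" "A \<in> H" for A l u
  proof -
    have "A *v x0 \<noteq> 0" using x0 sub_G[OF that(2)] by simp
    then show "l \<noteq> 0" using that(1) xy by (auto simp: form_def)
    have "dot3 a (A *v (adj3 A *v e)) = 1" using sub_G[OF that(2)] e by simp
    then show "l + dot3 a u \<noteq> 0" using form_dot[OF that(1)] by auto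
  qed
  have "\<forall>n. \<exists>l u. form (B n) l u" using form_ex T(2) by blast
  then obtain l u where lu: "\<And>n. form (B n) (l n) (u n)" by metis
  define k where "k n = l n + dot3 a (u n)" for n
  obtain c :: "nat \<Rightarrow> real" where c: "c \<longlonglongrightarrow> 0" "(\<lambda>n. c n *\<^sub>R B n) \<longlonglongrightarrow> T"
    using T(1) by (auto simp: limit_of_def)
  have lim: "(\<lambda>n. of_real (c n) *s (B n *v v)) \<longlonglongrightarrow> T *v v" for v
    using tendsto_matrix_vector_mult[OF c(2) tendsto_const[of v]]
    by (simp add: scaleR_matrix_vector_assoc scaleR_complex_vec)
  obtain i where i: "x0 $ i \<noteq> 0" using x0 by (auto simp: vec_eq_iff)
  define t where "t = (T *v x0) $ i / x0 $ i"
  have "(\<lambda>n. (of_real (c n) *s (B n *v x0)) $ i / x0 $ i) \<longlonglongrightarrow> t"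
    unfolding t_def by (intro tendsto_intros lim i)
  moreover have "(of_real (c n) *s (B n *v x0)) $ i / x0 $ i = of_real (c n) * l n" for n
    using lu[of n] i xy by (simp add: form_def)
  ultimately have cl: "(\<lambda>n. of_real (c n) * l n) \<longlonglongrightarrow> t" by simp
  have T_axis: "T *v v = t *s v" if "dot3 a v = 0" for v
  proof -
    have "(\<lambda>n. (of_real (c n) * l n) *s v) \<longlonglongrightarrow> t *s v"
      unfolding vector_scalar_mult_def
      by (intro vec_tendstoI, simp only: vec_lambda_beta) (intro tendsto_intros cl)
    moreover have "of_real (c n) *s (B n *v v) = (of_real (c n) * l n) *s v" for n
      using lu[of n] that by (simp add: form_def vector_smult_assoc)
    ultimately show ?thesis using lim[of v] LIMSEQ_unique by auto
  qed
  have "t \<noteq> 0"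
  proof
    assume "t = 0"
    have "T *v v = 0" for v
      using T_axis[of "v - dot3 a v *s e"] \<open>t = 0\<close> e
      by (simp add: matrix_vector_mult_diff_distrib vec.scale dot3_diff dot3_scale)
    then show False using T(1) matrix_eq_0I by (auto simp: limit_of_def)
  qed
  have "(\<lambda>n. dot3 a (of_real (c n) *s (B n *v e))) \<longlonglongrightarrow> dot3 a (T *v e)"
    unfolding dot3_def by (intro tendsto_intros lim)
  then have ck: "(\<lambda>n. of_real (c n) * k n) \<longlonglongrightarrow> 0"
    by (simp add: e dot3_scale form_dot[OF lu] k_def)
  have "(\<lambda>n. (of_real (c n) * k n) / (of_real (c n) * l n)) \<longlonglongrightarrow> 0 / t"
    by (intro tendsto_intros ck cl \<open>t \<noteq> 0\<close>)
  moreover have "\<forall>\<^sub>F n in sequentially. (of_real (c n) * k n) / (of_real (c n) * l n) = k n / l n"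
    using tendsto_imp_eventually_ne[OF cl \<open>t \<noteq> 0\<close>] by (rule eventually_mono) auto
  \<comment> \<open>The limit \<open>T\<close> is the nonzero scalar \<open>t\<close> on the axis
    and kills \<open>e\<close>, so the eigenvalue on the quotient becomes negligible. This ratio is
    the factor by which conjugation shrinks translations.\<close>
  ultimately have kl: "(\<lambda>n. k n / l n) \<longlonglongrightarrow> 0"
    using Lim_transform_eventually by fastforce
  have no_translation: "w = 0" if C: "C \<in> H" "form C 1 w" "dot3 a w = 0" for C w
  proof -
    define E where "E n = adj3 (B n) ** (C ** B n)" for n
    have EG: "E n \<in> G" for n
      unfolding E_def using C(1) T(2) by (auto intro: sub_G mult_H inverse_H)
    have E: "E n *v v = v + (k n / l n * dot3 a v) *s w" for n v
    proof -
      have B: "B n \<in> G" using T(2) sub_G by blast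
      have "B n *v w = l n *s w" using lu[of n] C(3) by (simp add: form_def)
      then have "l n *s (adj3 (B n) *v w) = w" using B inverse_simps(4)[OF B, of w] by (simp add: vec.scale)
      then have w: "adj3 (B n) *v w = inverse (l n) *s w"
        using form_nz(1)[OF lu T(2)]
        by (metis vector_smult_assoc left_inverse vector_smult_lid)
      have "E n *v v = adj3 (B n) *v (C *v (B n *v v))"
        by (simp add: E_def matrix_vector_mul_assoc matrix_mul_assoc)
      also have "\<dots> = adj3 (B n) *v (B n *v v + (k n * dot3 a v) *s w)"
        using C(2) form_dot[OF lu] by (simp add: form_def k_def)
      also have "\<dots> = v + (k n / l n * dot3 a v) *s w"
        using B by (simp add: matrix_vector_right_distrib vec.scale w vector_smult_assoc divide_inverse mult_ac)
      finally show ?thesis .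
    qed
    have Ee: "(\<lambda>n. E n *v v) \<longlonglongrightarrow> v" for v
    proof -
      have "(\<lambda>n. v + (k n / l n * dot3 a v) *s w) \<longlonglongrightarrow> v + (0 * dot3 a v) *s w"
        unfolding vector_scalar_mult_def
        by (intro vec_tendstoI, simp only: vec_lambda_beta vector_add_component) (intro tendsto_intros kl)
      then show ?thesis by (simp add: E)
    qed
    have "E \<longlonglongrightarrow> mat 1"
    proof (intro vec_tendstoI)
      fix i j :: 3
      have "M $ i $ j = (M *v axis j 1) $ i" for M :: "complex^3^3"
        using exhaust_3[of j] by (auto simp: matrix_vector_mult_def sum_3 axis_def)
      then show "(\<lambda>n. E n $ i $ j) \<longlonglongrightarrow> mat 1 $ i $ j"
        using tendsto_vec_nth[OF Ee[of "axis j 1"], of i] by simp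
    qed
    from eventually_happens[OF discrete_convergent[OF EG this]] obtain n where "E n = mat 1" by auto
    then have "(k n / l n) *s w = 0" using E[of n e] e by simp
    then show "w = 0" using form_nz[OF lu T(2), of n] by (simp add: k_def)
  qed
  have commute: "dot3 a w *s u = dot3 a u *s w" if A: "A \<in> H" "form A l u" and B: "B \<in> H" "form B m w" for A B l m u w
  proof -
    define X where "X = A ** B"
    define Y where "Y = B ** A"
    have XY: "X \<in> H" "Y \<in> H" using A B mult_H by (auto simp: X_def Y_def)
    \<comment> \<open>The vector \<open>d\<close> measures the failure of \<open>A\<close> and
      \<open>B\<close> to commute: \<open>X ** adj3 Y\<close> is the translation along
      \<open>(1 / \<kappa>) *s d\<close>, where \<open>\<kappa>\<close> is the eigenvalue of
      \<open>Y\<close> on the quotient.\<close>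
    define d where "d = dot3 a w *s u - dot3 a u *s w"
    define \<kappa> where "\<kappa> = (l + dot3 a u) * (m + dot3 a w)"
    have "A *v v = l *s v + dot3 a v *s u" "B *v v = m *s v + dot3 a v *s w" for v
      using A(2) B(2) by (simp_all add: form_def)
    then have X: "X *v v = Y *v v + dot3 a v *s d" for v
      by (simp add: X_def Y_def matrix_vector_mul_assoc[symmetric] dot3_add dot3_scale d_def)
    have Y: "dot3 a (Y *v v) = \<kappa> * dot3 a v" for v
      by (simp add: Y_def matrix_vector_mul_assoc[symmetric] form_dot[OF A(2)] form_dot[OF B(2)] \<kappa>_def)
    have \<kappa>: "\<kappa> \<noteq> 0" using form_nz A B by (simp add: \<kappa>_def)
    have "form (X ** adj3 Y) 1 ((1 / \<kappa>) *s d)"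
      unfolding form_def
    proof
      fix v
      have "dot3 a (adj3 Y *v v) = dot3 a v / \<kappa>"
        using Y[of "adj3 Y *v v"] XY(2) \<kappa> by (simp add: sub_G field_simps)
      then show "(X ** adj3 Y) *v v = 1 *s v + dot3 a v *s ((1 / \<kappa>) *s d)"
        using XY(2) by (simp add: matrix_vector_mul_assoc[symmetric] X sub_G vector_smult_assoc)
    qed
    moreover have "X ** adj3 Y \<in> H" using XY mult_H inverse_H by blast
    moreover have "dot3 a ((1 / \<kappa>) *s d) = 0" by (simp add: d_def dot3_scale dot3_diff mult.commute)
    ultimately have "(1 / \<kappa>) *s d = 0" using no_translation by blast
    then have "d = 0" using \<kappa> by (metis vector_mul_eq_0 divide_eq_0_iff zero_neq_one)
    then show ?thesis by (simp add: d_def)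
  qed
  have "\<forall>\<^sub>F n in sequentially. k n / l n \<noteq> 1"
    using tendsto_imp_eventually_ne[OF kl, of 1] by simp
  \<comment> \<open>A ratio other than 1 separates the eigenvalue on the quotient from the one on
    the axis, so \<open>u n\<close> is an eigenvector of \<open>B n\<close> off the axis.\<close>
  then obtain n where n: "k n / l n \<noteq> 1" using eventually_happens by fastforce
  show ?thesis
  proof (rule that[of "u n"])
    show "dot3 a (u n) \<noteq> 0" using n form_nz(1)[OF lu T(2), of n] by (auto simp: k_def)
    fix A assume A: "A \<in> H"
    then obtain m w where mw: "form A m w" using form_ex by blast
    have "A *v u n = m *s u n + dot3 a (u n) *s w" using mw by (simp add: form_def)
    also have "\<dots> = (m + dot3 a w) *s u n"
      using commute[OF T(2)[of n] lu[of n] A mw] by (simp add: vector_sadd_rdistrib)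
    finally show "\<exists>l. A *v u n = l *s u n" by blast
  qed
qed

lemma KER_of_three_fixed_points:
  assumes dist: "x1 \<noteq> x2" "x1 \<noteq> x3" "x2 \<noteq> x3"
    and fixed: "\<And>A x. A \<in> H \<Longrightarrow> x \<in> {x1, x2, x3} \<Longrightarrow> papp A x = x"
  obtains M where "finite M" "card M \<le> 3" "\<And>m. m \<in> M \<Longrightarrow> complex_line m" "KER \<subseteq> \<Union>M"
proof -
  note result = that
  obtain v1 v2 v3 where v: "v1 \<noteq> 0" "x1 = cp2_of v1" "v2 \<noteq> 0" "x2 = cp2_of v2" "v3 \<noteq> 0" "x3 = cp2_of v3"
    using cp2_cases by metis
  have eig: "\<exists>l. A *v v = l *s v" if "A \<in> H" "v \<noteq> 0" "papp A (cp2_of v) = cp2_of v" for A v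
  proof -
    have "A *v v \<noteq> 0" using that sub_G by simp
    then have "cross v (A *v v) = 0" using that by (simp add: cross_eq_0_iff papp_cp2_of)
    then show ?thesis using cross_eq_0D that(2) by blast
  qed
  have e: "\<exists>l. A *v v1 = l *s v1" "\<exists>l. A *v v2 = l *s v2" "\<exists>l. A *v v3 = l *s v3" if "A \<in> H" for A
    using eig[OF that] fixed[OF that] v by auto
  have triangle: thesis if ind: "dot3 (cross v1 v2) w \<noteq> 0" and ew: "\<And>A. A \<in> H \<Longrightarrow> \<exists>l. A *v w = l *s w" for w
  proof (rule result[of "{pline (cross v1 v2), pline (cross v2 w), pline (cross w v1)}"])
    have "cross v1 v2 \<noteq> 0" "cross v2 w \<noteq> 0" "cross w v1 \<noteq> 0"
      using ind dot3_cross_cyclic[of v1 v2 w] by auto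
    then show "complex_line m" if "m \<in> {pline (cross v1 v2), pline (cross v2 w), pline (cross w v1)}" for m
      using that complex_line_iff by auto
    show "KER \<subseteq> \<Union>{pline (cross v1 v2), pline (cross v2 w), pline (cross w v1)}"
      by (rule KER_triangle[OF ind e(1,2) ew])
  qed (auto simp: card_insert_if)
  show thesis
  proof (cases "dot3 (cross v1 v2) v3 = 0")
    case False
    then show ?thesis using triangle e(3) by blast
  next
    case True
    have c12: "cross v1 v2 \<noteq> 0" using dist v cross_eq_0_iff by blast
    obtain \<alpha> \<beta> where v3: "v3 = \<alpha> *s v1 + \<beta> *s v2" using span_of_cross[OF c12 True] by blast
    have ab: "\<alpha> \<noteq> 0" "\<beta> \<noteq> 0" using dist v v3 by (auto simp: cp2_of_scale0)
    \<comment> \<open>The eigenvector \<open>v3\<close> has nonzero coordinates along both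
      \<open>v1\<close> and \<open>v2\<close>, which forces their eigenvalues to agree.\<close>
    have axis: "\<exists>l. \<forall>v. dot3 (cross v1 v2) v = 0 \<longrightarrow> A *v v = l *s v" if A: "A \<in> H" for A
    proof -
      obtain l1 l2 l3 where l: "A *v v1 = l1 *s v1" "A *v v2 = l2 *s v2" "A *v v3 = l3 *s v3"
        using e[OF A] by blast
      have "(\<alpha> * l1) *s v1 + (\<beta> * l2) *s v2 = (\<alpha> * l3) *s v1 + (\<beta> * l3) *s v2"
        using l(3) by (simp add: v3 matrix_vector_right_distrib vec.scale l vector_smult_assoc
            vector_add_ldistrib mult.commute)
      then have "l1 = l3" "l2 = l3" using combination_0[OF c12] ab by (metis mult_cancel_left)+
      then have "A *v v = l3 *s v" if "dot3 (cross v1 v2) v = 0" for v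
        using span_of_cross[OF c12 that] l
        by (auto simp: matrix_vector_right_distrib vec.scale vector_add_ldistrib vector_smult_assoc mult.commute)
      then show ?thesis by blast
    qed
    show ?thesis
    proof (cases "KER \<subseteq> pline (cross v1 v2)")
      case True
      then show ?thesis using that[of "{pline (cross v1 v2)}"] c12 complex_line_iff by auto
    next
      case False
      \<comment> \<open>The eigenvector off the axis completes \<open>v1\<close>, \<open>v2\<close>
        to a basis, so the triangle case applies again.\<close>
      show ?thesis by (rule axis_cases[OF c12 axis False]) (use triangle in blast)+
    qed
  qed
qed

end

section \<open>Configurations of lines\<close>

lemma line_Int_subsingleton:
  assumes "complex_line L" "complex_line M" "L \<noteq> M" "x \<in> L" "x \<in> M" shows "L \<inter> M = {x}"
  using line_unique[OF assms(1,2)] assms by blast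

lemma obtain_three:
  assumes "3 \<le> card A" obtains x y z where "x \<in> A" "y \<in> A" "z \<in> A" "x \<noteq> y" "x \<noteq> z" "y \<noteq> z"
proof -
  obtain B where "B \<subseteq> A" "card B = 3" using obtain_subset_with_card_n[OF assms] by metis
  then show ?thesis using that card_3_iff[of B] by auto
qed

lemma lines_through_two_points_finite:
  assumes "p \<noteq> q" shows "finite {L. complex_line L \<and> p \<in> L \<and> q \<in> L}"
proof -
  obtain L where "complex_line L" "p \<in> L" "q \<in> L" using line_through[OF assms] by blast
  then have "{L. complex_line L \<and> p \<in> L \<and> q \<in> L} \<subseteq> {L}" using line_unique[OF _ _ assms] by auto
  then show ?thesis using finite_subset by blast
qed

context discrete_matrix_group
begin

lemma papp_mult_G: "A \<in> G \<Longrightarrow> B \<in> G \<Longrightarrow> papp (A ** B) x = papp A (papp B x)"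
  by (simp add: papp_mult)

text \<open>
  All lines in the invariant set pass through the finitely many intersection points of a maximal
  configuration. The points lying on infinitely many of these lines, and the lines avoiding those
  points, form a finite invariant family, so a subgroup of finite index fixes each of its members.
\<close>

lemma five_lines_not_maximal:
  assumes inv: "\<And>A x. A \<in> G \<Longrightarrow> x \<in> \<Lambda> \<Longrightarrow> papp A x \<in> \<Lambda>"
    and ker: "\<Lambda> \<subseteq> KER"
    and S: "finite S" "5 \<le> card S" "\<And>L. L \<in> S \<Longrightarrow> complex_line L" "general_position S" "\<Union>S \<subseteq> \<Lambda>"
    and max: "\<And>L. complex_line L \<Longrightarrow> L \<subseteq> \<Lambda> \<Longrightarrow> L \<notin> S \<Longrightarrow> \<not> general_position (insert L S)"
  shows False
proof -
  define LL where "LL = {L. complex_line L \<and> L \<subseteq> \<Lambda>}"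
  define Q where "Q = (\<Union>a\<in>S. \<Union>b\<in>S - {a}. a \<inter> b)"
  define P where "P = {p. infinite {L \<in> LL. p \<in> L}}"
  define F where "F = {L \<in> LL. L \<inter> P = {}}"
  \<comment> \<open>Points enter as singletons, so that a single finite family of sets records
    points and lines alike.\<close>
  define X where "X = (\<lambda>p. {p}) ` P \<union> F"
  have gp: "x \<notin> c" if "a \<in> S" "b \<in> S" "c \<in> S" "a \<noteq> b" "b \<noteq> c" "a \<noteq> c" "x \<in> a" "x \<in> b" for a b c x
    using S(4) that unfolding general_position_def by blast
  have S_LL: "L \<in> LL" if "L \<in> S" for L using S that by (auto simp: LL_def)
  have finQ: "finite Q"
    unfolding Q_def
  proof (intro finite_UN_I S finite_Diff)
    fix a b assume ab: "a \<in> S" "b \<in> S - {a}"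
    then obtain x where "x \<in> a" "x \<in> b" using lines_meet S(3) by (metis DiffD1)
    then have "a \<inter> b = {x}" using line_Int_subsingleton[of a b x] S(3) ab by auto
    then show "finite (a \<inter> b)" by simp
  qed
  \<comment> \<open>A line of \<open>S\<close> crosses the others in \<open>Q\<close>; a line
    outside \<open>S\<close> passes, by maximality, through a common point of two lines of
    \<open>S\<close>.\<close>
  have meetsQ: "\<exists>q\<in>Q. q \<in> L" if L: "L \<in> LL" for L
  proof (cases "L \<in> S")
    case True
    have "S - {L} \<noteq> {}"
    proof
      assume "S - {L} = {}"
      then have "card S \<le> card {L}" by (intro card_mono) auto
      then show False using S(2) by simp
    qed
    then obtain b where b: "b \<in> S - {L}" by blast
    then obtain x where "x \<in> L" "x \<in> b" using lines_meet S(3) True by (metis DiffD1)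
    then show ?thesis using b True unfolding Q_def by blast
  next
    case False
    then have "\<not> general_position (insert L S)" using max L by (auto simp: LL_def)
    then obtain a b c x where abc: "a \<in> insert L S" "b \<in> insert L S" "c \<in> insert L S"
      "a \<noteq> b" "b \<noteq> c" "a \<noteq> c" "x \<in> a" "x \<in> b" "x \<in> c"
      unfolding general_position_def by blast
    have "\<not> (a \<in> S \<and> b \<in> S \<and> c \<in> S)" using gp abc by blast
    then have "\<exists>a'\<in>S. \<exists>b'\<in>S - {a'}. x \<in> a' \<inter> b'" "x \<in> L" using abc by blast+
    then show ?thesis unfolding Q_def by blast
  qed
  have PQ: "P \<subseteq> Q"
  proof
    fix p assume p: "p \<in> P"
    show "p \<in> Q"
    proof (rule ccontr)
      assume "p \<notin> Q"
      \<comment> \<open>Each line here passes through \<open>p\<close> and some point of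
        \<open>Q\<close>; for \<open>p\<close> outside \<open>Q\<close> the two points are distinct
        and determine it, leaving finitely many lines.\<close>
      have "{L \<in> LL. p \<in> L} \<subseteq> (\<Union>q\<in>Q. {L. complex_line L \<and> p \<in> L \<and> q \<in> L})"
        using meetsQ by (auto simp: LL_def)
      moreover have "finite (\<Union>q\<in>Q. {L. complex_line L \<and> p \<in> L \<and> q \<in> L})"
        using \<open>p \<notin> Q\<close> by (intro finite_UN_I finQ lines_through_two_points_finite) auto
      ultimately have "finite {L \<in> LL. p \<in> L}" by (rule finite_subset)
      then show False using p by (simp add: P_def)
    qed
  qed
  then have finP: "finite P" using finQ finite_subset by blast
  have "F \<subseteq> (\<Union>q\<in>Q - P. {L \<in> LL. q \<in> L})" using meetsQ by (fastforce simp: F_def)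
  moreover have "finite (\<Union>q\<in>Q - P. {L \<in> LL. q \<in> L})" using finQ by (auto simp: P_def)
  ultimately have finF: "finite F" using finite_subset by blast
  have finX: "finite X" using finP finF by (simp add: X_def)
  have inj: "inj (papp A)" if "A \<in> G" for A using papp_bij det_G that bij_is_inj by blast
  have LL_inv: "papp A ` L \<in> LL" if "A \<in> G" "L \<in> LL" for A L
    using that papp_line[of A L] det_G inv by (auto simp: LL_def)
  have P_inv: "papp A p \<in> P" if A: "A \<in> G" "p \<in> P" for A p
  proof -
    have "(`) (papp A) ` {L \<in> LL. p \<in> L} \<subseteq> {L \<in> LL. papp A p \<in> L}" using LL_inv A by auto
    moreover have "inj_on ((`) (papp A)) {L \<in> LL. p \<in> L}"
      using inj_image_eq_iff[OF inj[OF A(1)]] by (intro inj_onI) simp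
    ultimately have "infinite {L \<in> LL. papp A p \<in> L}"
      using A(2) inj_on_finite unfolding P_def by blast
    then show ?thesis by (simp add: P_def)
  qed
  have F_inv: "papp A ` L \<in> F" if A: "A \<in> G" "L \<in> F" for A L
  proof -
    have "papp A x \<notin> P" if "x \<in> L" for x
    proof
      assume "papp A x \<in> P"
      then have "papp (adj3 A) (papp A x) \<in> P" using P_inv inverse_G A(1) by blast
      then show False using A that by (auto simp: F_def)
    qed
    then show ?thesis using LL_inv A by (auto simp: F_def)
  qed
  have X_inv: "papp A ` Y \<in> X" if "A \<in> G" "Y \<in> X" for A Y
    using that P_inv F_inv by (auto simp: X_def)
  define H where "H = {A \<in> G. \<forall>Y\<in>X. papp A ` Y = Y}"
  \<comment> \<open>This is the self-map of \<open>X\<close> induced by \<open>A\<close>. Only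
    finitely many occur, and two elements inducing the same one differ by a factor in
    \<open>H\<close>; finite index results.\<close>
  define res where "res A = (\<lambda>Y\<in>X. papp A ` Y)" for A
  have "res ` G \<subseteq> X \<rightarrow>\<^sub>E X" using X_inv by (auto simp: res_def)
  moreover have "finite (X \<rightarrow>\<^sub>E X)" by (intro finite_PiE finX)
  ultimately have "finite (res ` G)" by (rule finite_subset)
  then obtain D where D: "D \<subseteq> G" "finite D" "res ` G = res ` D"
    using finite_subset_image[OF \<open>finite (res ` G)\<close> subset_refl] by blast
  have H_inv: "papp (adj3 A) ` papp A ` Y = Y" if "A \<in> G" for A Y
    using that by (auto simp: image_image)
  have mult: "papp (A ** B) ` Y = papp A ` papp B ` Y" if "A \<in> G" "B \<in> G" for A B Y
    using that by (simp add: image_image papp_mult_G)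
  interpret finite_index_subgroup G H D
  proof unfold_locales
    fix A assume A: "A \<in> G"
    then have "res A \<in> res ` D" using D(3) by blast
    then obtain d where d: "d \<in> D" "res A = res d" by blast
    then have dG: "d \<in> G" using D by blast
    have "papp A ` Y = papp d ` Y" if "Y \<in> X" for Y
      using fun_cong[OF d(2), of Y] that by (simp add: res_def)
    then have "adj3 d ** A \<in> H"
      using dG A by (simp add: H_def mult_G inverse_G mult H_inv)
    moreover have "A = d ** (adj3 d ** A)" using dG by (simp add: matrix_mul_assoc)
    ultimately show "\<exists>d\<in>D. \<exists>B\<in>H. A = d ** B" using d(1) by blast
  next
    fix A assume A: "A \<in> H"
    then have "papp (adj3 A) ` Y = Y" if "Y \<in> X" for Y
      using H_inv[of A Y] that by (auto simp: H_def)
    then show "adj3 A \<in> H" using A by (simp add: H_def inverse_G)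
  qed (use D in \<open>auto simp: H_def mult_G mult\<close>)
  have fixed_P: "papp A p = p" if "A \<in> H" "p \<in> P" for A p
  proof -
    have "{p} \<in> X" using that(2) by (simp add: X_def)
    then have "papp A ` {p} = {p}" using that(1) unfolding H_def by blast
    then show ?thesis by simp
  qed
  have fixed_meet: "papp A x = x"
    if "A \<in> H" "complex_line a" "complex_line b" "a \<noteq> b" "papp A ` a = a" "papp A ` b = b" "x \<in> a" "x \<in> b" for A a b x
    using line_Int_subsingleton[of a b x] that by blast
  have fixed_F: "papp A ` L = L" if "A \<in> H" "L \<in> F" for A L
    using that by (auto simp: H_def X_def)
  have lineF: "complex_line L" if "L \<in> F" for L using that by (simp add: F_def LL_def)
  \<comment> \<open>Three lines of \<open>S\<close> through one point would violate general
    position. So at most \<open>2 * card P\<close> lines of \<open>S\<close> meet \<open>P\<close>,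
    and the remaining ones lie in \<open>F\<close>.\<close>
  have "card {L \<in> S. p \<in> L} \<le> 2" for p
  proof (rule ccontr)
    assume "\<not> ?thesis"
    then have "3 \<le> card {L \<in> S. p \<in> L}" by simp
    then show False by (rule obtain_three) (use gp in blast)
  qed
  then have "card (\<Union>p\<in>P. {L \<in> S. p \<in> L}) \<le> (\<Sum>p\<in>P. 2)"
    by (intro order_trans[OF card_UN_le[OF finP]] sum_mono)
  moreover have "S - F \<subseteq> (\<Union>p\<in>P. {L \<in> S. p \<in> L})" using S_LL by (auto simp: F_def)
  ultimately have "card (S - F) \<le> 2 * card P"
    using card_mono[of "\<Union>p\<in>P. {L \<in> S. p \<in> L}" "S - F"] finP S(1) by (simp add: mult.commute)
  moreover have "card S = card (S \<inter> F) + card (S - F)"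
    using S(1) card_Int_Diff by blast
  ultimately have SF: "5 \<le> card (S \<inter> F) + 2 * card P" using S(2) by linarith
  have "\<exists>x1 x2 x3. x1 \<noteq> x2 \<and> x1 \<noteq> x3 \<and> x2 \<noteq> x3 \<and> (\<forall>A\<in>H. papp A x1 = x1 \<and> papp A x2 = x2 \<and> papp A x3 = x3)"
  proof -
    \<comment> \<open>If \<open>P\<close> has at most one point, \<open>SF\<close> leaves three
      lines in \<open>F\<close>; if it has two, \<open>SF\<close> leaves one.\<close>
    consider "3 \<le> card P" | "card P = 2" | "3 \<le> card (S \<inter> F)" using SF by linarith
    then show ?thesis
    proof cases
      case 1
      then obtain x1 x2 x3 where "x1 \<in> P" "x2 \<in> P" "x3 \<in> P" "x1 \<noteq> x2" "x1 \<noteq> x3" "x2 \<noteq> x3"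
        by (rule obtain_three)
      then show ?thesis using fixed_P by blast
    next
      case 2
      then obtain p1 p2 where p: "P = {p1, p2}" "p1 \<noteq> p2" using card_2_iff by metis
      have "S \<inter> F \<noteq> {}" using SF 2 by auto
      then obtain f where f: "f \<in> F" by blast
      obtain m where m: "complex_line m" "p1 \<in> m" "p2 \<in> m" using line_through[OF p(2)] by blast
      \<comment> \<open>The third fixed point is where \<open>f\<close> crosses the line
        \<open>m\<close> joining the two fixed points; it is new because \<open>f\<close> avoids
        \<open>P\<close>.\<close>
      obtain x where x: "x \<in> f" "x \<in> m" using lines_meet lineF f m(1) by metis
      have "f \<noteq> m" "x \<noteq> p1" "x \<noteq> p2" using f p m x by (auto simp: F_def)
      have fm: "papp A ` m = m" if A: "A \<in> H" for A
      proof -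
        have "p1 \<in> papp A ` m" "p2 \<in> papp A ` m" using fixed_P[OF A] p m by (metis imageI insertI1 insertI2)+
        then show ?thesis
          using line_unique[OF _ m(1) p(2)] papp_line[OF det_G[OF sub_G[OF A]] m(1)] m by blast
      qed
      have "papp A x = x" if "A \<in> H" for A
        using fixed_meet[OF that lineF[OF f] m(1) \<open>f \<noteq> m\<close> fixed_F[OF that f] fm[OF that] x] .
      moreover have "papp A p1 = p1" "papp A p2 = p2" if "A \<in> H" for A
        using fixed_P[OF that] p(1) by auto
      ultimately show ?thesis using p(2) \<open>x \<noteq> p1\<close> \<open>x \<noteq> p2\<close> by blast
    next
      case 3
      then obtain a b c where abc: "a \<in> S \<inter> F" "b \<in> S \<inter> F" "c \<in> S \<inter> F" "a \<noteq> b" "a \<noteq> c" "b \<noteq> c"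
        by (rule obtain_three)
      then have l: "complex_line a" "complex_line b" "complex_line c" using lineF by auto
      obtain x where x: "x \<in> a" "x \<in> b" by (rule lines_meet[OF l(1,2)])
      obtain y where y: "y \<in> a" "y \<in> c" by (rule lines_meet[OF l(1,3)])
      obtain z where z: "z \<in> b" "z \<in> c" by (rule lines_meet[OF l(2,3)])
      note xyz = x y z
      have "x \<notin> c" by (rule gp[of a b c x]) (use abc xyz in simp_all)
      moreover have "y \<notin> b" by (rule gp[of a c b y]) (use abc xyz in simp_all)
      ultimately have "x \<noteq> y" "x \<noteq> z" "y \<noteq> z" using xyz by metis+
      moreover have "papp A x = x" "papp A y = y" "papp A z = z" if A: "A \<in> H" for A
      proof -
        have F: "papp A ` a = a" "papp A ` b = b" "papp A ` c = c" using fixed_F[OF A] abc by auto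
        show "papp A x = x" by (rule fixed_meet[OF A l(1,2) abc(4) F(1,2) xyz(1,2)])
        show "papp A y = y" by (rule fixed_meet[OF A l(1,3) abc(5) F(1,3) xyz(3,4)])
        show "papp A z = z" by (rule fixed_meet[OF A l(2,3) abc(6) F(2,3) xyz(5,6)])
      qed
      ultimately show ?thesis by blast
    qed
  qed
  then obtain x1 x2 x3 where x: "x1 \<noteq> x2" "x1 \<noteq> x3" "x2 \<noteq> x3"
    "\<And>A. A \<in> H \<Longrightarrow> papp A x1 = x1 \<and> papp A x2 = x2 \<and> papp A x3 = x3" by blast
  have "\<And>A x. A \<in> H \<Longrightarrow> x \<in> {x1, x2, x3} \<Longrightarrow> papp A x = x" using x(4) by auto
  then obtain M where M: "finite M" "card M \<le> 3" "\<And>m. m \<in> M \<Longrightarrow> complex_line m" "KER \<subseteq> \<Union>M"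
    using KER_of_three_fixed_points[OF x(1-3)] by blast
  have "S \<subseteq> M"
    using line_in_finite_Union[OF _ M(1,3)] S(3,5) ker M(4) by blast
  then have "card S \<le> 3" using card_mono M(1,2) order_trans by blast
  then show False using S(2) by simp
qed

end

section \<open>Discrete subgroups of the projective group\<close>

abbreviation coset :: "complex^3^3 \<Rightarrow> (complex^3^3) set" where
  "coset A \<equiv> SL3_center #>\<^bsub>SL3\<^esub> A"

lemma coset_eq: "coset A = {mat c ** A | c. c ^ 3 = 1}"
  by (auto simp: r_coset_def SL3_center_def)

lemma coset_self: "A \<in> coset A"
  unfolding coset_eq by (metis (mono_tags, lifting) matrix_mul_lid mem_Collect_eq power_one)

lemma finite_coset: "finite (coset A)"
proof -
  have "finite {c :: complex. c ^ 3 = 1}" by (rule finite_roots_unity) simp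
  moreover have "coset A = (\<lambda>c. mat c ** A) ` {c. c ^ 3 = 1}" by (auto simp: coset_eq)
  ultimately show ?thesis by simp
qed

lemma act_coset_papp: "det A = 1 \<Longrightarrow> act (coset A) = papp A"
proof
  fix x assume "det A = 1"
  then show "act (coset A) x = papp A x"
    by (metis act_coset cp2_cases papp_cp2_of)
qed

text \<open>The full preimage: each projective map comes with all its lifts, so closure under
  products and inverses needs no choice of lifts.\<close>

definition matrices_of :: "(complex^3^3) set set \<Rightarrow> (complex^3^3) set" where
  "matrices_of \<Gamma> = {A. det A = 1 \<and> coset A \<in> \<Gamma>}"

lemma coset_mult:
  assumes "det A = 1" "det B = 1" shows "coset A \<otimes>\<^bsub>PSL3\<^esub> coset B = coset (A ** B)"
  using normal.rcos_sum[OF normal_SL3_center, of A B] assms by (simp add: PSL3_def FactGroup_def)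

lemma coset_mat_1: "coset (mat 1) = SL3_center"
  unfolding coset_eq unfolding SL3_center_def by simp

lemma coset_one: "coset (mat 1) = \<one>\<^bsub>PSL3\<^esub>"
  by (simp add: PSL3_def FactGroup_def coset_mat_1)

lemma coset_carrier: "det A = 1 \<Longrightarrow> coset A \<in> carrier PSL3"
  unfolding PSL3_def FactGroup_def RCOSETS_def by auto

lemma carrier_coset:
  assumes "g \<in> carrier PSL3" obtains A where "det A = 1" "g = coset A"
  using assms unfolding PSL3_def FactGroup_def RCOSETS_def by auto

text \<open>Discreteness isolates the neutral element in the quotient topology, and its preimage is
  the whole centre rather than \<open>mat 1\<close> alone.\<close>

lemma discrete_near_one:
  assumes "discrete_subgroup \<Gamma>"
  obtains e where "e > 0" "\<And>A. A \<in> matrices_of \<Gamma> \<Longrightarrow> dist A (mat 1) < e \<Longrightarrow> A \<in> SL3_center"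
proof -
  have sub: "subgroup \<Gamma> PSL3" using assms by (simp add: discrete_subgroup_def)
  have one: "coset (mat 1) \<in> \<Gamma>" unfolding coset_one using sub by (rule subgroup.one_closed)
  then have "openin (subtopology PSL3_topology \<Gamma>) {coset (mat 1)}"
    using assms by (simp add: discrete_subgroup_def)
  then obtain U where U: "openin PSL3_topology U" "{coset (mat 1)} = U \<inter> \<Gamma>"
    unfolding openin_subtopology by blast
  let ?V = "{A \<in> carrier SL3. coset A \<in> U}"
  have "openin (top_of_set (carrier SL3)) ?V" using U(1) by (simp add: openin_PSL3_topology)
  moreover have "mat 1 \<in> ?V" using U(2) by auto
  ultimately obtain e where e: "e > 0" "\<And>A. A \<in> carrier SL3 \<Longrightarrow> dist A (mat 1) < e \<Longrightarrow> A \<in> ?V"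
    unfolding openin_euclidean_subtopology_iff by blast
  have "A \<in> SL3_center" if "A \<in> matrices_of \<Gamma>" "dist A (mat 1) < e" for A
  proof -
    have "coset A \<in> U \<inter> \<Gamma>" using e(2)[of A] that by (simp add: matrices_of_def)
    then have "coset A = coset (mat 1)" using U(2) by blast
    then show ?thesis using coset_self[of A] by (simp add: coset_mat_1)
  qed
  then show ?thesis using that e(1) by blast
qed

lemma matrices_of_closed:
  assumes "subgroup \<Gamma> PSL3"
  shows "A \<in> matrices_of \<Gamma> \<Longrightarrow> B \<in> matrices_of \<Gamma> \<Longrightarrow> A ** B \<in> matrices_of \<Gamma>"
    and "A \<in> matrices_of \<Gamma> \<Longrightarrow> adj3 A \<in> matrices_of \<Gamma>"
proof -
  show "A ** B \<in> matrices_of \<Gamma>" if "A \<in> matrices_of \<Gamma>" "B \<in> matrices_of \<Gamma>"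
    using that subgroup.m_closed[OF assms, of "coset A" "coset B"]
    by (simp add: matrices_of_def coset_mult det_mul)
  show "adj3 A \<in> matrices_of \<Gamma>" if "A \<in> matrices_of \<Gamma>"
  proof -
    have A: "det A = 1" "coset A \<in> \<Gamma>" using that by (auto simp: matrices_of_def)
    have "coset (adj3 A) \<otimes>\<^bsub>PSL3\<^esub> coset A = \<one>\<^bsub>PSL3\<^esub>"
      using A by (simp add: coset_mult adj3_inverse coset_one)
    then have "inv\<^bsub>PSL3\<^esub> (coset A) = coset (adj3 A)"
      using A by (intro group.inv_equality[OF group_PSL3] coset_carrier) (simp_all add: adj3_inverse)
    then show ?thesis using subgroup.m_inv_closed[OF assms A(2)] A(1)
      by (simp add: matrices_of_def adj3_inverse)
  qed
qed

text \<open>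
  If infinitely many matrices lay in a ball, consecutive members of a convergent sequence of them
  would eventually differ by a central factor, hence stay in one finite coset.
\<close>

lemma finite_balls_of_discrete:
  assumes "discrete_subgroup \<Gamma>" shows "finite {A \<in> matrices_of \<Gamma>. norm A \<le> R}"
proof (rule ccontr)
  assume inf: "\<not> ?thesis"
  have sub: "subgroup \<Gamma> PSL3" using assms by (simp add: discrete_subgroup_def)
  obtain e where e: "e > 0" "\<And>A. A \<in> matrices_of \<Gamma> \<Longrightarrow> dist A (mat 1) < e \<Longrightarrow> A \<in> SL3_center"
    using discrete_near_one assms by blast
  obtain A :: "nat \<Rightarrow> complex^3^3" where A: "inj A" "range A \<subseteq> {A \<in> matrices_of \<Gamma>. norm A \<le> R}"
    using infinite_countable_subset[OF inf] by blast
  then have "\<forall>n. A n \<in> cball 0 R" by auto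
  then obtain X r where X: "strict_mono r" "(A \<circ> r) \<longlonglongrightarrow> X"
    using compact_cball[of "0 :: complex^3^3" R] unfolding compact_def by metis
  define B where "B = A \<circ> r"
  have B: "B n \<in> matrices_of \<Gamma>" "det (B n) = 1" for n using A(2) by (auto simp: B_def matrices_of_def)
  have "inj B" unfolding B_def using A(1) strict_mono_imp_inj_on[OF X(1)] by (intro inj_compose)
  have BX: "B \<longlonglongrightarrow> X" using X by (simp add: B_def)
  have "det X = 1" using tendsto_det[OF BX] B(2) by (simp add: LIMSEQ_const_iff)
  have "(\<lambda>n. adj3 (B n) ** B (Suc n)) \<longlonglongrightarrow> adj3 X ** X"
    by (intro tendsto_matrix_matrix_mult tendsto_adj3 BX LIMSEQ_Suc)
  then have "(\<lambda>n. adj3 (B n) ** B (Suc n)) \<longlonglongrightarrow> mat 1"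
    using \<open>det X = 1\<close> by (simp add: adj3_inverse)
  from tendstoD[OF this e(1)] obtain N where
    N: "\<And>n. n \<ge> N \<Longrightarrow> dist (adj3 (B n) ** B (Suc n)) (mat 1) < e"
    unfolding eventually_sequentially by blast
  have step: "\<exists>c. c ^ 3 = 1 \<and> B (Suc n) = mat c ** B n" if n: "n \<ge> N" for n
  proof -
    have "adj3 (B n) ** B (Suc n) \<in> SL3_center"
      by (rule e(2)[OF _ N[OF n]]) (intro matrices_of_closed[OF sub] B)
    then obtain c where c: "c ^ 3 = 1" "adj3 (B n) ** B (Suc n) = mat c" by (auto simp: SL3_center_def)
    have "B (Suc n) = B n ** (adj3 (B n) ** B (Suc n))"
      using B(2) by (simp add: matrix_mul_assoc adj3_inverse)
    then show ?thesis using c by (auto simp: mat_mult_left mat_mult_right)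
  qed
  have "B (N + k) \<in> coset (B N)" for k
  proof (induction k)
    case 0 show ?case using coset_self by simp
  next
    case (Suc k)
    then obtain c where c: "c ^ 3 = 1" "B (N + k) = mat c ** B N" by (auto simp: coset_eq)
    obtain d where d: "d ^ 3 = 1" "B (Suc (N + k)) = mat d ** B (N + k)" using step[of "N + k"] by auto
    have "B (N + Suc k) = mat (d * c) ** B N" using c d by (simp add: mat_mult_left mult.assoc)
    then show ?case using c d unfolding coset_eq by (auto simp: power_mult_distrib)
  qed
  then have "range (\<lambda>k. B (N + k)) \<subseteq> coset (B N)" by blast
  moreover have "inj (\<lambda>k. B (N + k))" using injD[OF \<open>inj B\<close>] by (intro injI) fastforce
  ultimately show False using finite_coset finite_subset finite_imageD infinite_UNIV_nat by metis
qed

text \<open>Continuous convergence on a compact set is uniform. Subsequences \<open>\<sigma>\<close>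
  appear because failure of uniformity is seen only along a subsequence, and convergence of the bad
  points needs a further one.\<close>

lemma uniform_limit_on_compactI:
  fixes F :: "nat \<Rightarrow> 'a :: metric_space \<Rightarrow> 'b :: metric_space"
  assumes "compact K"
    and F: "\<And>\<sigma> z x. strict_mono (\<sigma> :: nat \<Rightarrow> nat) \<Longrightarrow> (\<And>n. z n \<in> K) \<Longrightarrow> x \<in> K \<Longrightarrow> z \<longlonglongrightarrow> x \<Longrightarrow>
      (\<lambda>n. F (\<sigma> n) (z n)) \<longlonglongrightarrow> f x"
    and f: "\<And>z x. (\<And>n. z n \<in> K) \<Longrightarrow> x \<in> K \<Longrightarrow> z \<longlonglongrightarrow> x \<Longrightarrow> (\<lambda>n. f (z n)) \<longlonglongrightarrow> f x"
  shows "uniform_limit K F f sequentially"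
proof (rule ccontr)
  assume "\<not> ?thesis"
  then obtain e where e: "e > 0" "\<not> (\<forall>\<^sub>F n in sequentially. \<forall>x\<in>K. dist (F n x) (f x) < e)"
    unfolding uniform_limit_iff by blast
  let ?S = "{n. \<exists>x\<in>K. \<not> dist (F n x) (f x) < e}"
  have "infinite ?S"
    using e(2) unfolding cofinite_eq_sequentially[symmetric] eventually_cofinite by simp
  then obtain r :: "nat \<Rightarrow> nat" where r: "strict_mono r" "\<forall>n. r n \<in> ?S"
    using infinite_enumerate by blast
  have "\<forall>n. \<exists>x\<in>K. e \<le> dist (F (r n) x) (f x)"
    using r(2) by (simp add: not_less)
  then obtain z where z: "\<And>n. z n \<in> K" "\<And>n. e \<le> dist (F (r n) (z n)) (f (z n))" by metis
  obtain x q where q: "x \<in> K" "strict_mono (q :: nat \<Rightarrow> nat)" "(z \<circ> q) \<longlonglongrightarrow> x"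
    using assms(1) z(1) unfolding compact_def by metis
  have "(\<lambda>n. F ((r \<circ> q) n) ((z \<circ> q) n)) \<longlonglongrightarrow> f x"
    by (intro F strict_mono_o r q) (simp_all add: z)
  moreover have "(\<lambda>n. f ((z \<circ> q) n)) \<longlonglongrightarrow> f x"
    by (intro f q) (simp_all add: z)
  ultimately have "(\<lambda>n. dist (F ((r \<circ> q) n) ((z \<circ> q) n)) (f ((z \<circ> q) n))) \<longlonglongrightarrow> 0"
    using tendsto_dist by fastforce
  then have "\<forall>\<^sub>F n in sequentially. dist (F ((r \<circ> q) n) ((z \<circ> q) n)) (f ((z \<circ> q) n)) < e"
    using e(1) order_tendstoD(2) by blast
  then obtain n where "dist (F ((r \<circ> q) n) ((z \<circ> q) n)) (f ((z \<circ> q) n)) < e"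
    using eventually_happens by fastforce
  then show False using z(2)[of "q n"] by simp
qed

text \<open>Infinitude supplies the escaping sequences. For a finite group all three kinds of
  \<open>\<Omega>\<close> are the whole plane, and no line is omitted.\<close>

locale psl3_discrete =
  fixes \<Gamma> :: "(complex^3^3) set set"
  assumes disc: "discrete_subgroup \<Gamma>" and inf: "infinite \<Gamma>"

sublocale psl3_discrete \<subseteq> discrete_matrix_group "matrices_of \<Gamma>"
proof
  have sub: "subgroup \<Gamma> PSL3" using disc by (simp add: discrete_subgroup_def)
  show "det A = 1" if "A \<in> matrices_of \<Gamma>" for A using that by (simp add: matrices_of_def)
  show "A ** B \<in> matrices_of \<Gamma>" if "A \<in> matrices_of \<Gamma>" "B \<in> matrices_of \<Gamma>" for A B
    using matrices_of_closed(1)[OF sub that] .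
  show "adj3 A \<in> matrices_of \<Gamma>" if "A \<in> matrices_of \<Gamma>" for A
    using matrices_of_closed(2)[OF sub that] .
  show "finite {A \<in> matrices_of \<Gamma>. norm A \<le> R}" for R
    by (rule finite_balls_of_discrete[OF disc])
  have "\<Gamma> \<subseteq> coset ` matrices_of \<Gamma>"
  proof
    fix g assume g: "g \<in> \<Gamma>"
    then have "g \<in> carrier PSL3" using subgroup.subset[OF sub] by blast
    then show "g \<in> coset ` matrices_of \<Gamma>"
      using g by (elim carrier_coset) (auto simp: matrices_of_def)
  qed
  then show "infinite (matrices_of \<Gamma>)" using inf finite_surj by blast
qed

context psl3_discrete
begin

abbreviation "G \<equiv> matrices_of \<Gamma>"

lemma subgroup_\<Gamma>: "subgroup \<Gamma> PSL3" using disc by (simp add: discrete_subgroup_def)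

lemma act_papp: "A \<in> G \<Longrightarrow> act (coset A) = papp A"
  by (simp add: act_coset_papp det_G)

lemma coset_in: "A \<in> G \<Longrightarrow> coset A \<in> \<Gamma>"
  by (simp add: matrices_of_def)

lemma \<Gamma>_lift: assumes "g \<in> \<Gamma>" obtains A where "A \<in> G" "g = coset A"
proof -
  have "g \<in> carrier PSL3" using assms subgroup.subset[OF subgroup_\<Gamma>] by blast
  then show ?thesis by (rule carrier_coset) (use that assms in \<open>auto simp: matrices_of_def\<close>)
qed

text \<open>Translates statements about infinitely many elements of \<open>\<Gamma>\<close> into
  sequences of matrices. Cosets are finite, so finitely many elements have finitely many lifts, and
  an escaping sequence leaves them.\<close>

lemma infinite_iff_escaping:
  "infinite {g \<in> \<Gamma>. P (act g)} \<longleftrightarrow> (\<exists>A. escaping A \<and> (\<forall>n. P (papp (A n))))"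
proof
  assume "infinite {g \<in> \<Gamma>. P (act g)}"
  then obtain g :: "nat \<Rightarrow> _" where g: "inj g" "range g \<subseteq> {g \<in> \<Gamma>. P (act g)}"
    using infinite_countable_subset by blast
  then have "\<forall>n. \<exists>A. A \<in> G \<and> g n = coset A" using \<Gamma>_lift by blast
  then obtain A where A: "\<And>n. A n \<in> G" "\<And>n. g n = coset (A n)" by metis
  have "inj A" using g(1) A(2) unfolding inj_def by metis
  then have "escaping A" using A(1) by (intro escaping_inj) auto
  moreover have "P (papp (A n))" for n
  proof -
    have "P (act (g n))" using g(2) by auto
    then show ?thesis using act_papp[OF A(1)[of n]] by (simp add: A(2))
  qed
  ultimately show "\<exists>A. escaping A \<and> (\<forall>n. P (papp (A n)))" by blast
next
  assume "\<exists>A. escaping A \<and> (\<forall>n. P (papp (A n)))"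
  then obtain A where A: "escaping A" "\<And>n. P (papp (A n))" by blast
  show "infinite {g \<in> \<Gamma>. P (act g)}"
  proof
    assume fin: "finite {g \<in> \<Gamma>. P (act g)}"
    have "finite (\<Union>{g \<in> \<Gamma>. P (act g)})"
    proof (intro finite_Union fin)
      fix g assume "g \<in> {g \<in> \<Gamma>. P (act g)}"
      then show "finite g" using \<Gamma>_lift finite_coset by blast
    qed
    from eventually_happens[OF escaping_finite[OF A(1) this]]
    obtain n where n: "A n \<notin> \<Union>{g \<in> \<Gamma>. P (act g)}" by auto
    have "A n \<in> G" using A(1) escaping_G by blast
    then have "coset (A n) \<in> {g \<in> \<Gamma>. P (act g)}"
      using A(2) act_papp coset_in by simp
    then show False using n coset_self by blast
  qed
qed

lemma escaping_shift: "escaping A \<Longrightarrow> escaping (\<lambda>n. A (n + N))"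
  using escaping_subseq[of A "\<lambda>n. n + N"] by (simp add: o_def strict_mono_def)

lemma escaping_of_norm:
  assumes "\<And>n. A n \<in> G" "\<And>n. real n \<le> norm (A n)" shows "escaping A"
  unfolding escaping_def
proof (intro conjI allI)
  fix B :: "complex^3^3"
  have "\<forall>\<^sub>F n in sequentially. norm B < real n"
    using filterlim_real_sequentially filterlim_at_top_dense by blast
  then show "\<forall>\<^sub>F n in sequentially. A n \<noteq> B"
  proof (rule eventually_mono)
    fix n assume "norm B < real n"
    then show "A n \<noteq> B" using assms(2)[of n] by auto
  qed
qed (rule assms)

text \<open>Each ball about \<open>q\<close> supplies its own infinite family. Demanding norm at
  least \<open>n\<close> of the matrix chosen for the ball of radius
  \<open>inverse (real (Suc n))\<close> merges them into one escaping sequence.\<close>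

lemma cluster_points_iff:
  "q \<in> cluster_points \<Gamma> K \<longleftrightarrow>
     (\<exists>A a. escaping A \<and> (\<forall>n. a n \<in> K) \<and> (\<lambda>n. papp (A n) (a n)) \<longlonglongrightarrow> q)"
proof
  assume q: "q \<in> cluster_points \<Gamma> K"
  have "\<exists>A a. A \<in> G \<and> real n \<le> norm A \<and> a \<in> K \<and> dist (papp A a) q < inverse (real (Suc n))" for n
  proof -
    have "open (ball q (inverse (real (Suc n))))" "q \<in> ball q (inverse (real (Suc n)))" by simp_all
    then have "infinite {g \<in> \<Gamma>. act g ` K \<inter> ball q (inverse (real (Suc n))) \<noteq> {}}"
      using q unfolding cluster_points_def by blast
    then obtain A where A: "escaping A" "\<And>m. papp (A m) ` K \<inter> ball q (inverse (real (Suc n))) \<noteq> {}"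
      using infinite_iff_escaping[of "\<lambda>h. h ` K \<inter> ball q (inverse (real (Suc n))) \<noteq> {}"] by blast
    have "\<forall>\<^sub>F m in sequentially. real n \<le> norm (A m)"
      using escaping_norm[OF A(1)] unfolding filterlim_at_top by blast
    then obtain m where m: "real n \<le> norm (A m)" using eventually_happens by fastforce
    obtain a where "a \<in> K" "dist (papp (A m) a) q < inverse (real (Suc n))"
      using A(2)[of m] by (auto simp: dist_commute)
    then show ?thesis using m escaping_G[OF A(1)] by blast
  qed
  then obtain A a where Aa: "\<And>n. A n \<in> G" "\<And>n. real n \<le> norm (A n)" "\<And>n. a n \<in> K"
    "\<And>n. dist (papp (A n) (a n)) q < inverse (real (Suc n))" by metis
  have "(\<lambda>n. dist (papp (A n) (a n)) q) \<longlonglongrightarrow> 0"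
    by (rule tendsto_sandwich[OF _ _ tendsto_const LIMSEQ_inverse_real_of_nat])
      (use Aa(4) in \<open>auto intro!: always_eventually less_imp_le\<close>)
  then have "(\<lambda>n. papp (A n) (a n)) \<longlonglongrightarrow> q" using tendsto_dist_iff by blast
  then show "\<exists>A a. escaping A \<and> (\<forall>n. a n \<in> K) \<and> (\<lambda>n. papp (A n) (a n)) \<longlonglongrightarrow> q"
    using escaping_of_norm Aa by blast
next
  assume "\<exists>A a. escaping A \<and> (\<forall>n. a n \<in> K) \<and> (\<lambda>n. papp (A n) (a n)) \<longlonglongrightarrow> q"
  then obtain A a where A: "escaping A" "\<And>n. a n \<in> K" "(\<lambda>n. papp (A n) (a n)) \<longlonglongrightarrow> q" by blast
  show "q \<in> cluster_points \<Gamma> K"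
    unfolding cluster_points_def
  proof (intro CollectI allI impI)
    fix U assume "open U \<and> q \<in> U"
    then obtain N where N: "\<And>n. n \<ge> N \<Longrightarrow> papp (A n) (a n) \<in> U"
      using topological_tendstoD[OF A(3)] unfolding eventually_sequentially by blast
    have "papp (A (n + N)) ` K \<inter> U \<noteq> {}" for n using N[of "n + N"] A(2) by auto
    then show "infinite {g \<in> \<Gamma>. act g ` K \<inter> U \<noteq> {}}"
      unfolding infinite_iff_escaping[of "\<lambda>h. h ` K \<inter> U \<noteq> {}"]
      using escaping_shift[OF A(1), of N] by (intro exI[of _ "\<lambda>n. A (n + N)"]) simp
  qed
qed

subsection \<open>Invariance and wandering\<close>

definition invariant :: "cp2 set \<Rightarrow> bool" where
  "invariant X \<longleftrightarrow> (\<forall>A\<in>G. \<forall>x\<in>X. papp A x \<in> X)"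

text \<open>The sequential form of proper discontinuity, with moving points \<open>x n\<close> in
  place of compact sets. Unlike \<open>proper_region\<close> it allows the empty set, so it covers
  all three choices of \<open>\<Omega>\<close>.\<close>

definition wandering :: "cp2 set \<Rightarrow> bool" where
  "wandering \<Omega> \<longleftrightarrow> (\<forall>A x p q. escaping A \<longrightarrow> x \<longlonglongrightarrow> p \<longrightarrow> (\<lambda>n. papp (A n) (x n)) \<longlonglongrightarrow> q \<longrightarrow>
     p \<in> \<Omega> \<longrightarrow> q \<in> \<Omega> \<longrightarrow> False)"

lemma invariant_Compl: "invariant (- X) \<longleftrightarrow> invariant X"
proof -
  have "invariant (- X)" if "invariant X" for X
    unfolding invariant_def
  proof (intro ballI)
    fix A x assume A: "A \<in> G" "x \<in> - X"
    have "papp (adj3 A) (papp A x) \<in> X" if "papp A x \<in> X"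
      using that \<open>invariant X\<close> inverse_G[OF A(1)] unfolding invariant_def by blast
    then show "papp A x \<in> - X" using A by auto
  qed
  from this[of X] this[of "- X"] show ?thesis by auto
qed

lemma invariant_closure:
  assumes "invariant X" shows "invariant (closure X)"
  unfolding invariant_def
proof (intro ballI)
  fix A x assume A: "A \<in> G" "x \<in> closure X"
  then obtain y where y: "\<And>n. y n \<in> X" "y \<longlonglongrightarrow> x" unfolding closure_sequential by blast
  have "(\<lambda>n. papp A (y n)) \<longlonglongrightarrow> papp A x" by (intro papp_continuous det_G A y)
  moreover have "\<forall>n. papp A (y n) \<in> X" using assms A(1) y(1) unfolding invariant_def by blast
  ultimately show "papp A x \<in> closure X"
    unfolding closure_sequential by (intro exI[of _ "\<lambda>n. papp A (y n)"]) simp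
qed

lemma invariant_KER: "invariant KER"
  using KER_invariant unfolding invariant_def by blast

lemma wandering_line:
  assumes "open \<Omega>" "wandering \<Omega>" obtains L where "complex_line L" "L \<subseteq> - \<Omega>"
proof -
  obtain A T L where T: "limit_of A T" "complex_line L" "L \<subseteq> pker T" using limit_of_line by blast
  show ?thesis
  proof (cases "L \<inter> \<Omega> = {}")
    case True then show ?thesis using that T by blast
  next
    case False
    then obtain z where z: "z \<in> L" "z \<in> \<Omega>" by blast
    obtain v where v: "v \<noteq> 0" "z = cp2_of v" by (rule cp2_cases)
    have Tv: "T *v v = 0" using z T v by (auto simp: cp2_of_in_pker)
    obtain u where u: "T *v u \<noteq> 0" using T(1) matrix_eq_0I by (auto simp: limit_of_def)
    obtain r s where rs: "strict_mono r" "cross s (T *v u) \<noteq> 0"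
      "\<And>\<tau>. \<exists>x. x \<longlonglongrightarrow> cp2_of v \<and> (\<lambda>n. papp (A (r n)) (x n)) \<longlonglongrightarrow> cp2_of (s + \<tau> *s (T *v u))"
      using blow_up[OF T(1) Tv v(1) u] by metis
    have esc: "escaping (\<lambda>n. A (r n))"
      using escaping_subseq[OF limit_of_escaping[OF T(1)] rs(1)] by (simp add: o_def)
    have out: "cp2_of (s + \<tau> *s (T *v u)) \<notin> \<Omega>" for \<tau>
      using rs(3)[of \<tau>] esc assms(2) z v unfolding wandering_def by blast
    \<comment> \<open>The blow-up gives every point of the line except the class of
      \<open>T *v u\<close>. Letting \<open>\<tau>\<close> run through the positive integers
      approaches it, and the complement of \<open>\<Omega>\<close> is closed.\<close>
    have "(\<lambda>n. T *v u + of_real (inverse (real (Suc n))) *s s) \<longlonglongrightarrow> T *v u + of_real 0 *s s"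
      unfolding vector_scalar_mult_def
      by (intro vec_tendstoI, simp only: vec_lambda_beta vector_add_component)
        (intro tendsto_intros LIMSEQ_inverse_real_of_nat)
    then have lim: "(\<lambda>n. cp2_of (T *v u + of_real (inverse (real (Suc n))) *s s)) \<longlonglongrightarrow> cp2_of (T *v u)"
      using tendsto_cp2_of u by simp
    have "T *v u + of_real (inverse (real (Suc n))) *s s
        = of_real (inverse (real (Suc n))) *s (s + of_real (real (Suc n)) *s (T *v u))" for n
    proof -
      have "complex_of_real (inverse (real (Suc n))) * of_real (real (Suc n)) = 1"
        by (simp flip: of_real_mult del: of_nat_Suc)
      then show ?thesis
        by (simp only: vector_add_ldistrib vector_smult_assoc vector_smult_lid add.commute)
    qed
    then have "cp2_of (T *v u + of_real (inverse (real (Suc n))) *s s) \<in> - \<Omega>" for n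
      using out[of "of_real (real (Suc n))"] cp2_of_scale0[of "of_real (inverse (real (Suc n)))"]
      by (metis ComplI inverse_nonzero_iff_nonzero of_nat_neq_0 of_real_eq_0_iff)
    then have out': "cp2_of (T *v u) \<in> - \<Omega>"
      using closed_sequentially[OF _ _ lim] assms(1) closed_Compl by blast
    have "pline (cross s (T *v u)) \<subseteq> - \<Omega>"
    proof
      fix y assume "y \<in> pline (cross s (T *v u))"
      then obtain w where w: "w \<noteq> 0" "y = cp2_of w" "dot3 (cross s (T *v u)) w = 0"
        by (auto simp: pline_def)
      then obtain \<alpha> \<beta> where ab: "w = \<alpha> *s s + \<beta> *s (T *v u)" using span_of_cross rs(2) by blast
      show "y \<in> - \<Omega>"
      proof (cases "\<alpha> = 0")
        case True
        then have "y = cp2_of (T *v u)" using w ab by (auto simp: cp2_of_scale0)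
        then show ?thesis using out' by simp
      next
        case False
        then have "w = \<alpha> *s (s + (\<beta> / \<alpha>) *s (T *v u))"
          by (simp add: ab vector_add_ldistrib vector_smult_assoc)
        then have "y = cp2_of (s + (\<beta> / \<alpha>) *s (T *v u))" using w(2) cp2_of_scale0[OF False] by metis
        then show ?thesis using out by simp
      qed
    qed
    then show ?thesis using that rs(2) complex_line_iff by blast
  qed
qed

section \<open>Regions of proper discontinuity\<close>

lemma compact_nhd:
  assumes "open U" "(x :: cp2) \<in> U" obtains e where "e > 0" "compact (cball x e)" "cball x e \<subseteq> U"
proof -
  obtain e where e: "e > 0" "ball x e \<subseteq> U" using assms open_contains_ball by blast
  then have "cball x (e / 2) \<subseteq> U" by (auto simp: subset_eq)
  then show ?thesis using that[of "e / 2"] e(1) compact_cp2 by auto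
qed

lemma eventually_in_cball:
  assumes "x \<longlonglongrightarrow> p" "e > 0" shows "\<forall>\<^sub>F n in sequentially. x n \<in> cball p e"
  using tendstoD[OF assms] by (rule eventually_mono) (simp add: dist_commute)

text \<open>Closed balls about \<open>p\<close> and \<open>q\<close> are united into one compact
  set, so that passing from near \<open>p\<close> to near \<open>q\<close> counts as a return of
  this set to itself.\<close>

lemma proper_region_wandering:
  assumes "proper_region \<Gamma> \<Omega>" shows "wandering \<Omega>"
  unfolding wandering_def
proof (intro allI impI)
  fix A x p q
  assume A: "escaping A" "x \<longlonglongrightarrow> p" "(\<lambda>n. papp (A n) (x n)) \<longlonglongrightarrow> q" "p \<in> \<Omega>" "q \<in> \<Omega>"
  have op: "open \<Omega>" using assms by (simp add: proper_region_def)
  obtain d where d: "d > 0" "compact (cball p d)" "cball p d \<subseteq> \<Omega>" using compact_nhd op A(4) by blast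
  obtain e where e: "e > 0" "compact (cball q e)" "cball q e \<subseteq> \<Omega>" using compact_nhd op A(5) by blast
  let ?K = "cball p d \<union> cball q e"
  have "\<forall>\<^sub>F n in sequentially. papp (A n) ` ?K \<inter> ?K \<noteq> {}"
    using eventually_in_cball[OF A(2) d(1)] eventually_in_cball[OF A(3) e(1)]
    by eventually_elim blast
  then obtain N where "\<And>n. n \<ge> N \<Longrightarrow> papp (A n) ` ?K \<inter> ?K \<noteq> {}"
    unfolding eventually_sequentially by blast
  then have "infinite {g \<in> \<Gamma>. act g ` ?K \<inter> ?K \<noteq> {}}"
    unfolding infinite_iff_escaping[of "\<lambda>h. h ` ?K \<inter> ?K \<noteq> {}"]
    using escaping_shift[OF A(1), of N] by (intro exI[of _ "\<lambda>n. A (n + N)"]) simp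
  moreover have "compact ?K" "?K \<subseteq> \<Omega>" using d e by (auto intro: compact_Un)
  ultimately show False using assms unfolding proper_region_def by blast
qed

lemma proper_region_invariant:
  assumes "proper_region \<Gamma> \<Omega>" shows "invariant \<Omega>"
  unfolding invariant_def
proof (intro ballI)
  fix A x assume A: "A \<in> G" "x \<in> \<Omega>"
  then have "act (coset A) x \<in> (\<Union>g\<in>\<Gamma>. act g ` \<Omega>)" using coset_in by blast
  also have "\<dots> = \<Omega>" using assms by (simp add: proper_region_def)
  finally show "papp A x \<in> \<Omega>" using act_papp A(1) by simp
qed

text \<open>If infinitely many elements returned \<open>K\<close> to itself, compactness would give
  limits in \<open>K\<close> of points and of their images, which \<open>wandering\<close>
  forbids.\<close>

lemma proper_regionI:
  assumes "\<Omega> \<noteq> {}" "open \<Omega>" "invariant \<Omega>" "wandering \<Omega>" shows "proper_region \<Gamma> \<Omega>"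
  unfolding proper_region_def
proof (intro conjI allI impI assms)
  show "(\<Union>g\<in>\<Gamma>. act g ` \<Omega>) = \<Omega>"
  proof
    show "(\<Union>g\<in>\<Gamma>. act g ` \<Omega>) \<subseteq> \<Omega>"
    proof clarify
      fix g x assume g: "g \<in> \<Gamma>" "x \<in> \<Omega>"
      then obtain A where "A \<in> G" "g = coset A" using \<Gamma>_lift by blast
      then show "act g x \<in> \<Omega>" using assms(3) g(2) act_papp unfolding invariant_def by simp
    qed
    obtain A where "escaping A" using escaping_exists by blast
    then have A: "A 0 \<in> G" using escaping_G by blast
    show "\<Omega> \<subseteq> (\<Union>g\<in>\<Gamma>. act g ` \<Omega>)"
    proof
      fix x assume "x \<in> \<Omega>"
      then have "papp (adj3 (A 0)) x \<in> \<Omega>" using A inverse_G assms(3) unfolding invariant_def by blast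
      moreover have "x = act (coset (A 0)) (papp (adj3 (A 0)) x)" using A act_papp by simp
      ultimately show "x \<in> (\<Union>g\<in>\<Gamma>. act g ` \<Omega>)" using coset_in[OF A] by blast
    qed
  qed
next
  fix K assume K: "compact K \<and> K \<subseteq> \<Omega>"
  show "finite {g \<in> \<Gamma>. act g ` K \<inter> K \<noteq> {}}"
  proof (rule ccontr)
    assume "infinite {g \<in> \<Gamma>. act g ` K \<inter> K \<noteq> {}}"
    then obtain A where A: "escaping A" "\<And>n. papp (A n) ` K \<inter> K \<noteq> {}"
      unfolding infinite_iff_escaping[of "\<lambda>h. h ` K \<inter> K \<noteq> {}"] by blast
    then have "\<forall>n. \<exists>x. x \<in> K \<and> papp (A n) x \<in> K" by blast
    then obtain x where x: "\<And>n. x n \<in> K" "\<And>n. papp (A n) (x n) \<in> K" by metis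
    obtain p r where p: "p \<in> K" "strict_mono (r :: nat \<Rightarrow> nat)" "(x \<circ> r) \<longlonglongrightarrow> p"
      using K x(1) unfolding compact_def by metis
    obtain q r' where q: "q \<in> K" "strict_mono (r' :: nat \<Rightarrow> nat)"
        "((\<lambda>n. papp (A (r n)) (x (r n))) \<circ> r') \<longlonglongrightarrow> q"
      using K x(2) unfolding compact_def by (metis (no_types, lifting))
    have "(x \<circ> r \<circ> r') \<longlonglongrightarrow> p" using LIMSEQ_subseq_LIMSEQ[OF p(3) q(2)] .
    moreover have "escaping (A \<circ> r \<circ> r')" by (intro escaping_subseq A p q)
    moreover have "(\<lambda>n. papp ((A \<circ> r \<circ> r') n) ((x \<circ> r \<circ> r') n)) \<longlonglongrightarrow> q" using q(3) by (simp add: o_def)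
    ultimately show False using assms(4) K p(1) q(1) unfolding wandering_def by blast
  qed
qed

lemma wandering_Compl_KER: "wandering (- KER)"
  unfolding wandering_def using dynamically_related by (metis ComplD)

lemma wandering_Un_Compl_KER:
  assumes "open \<Omega>" "invariant \<Omega>" "wandering \<Omega>" shows "wandering (\<Omega> \<union> - KER)"
proof -
  \<comment> \<open>As \<open>q\<close> is outside \<open>KER\<close>, the point \<open>p\<close>
    lies in \<open>KER\<close>, hence in \<open>\<Omega>\<close>. The inverses carry
    \<open>q\<close> itself towards \<open>p\<close> and so into the open set
    \<open>\<Omega>\<close>; invariance brings \<open>q\<close> back into
    \<open>\<Omega>\<close>.\<close>
  have enter: "q \<in> \<Omega>"
    if A: "escaping A" and x: "x \<longlonglongrightarrow> p" "(\<lambda>n. papp (A n) (x n)) \<longlonglongrightarrow> q" and "p \<in> \<Omega> \<union> - KER" "q \<notin> KER"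
    for A x p q
  proof -
    obtain r where r: "(\<lambda>n. papp (adj3 (A (r n))) q) \<longlonglongrightarrow> p" "p \<in> KER"
      using dynamically_related[OF A x \<open>q \<notin> KER\<close>] by metis
    then have "p \<in> \<Omega>" using that(4) by blast
    then have "\<forall>\<^sub>F n in sequentially. papp (adj3 (A (r n))) q \<in> \<Omega>"
      using topological_tendstoD[OF r(1) assms(1)] by blast
    then obtain n where n: "papp (adj3 (A (r n))) q \<in> \<Omega>" using eventually_happens by fastforce
    have "A (r n) \<in> G" using escaping_G[OF A] .
    moreover from this n assms(2) have "papp (A (r n)) (papp (adj3 (A (r n))) q) \<in> \<Omega>"
      unfolding invariant_def by blast
    ultimately show "q \<in> \<Omega>" by simp
  qed
  show ?thesis
    unfolding wandering_def
  proof (intro allI impI)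
    fix A x p q
    assume A: "escaping A" "x \<longlonglongrightarrow> p" "(\<lambda>n. papp (A n) (x n)) \<longlonglongrightarrow> q" and p: "p \<in> \<Omega> \<union> - KER" and q: "q \<in> \<Omega> \<union> - KER"
    have "q \<in> \<Omega>" using enter[OF A p] q by blast
    \<comment> \<open>The relation between \<open>p\<close> and \<open>q\<close> is symmetric: the
      inverse sequence leads from the images back to \<open>x n\<close>, so \<open>enter\<close>
      also applies to \<open>p\<close>.\<close>
    have "(\<lambda>n. papp (adj3 (A n)) (papp (A n) (x n))) \<longlonglongrightarrow> p"
      using A(2) escaping_G[OF A(1)] by simp
    then have "p \<in> \<Omega>" using enter[OF escaping_inverse[OF A(1)] A(3) _ q] p by blast
    then show False using A \<open>q \<in> \<Omega>\<close> assms(3) unfolding wandering_def by blast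
  qed
qed

lemma maximal_region_contains:
  assumes "maximal_proper_region \<Gamma> \<Omega>" shows "- KER \<subseteq> \<Omega>"
proof -
  have P: "proper_region \<Gamma> \<Omega>" using assms by (simp add: maximal_proper_region_def)
  then have "\<Omega> \<noteq> {}" "open \<Omega>" by (auto simp: proper_region_def)
  have "invariant (\<Omega> \<union> - KER)"
    using proper_region_invariant[OF P] invariant_KER invariant_Compl[of KER]
    unfolding invariant_def by blast
  then have "proper_region \<Gamma> (\<Omega> \<union> - KER)"
    using \<open>\<Omega> \<noteq> {}\<close> \<open>open \<Omega>\<close> closed_KER proper_region_invariant[OF P] proper_region_wandering[OF P]
    by (intro proper_regionI wandering_Un_Compl_KER open_Un) auto
  then show ?thesis using assms unfolding maximal_proper_region_def by blast
qed

section \<open>The Kulkarni limit set\<close>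

lemma isotropy_iff: "infinite {g \<in> \<Gamma>. act g z = z} \<longleftrightarrow> (\<exists>A. escaping A \<and> (\<forall>n. papp (A n) z = z))"
  by (rule infinite_iff_escaping)

lemma kulkarni_L0_KER: "kulkarni_L0 \<Gamma> \<subseteq> KER"
  unfolding kulkarni_L0_def
proof (rule closure_minimal[OF _ closed_KER], clarify)
  fix z assume "infinite {g \<in> \<Gamma>. act g z = z}"
  then obtain A where A: "escaping A" "\<And>n. papp (A n) z = z" unfolding isotropy_iff by blast
  have "(\<lambda>n. papp (A n) z) \<longlonglongrightarrow> z" by (simp add: A)
  then show "z \<in> KER" using dynamically_related[OF A(1) tendsto_const, of z z] by metis
qed

text \<open>If \<open>q\<close> were outside \<open>KER\<close>, then \<open>z\<close> would be
  inside, and its orbit could not leave this closed invariant set to approach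
  \<open>q\<close>.\<close>

lemma kulkarni_L1_KER: "kulkarni_L1 \<Gamma> \<subseteq> KER"
  unfolding kulkarni_L1_def
proof (rule closure_minimal[OF _ closed_KER], clarify)
  fix z q assume "q \<in> cluster_points \<Gamma> {z}"
  then obtain A a where A: "escaping A" "\<And>n. a n = z" "(\<lambda>n. papp (A n) (a n)) \<longlonglongrightarrow> q"
    unfolding cluster_points_iff by blast
  show "q \<in> KER"
  proof (rule ccontr)
    assume q: "q \<notin> KER"
    have lim: "(\<lambda>n. papp (A n) z) \<longlonglongrightarrow> q" using A by simp
    have "z \<in> KER" using dynamically_related[OF A(1) tendsto_const lim q] by metis
    then have "papp (A n) z \<in> KER" for n using KER_invariant escaping_G[OF A(1)] by blast
    then show False using closed_sequentially[OF closed_KER _ lim] q by blast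
  qed
qed

text \<open>If \<open>q\<close> were outside \<open>KER\<close>, the inverses would move the single
  point \<open>q\<close> towards a point of \<open>K\<close>. Since \<open>q\<close> is then also
  outside \<open>kulkarni_L0\<close>, that point would belong to \<open>kulkarni_L1\<close>, which
  \<open>K\<close> avoids.\<close>

lemma kulkarni_L2_KER: "kulkarni_L2 \<Gamma> \<subseteq> KER"
  unfolding kulkarni_L2_def
proof (rule closure_minimal[OF _ closed_KER], clarify)
  fix K q
  assume K: "compact K" "K \<subseteq> - (kulkarni_L0 \<Gamma> \<union> kulkarni_L1 \<Gamma>)" and "q \<in> cluster_points \<Gamma> K"
  then obtain A a where A: "escaping A" "\<And>n. a n \<in> K" "(\<lambda>n. papp (A n) (a n)) \<longlonglongrightarrow> q"
    unfolding cluster_points_iff by blast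
  obtain p r where p: "p \<in> K" "strict_mono (r :: nat \<Rightarrow> nat)" "(a \<circ> r) \<longlonglongrightarrow> p"
    using K(1) A(2) unfolding compact_def by metis
  have esc: "escaping (A \<circ> r)" using escaping_subseq A(1) p(2) by blast
  have lim: "(\<lambda>n. papp ((A \<circ> r) n) ((a \<circ> r) n)) \<longlonglongrightarrow> q"
    using LIMSEQ_subseq_LIMSEQ[OF A(3) p(2)] by (simp add: o_def)
  show "q \<in> KER"
  proof (rule ccontr)
    assume q: "q \<notin> KER"
    obtain r' where r': "strict_mono r'" "(\<lambda>n. papp (adj3 ((A \<circ> r) (r' n))) q) \<longlonglongrightarrow> p"
      using dynamically_related[OF esc p(3) lim q] by metis
    have "escaping (\<lambda>n. adj3 ((A \<circ> r) (r' n)))"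
      using escaping_inverse[OF escaping_subseq[OF esc r'(1)]] by (simp add: o_def)
    then have "p \<in> cluster_points \<Gamma> {q}" unfolding cluster_points_iff using r'(2)
      by (intro exI[of _ "\<lambda>n. adj3 ((A \<circ> r) (r' n))"] exI[of _ "\<lambda>n. q"]) simp
    moreover have "q \<in> - kulkarni_L0 \<Gamma>" using q kulkarni_L0_KER by blast
    ultimately have "p \<in> kulkarni_L1 \<Gamma>" unfolding kulkarni_L1_def using closure_subset by fast
    then show False using K(2) p(1) by blast
  qed
qed

lemma cluster_points_invariant:
  assumes "A \<in> G" "q \<in> cluster_points \<Gamma> K" shows "papp A q \<in> cluster_points \<Gamma> K"
proof -
  obtain B b where B: "escaping B" "\<And>n. b n \<in> K" "(\<lambda>n. papp (B n) (b n)) \<longlonglongrightarrow> q"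
    using assms(2) unfolding cluster_points_iff by blast
  have "(\<lambda>n. papp A (papp (B n) (b n))) \<longlonglongrightarrow> papp A q"
    by (intro papp_continuous det_G assms B)
  then have "(\<lambda>n. papp (A ** B n) (b n)) \<longlonglongrightarrow> papp A q"
    using papp_mult_G[OF assms(1) escaping_G[OF B(1)]] by simp
  then show ?thesis unfolding cluster_points_iff using escaping_mult_left[OF B(1) assms(1)] B(2) by blast
qed

lemma kulkarni_invariant: "invariant (kulkarni_limit_set \<Gamma>)"
proof -
  have "invariant {z. infinite {g \<in> \<Gamma>. act g z = z}}"
    unfolding invariant_def
  proof (intro ballI CollectI)
    fix A z assume A: "A \<in> G" "z \<in> {z. infinite {g \<in> \<Gamma>. act g z = z}}"
    then obtain B where B: "escaping B" "\<And>n. papp (B n) z = z" unfolding isotropy_iff by blast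
    have "papp (A ** B n ** adj3 A) (papp A z) = papp A z" for n
      using A(1) escaping_G[OF B(1)] by (simp add: papp_mult_G mult_G inverse_G B(2))
    then show "infinite {g \<in> \<Gamma>. act g (papp A z) = papp A z}"
      unfolding isotropy_iff
      using escaping_mult_right[OF escaping_mult_left[OF B(1) A(1)] inverse_G[OF A(1)]] by blast
  qed
  then have "invariant (kulkarni_L0 \<Gamma>)" unfolding kulkarni_L0_def by (rule invariant_closure)
  moreover have "invariant (kulkarni_L1 \<Gamma>)" unfolding kulkarni_L1_def
    by (rule invariant_closure) (use cluster_points_invariant in \<open>auto simp: invariant_def\<close>)
  moreover have "invariant (kulkarni_L2 \<Gamma>)" unfolding kulkarni_L2_def
    by (rule invariant_closure) (use cluster_points_invariant in \<open>auto simp: invariant_def\<close>)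
  ultimately show ?thesis unfolding kulkarni_limit_set_def invariant_def by blast
qed

lemma open_kulkarni_region: "open (kulkarni_region \<Gamma>)"
  unfolding kulkarni_region_def kulkarni_limit_set_def kulkarni_L0_def kulkarni_L1_def kulkarni_L2_def
  by (intro open_Compl closed_Un closed_closure)

lemma wandering_kulkarni: "wandering (kulkarni_region \<Gamma>)"
  unfolding wandering_def
proof (intro allI impI)
  fix A x p q
  assume A: "escaping A" "x \<longlonglongrightarrow> p" "(\<lambda>n. papp (A n) (x n)) \<longlonglongrightarrow> q" and p: "p \<in> kulkarni_region \<Gamma>" and q: "q \<in> kulkarni_region \<Gamma>"
  obtain e where e: "e > 0" "compact (cball p e)" "cball p e \<subseteq> kulkarni_region \<Gamma>"
    using compact_nhd open_kulkarni_region p by blast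
  obtain N where N: "\<And>n. n \<ge> N \<Longrightarrow> x n \<in> cball p e"
    using eventually_in_cball[OF A(2) e(1)] unfolding eventually_sequentially by blast
  have "q \<in> cluster_points \<Gamma> (cball p e)"
    unfolding cluster_points_iff
  proof (intro exI conjI allI)
    show "escaping (\<lambda>n. A (n + N))" by (rule escaping_shift[OF A(1)])
    show "x (n + N) \<in> cball p e" for n by (rule N) simp
    show "(\<lambda>n. papp (A (n + N)) (x (n + N))) \<longlonglongrightarrow> q" using LIMSEQ_ignore_initial_segment[OF A(3)] .
  qed
  moreover have "cball p e \<subseteq> - (kulkarni_L0 \<Gamma> \<union> kulkarni_L1 \<Gamma>)"
    using e(3) by (auto simp: kulkarni_region_def kulkarni_limit_set_def)
  ultimately have "q \<in> kulkarni_L2 \<Gamma>"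
    unfolding kulkarni_L2_def using e(2) closure_subset by fast
  then show False using q by (simp add: kulkarni_region_def kulkarni_limit_set_def)
qed

text \<open>Normality would give a limit map continuous at the kernel point \<open>z\<close>, so the
  images of all sequences tending to \<open>z\<close> would share one limit; the blow-up produces
  different ones.\<close>

lemma equicontinuity_set_disjoint_KER: "equicontinuity_set \<Gamma> \<inter> KER = {}"
proof (rule ccontr)
  assume "\<not> ?thesis"
  then obtain z A T where z: "z \<in> equicontinuity_set \<Gamma>" "limit_of A T" "z \<in> pker T"
    by (auto simp: KER_def)
  obtain v where v: "v \<noteq> 0" "z = cp2_of v" by (rule cp2_cases)
  have Tv: "T *v v = 0" using z v by (simp add: cp2_of_in_pker)
  obtain u where u: "T *v u \<noteq> 0" using z(2) matrix_eq_0I by (auto simp: limit_of_def)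
  obtain r s where rs: "strict_mono r" "cross s (T *v u) \<noteq> 0"
    "\<And>\<tau>. \<exists>x. x \<longlonglongrightarrow> cp2_of v \<and> (\<lambda>n. papp (A (r n)) (x n)) \<longlonglongrightarrow> cp2_of (s + \<tau> *s (T *v u))"
    using blow_up[OF z(2) Tv v(1) u] by metis
  obtain U where U: "open U" "z \<in> U" "normal_family_on (act ` \<Gamma>) U"
    using z(1) by (auto simp: equicontinuity_set_def)
  have AG: "A n \<in> G" for n using limit_of_G[OF z(2)] .
  have "range (\<lambda>n. papp (A (r n))) \<subseteq> act ` \<Gamma>"
    using act_papp[OF AG] coset_in[OF AG] by (metis image_eqI image_subsetI)
  then obtain q f where q: "strict_mono q"
    "\<And>K. compact K \<Longrightarrow> K \<subseteq> U \<Longrightarrow> uniform_limit K ((\<lambda>n. papp (A (r n))) \<circ> q) f sequentially"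
    using U(3) unfolding normal_family_on_def by metis
  obtain e where e: "e > 0" "compact (cball z e)" "cball z e \<subseteq> U" using compact_nhd U by blast
  have ul: "uniform_limit (cball z e) (\<lambda>n. papp (A (r (q n)))) f sequentially"
    using q(2)[OF e(2,3)] by (simp add: o_def)
  have "continuous_on (cball z e) f"
  proof (rule uniform_limit_theorem[OF _ ul])
    have "continuous_on (cball z e) (papp (A n))" for n
      unfolding continuous_on_sequentially o_def by (auto intro: papp_continuous det_G AG)
    then show "\<forall>\<^sub>F n in sequentially. continuous_on (cball z e) (papp (A (r (q n))))" by simp
  qed simp
  then have cont: "continuous (at z within cball z e) f"
    using e(1) continuous_on_eq_continuous_within by (metis centre_in_cball less_imp_le)
  have fz: "f z = cp2_of (s + \<tau> *s (T *v u))" for \<tau>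
  proof -
    obtain x where x: "x \<longlonglongrightarrow> z" "(\<lambda>n. papp (A (r n)) (x n)) \<longlonglongrightarrow> cp2_of (s + \<tau> *s (T *v u))"
      using rs(3)[of \<tau>] v by blast
    have xq: "(\<lambda>n. x (q n)) \<longlonglongrightarrow> z" using LIMSEQ_subseq_LIMSEQ[OF x(1) q(1)] by (simp add: o_def)
    have lim: "(\<lambda>n. papp (A (r (q n))) (x (q n))) \<longlonglongrightarrow> cp2_of (s + \<tau> *s (T *v u))"
      using LIMSEQ_subseq_LIMSEQ[OF x(2) q(1)] by (simp add: o_def)
    have inK: "\<forall>\<^sub>F n in sequentially. x (q n) \<in> cball z e" by (rule eventually_in_cball[OF xq e(1)])
    have "(\<lambda>n. papp (A (r (q n))) (x (q n))) \<longlonglongrightarrow> f z"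
    proof (rule tendstoI)
      fix d :: real assume "d > 0"
      then have "d / 2 > 0" by simp
      obtain \<delta> where \<delta>: "\<delta> > 0" "\<And>y. y \<in> cball z e \<Longrightarrow> dist y z < \<delta> \<Longrightarrow> dist (f y) (f z) < d / 2"
        using cont \<open>d / 2 > 0\<close> unfolding continuous_within_eps_delta by meson
      show "\<forall>\<^sub>F n in sequentially. dist (papp (A (r (q n))) (x (q n))) (f z) < d"
        using inK uniform_limitD[OF ul \<open>d / 2 > 0\<close>] tendstoD[OF xq \<delta>(1)]
      proof eventually_elim
        case (elim n)
        then show ?case using \<delta>(2)[of "x (q n)"] dist_triangle_half_r
          by (meson dist_triangle_half_l dist_commute_lessI)
      qed
    qed
    then show ?thesis using lim LIMSEQ_unique by blast
  qed
  have "cp2_of (s + 0 *s (T *v u)) = cp2_of (s + 1 *s (T *v u))" using fz[of 0] fz[of 1] by simp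
  then show False using affine_points_distinct(2)[OF rs(2)] zero_neq_one by blast
qed

text \<open>A sequence in the group either repeats one element infinitely often or escapes. In the
  second case a rescaled limit \<open>T\<close> provides the limit map, since \<open>papp T\<close>
  is continuous off its kernel.\<close>

lemma equicontinuity_set_eq: "equicontinuity_set \<Gamma> = - KER"
proof
  show "equicontinuity_set \<Gamma> \<subseteq> - KER" using equicontinuity_set_disjoint_KER by blast
  have "normal_family_on (act ` \<Gamma>) (- KER)"
    unfolding normal_family_on_def
  proof (intro allI impI)
    fix s :: "nat \<Rightarrow> cp2 \<Rightarrow> cp2" assume s: "range s \<subseteq> act ` \<Gamma>"
    have "\<exists>A. A \<in> G \<and> s n = papp A" for n
    proof -
      obtain g where g: "g \<in> \<Gamma>" "s n = act g" using s by blast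
      then show ?thesis using \<Gamma>_lift[OF g(1)] act_papp by metis
    qed
    then obtain A where A: "\<And>n. A n \<in> G" "\<And>n. s n = papp (A n)" by metis
    show "\<exists>r f. strict_mono r \<and> (\<forall>K. compact K \<and> K \<subseteq> - KER \<longrightarrow> uniform_limit K (s \<circ> r) f sequentially)"
    proof (cases "escaping A")
      case False
      then obtain B where "\<not> (\<forall>\<^sub>F n in sequentially. A n \<noteq> B)" using A(1) by (auto simp: escaping_def)
      then have "infinite {n. A n = B}"
        unfolding cofinite_eq_sequentially[symmetric] eventually_cofinite by simp
      then obtain r :: "nat \<Rightarrow> nat" where r: "strict_mono r" "\<forall>n. r n \<in> {n. A n = B}"
        using infinite_enumerate by blast
      then have "s \<circ> r = (\<lambda>n. papp B)" using A(2) by (auto simp: fun_eq_iff)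
      then show ?thesis using r(1) uniform_limit_const by metis
    next
      case True
      then obtain r T where r: "strict_mono r" "limit_of (A \<circ> r) T" using escaping_limit by blast
      have "uniform_limit K (s \<circ> r) (papp T) sequentially" if K: "compact K" "K \<subseteq> - KER" for K
      proof (rule uniform_limit_on_compactI[OF K(1)])
        have out: "x \<notin> pker T" if "x \<in> K" for x using KER_I[OF r(2)] K(2) that by blast
        show "(\<lambda>n. (s \<circ> r) (\<sigma> n) (z n)) \<longlonglongrightarrow> papp T x" if "strict_mono \<sigma>" "x \<in> K" "z \<longlonglongrightarrow> x" for \<sigma> z x
          using limit_of_papp[OF limit_of_subseq[OF r(2) that(1)] that(3) out[OF that(2)]] by (simp add: A(2))
        show "(\<lambda>n. papp T (z n)) \<longlonglongrightarrow> papp T x" if "x \<in> K" "z \<longlonglongrightarrow> x" for z x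
          using papp_tendsto[of "\<lambda>_. 1" "\<lambda>_. T" T z x] out[OF that(1)] that(2) by simp
      qed
      then show ?thesis using r(1) by blast
    qed
  qed
  moreover have "open (- KER)" using closed_KER by blast
  ultimately show "- KER \<subseteq> equicontinuity_set \<Gamma>" unfolding equicontinuity_set_def by blast
qed

text \<open>A finite supremum of cardinalities is attained, and a configuration attaining it cannot
  be extended by a further omitted line; this is the maximality that excludes five lines. The given
  line \<open>L\<close> excludes the value 0.\<close>

lemma LiG_of_invariant:
  assumes ker: "- \<Omega> \<subseteq> KER" and inv: "invariant (- \<Omega>)" and line: "complex_line L" "L \<subseteq> - \<Omega>"
  shows "LiG \<Omega> \<in> {1, 2, 3, 4, \<infinity>}"
proof (cases "LiG \<Omega> = \<infinity>")
  case False
  define C where "C = {S. finite S \<and> (\<forall>L\<in>S. complex_line L) \<and> general_position S \<and> \<Union>S \<subseteq> - \<Omega>}"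
  have LiG: "LiG \<Omega> = Sup ((\<lambda>S. enat (card S)) ` C)"
    unfolding LiG_def C_def by (simp only: setcompr_eq_image)
  have ub: "enat (card S) \<le> LiG \<Omega>" if "S \<in> C" for S
    unfolding LiG using that by (intro Sup_upper) blast
  have "{L} \<in> C" using line by (auto simp: C_def general_position_def)
  then have one: "1 \<le> LiG \<Omega>" and ne: "C \<noteq> {}" using ub[of "{L}"] by (auto simp: one_enat_def)
  obtain k where k: "LiG \<Omega> = enat k" using False by auto
  have "(\<lambda>S. enat (card S)) ` C \<subseteq> enat ` {..k}" using ub k by auto
  then have "finite ((\<lambda>S. enat (card S)) ` C)" by (rule finite_subset) simp
  then have "LiG \<Omega> \<in> (\<lambda>S. enat (card S)) ` C"
    unfolding LiG using ne Max_in[of "(\<lambda>S. enat (card S)) ` C"] by (simp add: Sup_enat_def)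
  then obtain S where S: "S \<in> C" "LiG \<Omega> = enat (card S)" by blast
  have max: "\<not> general_position (insert L S)" if L: "complex_line L" "L \<subseteq> - \<Omega>" "L \<notin> S" for L
  proof
    assume "general_position (insert L S)"
    then have "insert L S \<in> C" using S(1) L by (auto simp: C_def)
    from ub[OF this] show False using S L(3) by (auto simp: C_def)
  qed
  have "\<not> 5 \<le> card S"
  proof
    assume "5 \<le> card S"
    then show False
      using five_lines_not_maximal[of "- \<Omega>" S] inv ker S(1) max unfolding invariant_def C_def by blast
  qed
  moreover have "1 \<le> card S" using one S(2) by (simp add: one_enat_def)
  ultimately have "card S \<in> {1, 2, 3, 4}" by auto
  then show ?thesis using S(2) by (auto simp: one_enat_def numeral_eq_enat)
qed simp

end

theorem theorem0p2:
  fixes \<Gamma> :: "(complex^3^3) set set" and \<Omega> :: "cp2 set"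
  assumes "discrete_subgroup \<Gamma>" and "infinite \<Gamma>"
    and "\<Omega> = equicontinuity_set \<Gamma> \<or> \<Omega> = kulkarni_region \<Gamma> \<or> maximal_proper_region \<Gamma> \<Omega>"
  shows "LiG \<Omega> \<in> {1, 2, 3, 4, \<infinity>}"
proof -
  interpret psl3_discrete \<Gamma> by unfold_locales (fact assms)+
  have "- \<Omega> \<subseteq> KER \<and> invariant (- \<Omega>) \<and> open \<Omega> \<and> wandering \<Omega>"
    using assms(3)
  proof (elim disjE)
    assume "\<Omega> = equicontinuity_set \<Gamma>"
    then have "\<Omega> = - KER" by (simp add: equicontinuity_set_eq)
    then show ?thesis using invariant_KER closed_KER wandering_Compl_KER by auto
  next
    assume "\<Omega> = kulkarni_region \<Gamma>"
    then show ?thesis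
      using kulkarni_L0_KER kulkarni_L1_KER kulkarni_L2_KER kulkarni_invariant
        open_kulkarni_region wandering_kulkarni
      by (auto simp: kulkarni_region_def kulkarni_limit_set_def)
  next
    assume max: "maximal_proper_region \<Gamma> \<Omega>"
    then have "proper_region \<Gamma> \<Omega>" by (simp add: maximal_proper_region_def)
    then show ?thesis
      using maximal_region_contains[OF max] proper_region_invariant proper_region_wandering
        invariant_Compl by (auto simp: proper_region_def)
  qed
  then obtain L where "complex_line L" "L \<subseteq> - \<Omega>" "- \<Omega> \<subseteq> KER" "invariant (- \<Omega>)"
    using wandering_line by blast
  then show ?thesis using LiG_of_invariant by blast
qed

end
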